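(* Let $I$ be an ideal in $\hat{\mathcal O}=\mathbb C[[x_1,\ldots,x_n]]$. Then the local tropical variety of $I$, $$\mathcal T_{\mathrm{loc}}(I)=\{w\in\mathcal U_{\mathrm{loc}}\mid \mathrm{in}_w(I)\subset\mathrm{Gr}^w(\hat{\mathcal O})\text{ contains no monomials}\},$$ is a subfan of the local Gröbner fan $\mathrm{LGF}(I)$ of $I$.
   Context: Let $\mathcal U_{\mathrm{loc}}=\{u\in\mathbb R^n\mid u_i\ge 0\ \forall i\}$. For $f=\sum_\alpha p_\alpha x^\alpha\in\hat{\mathcal O}$ put $\mathrm{Supp}(f)=\{\alpha\in\mathbb N^n\mid p_\alpha\ne0\}$. For $u\in\mathcal U_{\mathrm{loc}}$, $\mathrm{wei}^u(f)=\min_{\alpha\in\mathrm{Supp}(f)}u\cdot\alpha$, $F^u_k=\{f\mid \mathrm{wei}^u(f)\ge k\}$, $F^u_{>k}=\{f\mid\mathrm{wei}^u(f)>k\}$, $\mathrm{Gr}^u(\hat{\mathcal O})=\bigoplus_k F^u_k/F^u_{>k}$, and $\mathrm{in}_u(f)$ is the class of $f$ in $F^u_k/F^u_{>k}$ with $k=\mathrm{wei}^u(f)$ (and $\mathrm{in}_u(0)=0$). $\mathrm{Gr}^u(\hat{\mathcal O})$ is identified with a subring of $\hat{\mathcal O}$, so that $\mathrm{in}_u(f)$ is the sum of the terms $p_\alpha x^\alpha$ of $f$ with $u\cdot\alpha=\mathrm{wei}^u(f)$. $\mathrm{in}_u(I)$ is the ideal of $\mathrm{Gr}^u(\hat{\mathcal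 O})$ generated by all $\mathrm{in}_u(f)$, $f\in I$. A monomial is an element $c\,x^\alpha$ with $c\in\mathbb C\setminus\{0\}$. Local Gröbner fan: for $u,u'\in\mathcal U_{\mathrm{loc}}$ write $u\sim u'$ if $\{i\mid u_i\ne0\}=\{i\mid u'_i\ne0\}$ (equivalently $\mathrm{Gr}^u(\hat{\mathcal O})=\mathrm{Gr}^{u'}(\hat{\mathcal O})$) and $\mathrm{in}_u(I)=\mathrm{in}_{u'}(I)$. The equivalence class $\mathcal C[u]$ is called a local open Gröbner cone of $I$, and $\mathrm{LGF}(I)=\{\overline{\mathcal C[u]}\mid u\in\mathcal U_{\mathrm{loc}}\}$ is the set of closures; it is a polyhedral fan (Bahloul–Takayama). That a subset of $\mathcal U_{\mathrm{loc}}$ is a subfan of $\mathrm{LGF}(I)$ means that it is the union of the cones in a subcollection of $\mathrm{LGF}(I)$ which is itself a polyhedral fan. Local tropical variety: $\mathcal T_{\mathrm{loc}}(I)=\bigcup_{\lambda\in\Lambda}\Bigl(\bigl(\bigcap_{f\in I}\overline{\mathrm{ord}(V(\widehat f^{\lambda}))}\bigr)\cap\mathcal U^{\lambda}_{\mathrm{loc}}\Bigr)$, where: $\Lambda=\{0,1,\ldots,n,12,13,\ldots,123\cdots n\}$ indexes all subsets $J\subset\{1,\ldots,n\}$ ($\lambda=0$ corresponds to $J=\emptyset$, otherwise $\lambda$ lists the elements of $J$), and $\mathcal U^\lambda_{\mathrm{loc}}=\{u\in\mathbb R^n\mid u_j=0\text{ for }j\in J,\ u_i>0\text{ for }i\notin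 J\}$. For $f=\sum_\alpha p_\alpha x^\alpha$ and $J\ne\{1,\ldots,n\}$ let $\pi_J:\mathbb N^n\to\mathbb N^{\{1,\ldots,n\}\setminus J}$ be the projection forgetting the coordinates in $J$, and let $\{\beta^1,\ldots,\beta^l\}$ be the finite minimal subset of $\pi_J(\mathrm{Supp}(f))$ with $\{\beta^1,\ldots,\beta^l\}+\mathbb N^{\{1,\ldots,n\}\setminus J}=\pi_J(\mathrm{Supp}(f))+\mathbb N^{\{1,\ldots,n\}\setminus J}$. Put $E^i=\{\alpha\in\mathrm{Supp}(f)\mid\pi_J(\alpha)=\beta^i\}$; if $\sharp E^i=1$ let $A^i=E^i$; if $\sharp E^i\ge2$ let $A^i$ be a chosen two-element subset of $E^i$. Then $\widehat f^\lambda=\sum_{\alpha\in A^1\cup\cdots\cup A^l}p_\alpha x^\alpha\in\mathbb C[x_1,\ldots,x_n]$. For $J=\{1,\ldots,n\}$, $\widehat f^\lambda=0$. The choices are made once for each $f$ and $\lambda$. With $K=\mathbb C\{\{t\}\}$ the field of Puiseux series, $V(g)=\{v\in(K\setminus\{0\})^n\mid g(v)=0\}$ for $g\in\mathbb C[x]$; $\mathrm{ord}:(K\setminus\{0\})^n\to\mathbb Q^n\subset\mathbb R^n$ takes each coordinate to its order (lowest exponent), and the overline denotes topological closure in $\mathbb R^n$.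
   Formalization: The displayed equality is asserted only when I contains no monomial; if I contains one (e.g. I=(1)), the local tropical variety is {0} while the right-hand set is empty, so the equality fails at w=0. The subfan claim holds for every I. *)

theory Defs
  imports
    "HOL-Analysis.Analysis"
    "HOL-Computational_Algebra.Formal_Laurent_Series"
    "HOL-Algebra.Subrings"
begin

no_notation fps_nth (infixl "$" 75)

section \<open>The field of Puiseux series\<close>

text \<open>
  A pair \<open>(N, F)\<close> with \<open>N > 0\<close> stands for the Puiseux series \<open>F(t\<^bsup>1/N\<^esup>)\<close>. Two pairs
  \<open>(N, F)\<close> and \<open>(M, G)\<close> denote the same series iff \<open>F(s\<^bsup>M\<^esup>) = G(s\<^bsup>N\<^esup>)\<close> where \<open>s = t\<^bsup>1/(NM)\<^esup>\<close>.
  The quotient is the union of the fields of formal Laurent series in \<open>t\<^bsup>1/N\<^esup>\<close>, \<open>N \<ge> 1\<close>.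
\<close>

definition puiseux_rel :: "nat \<times> complex fls \<Rightarrow> nat \<times> complex fls \<Rightarrow> bool" where
  "puiseux_rel p q \<longleftrightarrow> fst p > 0 \<and> fst q > 0 \<and>
     fls_compose_power (snd p) (fst q) = fls_compose_power (snd q) (fst p)"

lemma fcp_fcp:
  "a > 0 \<Longrightarrow> b > 0 \<Longrightarrow>
     fls_compose_power (fls_compose_power F a) b = fls_compose_power F (a * b)"
proof (rule fls_eqI)
  fix n assume ab: "a > 0" "b > 0"
  have "int a * int b dvd n \<longleftrightarrow> int b dvd n \<and> int a dvd n div int b"
    using ab by (metis dvd_mult_left dvd_mult_imp_div dvd_div_iff_mult mult.commute of_nat_0_less_iff less_irrefl)
  then show "fls_nth (fls_compose_power (fls_compose_power F a) b) n = fls_nth (fls_compose_power F (a * b)) n"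
    using ab by (auto simp: fls_nth_compose_power div_mult2_eq mult.commute zdiv_zmult2_eq)
qed

lemma fcp_inj:
  assumes "d > 0" "fls_compose_power F d = fls_compose_power G d" shows "F = G"
proof (rule fls_eqI)
  fix n
  have "fls_nth (fls_compose_power F d) (int d * n) = fls_nth (fls_compose_power G d) (int d * n)"
    using assms by simp
  then show "fls_nth F n = fls_nth G n" using assms(1) by (simp add: fls_nth_compose_power)
qed

lemma fcp_eq_0_iff [simp]: "d > 0 \<Longrightarrow> fls_compose_power F d = 0 \<longleftrightarrow> F = 0"
  using fcp_inj[of d F 0] by auto

lemma fcp_inverse [simp]:
  fixes F :: "complex fls"
  assumes "d > 0" shows "fls_compose_power (inverse F) d = inverse (fls_compose_power F d)"
proof (cases "F = 0")
  case False
  have "fls_compose_power F d * fls_compose_power (inverse F) d = fls_compose_power (F * inverse F) d"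
    by simp
  also have "\<dots> = 1" using False assms by simp
  finally show ?thesis by (metis inverse_unique)
qed simp

lemma fcp_subdegree:
  assumes d: "d > 0" shows "fls_subdegree (fls_compose_power F d) = int d * fls_subdegree F"
proof (cases "F = 0")
  case False
  show ?thesis
  proof (rule fls_subdegree_eqI)
    show "fls_nth (fls_compose_power F d) (int d * fls_subdegree F) \<noteq> 0"
      using False d by (simp add: fls_nth_compose_power)
    fix k assume k: "k < int d * fls_subdegree F"
    show "fls_nth (fls_compose_power F d) k = 0"
    proof (cases "int d dvd k")
      case True
      then obtain m where "k = int d * m" by auto
      with k d show ?thesis by (simp add: fls_nth_compose_power)
    qed (use d in \<open>simp add: fls_nth_compose_power\<close>)
  qed
qed simp

quotient_type puiseux = "nat \<times> complex fls" / partial: puiseux_rel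
proof (rule part_equivpI)
  show "\<exists>x. puiseux_rel x x" by (rule exI[of _ "(1, 0)"]) (simp add: puiseux_rel_def)
  show "symp puiseux_rel" by (auto simp: symp_def puiseux_rel_def)
  show "transp puiseux_rel"
  proof (rule transpI)
    fix x y z assume xy: "puiseux_rel x y" and yz: "puiseux_rel y z"
    obtain N F M G L H where e: "x = (N, F)" "y = (M, G)" "z = (L, H)" by (metis surj_pair)
    have p: "N > 0" "M > 0" "L > 0"
      and 1: "fls_compose_power F M = fls_compose_power G N"
      and 2: "fls_compose_power G L = fls_compose_power H M"
      using xy yz by (auto simp: e puiseux_rel_def)
    have "fls_compose_power (fls_compose_power F L) M = fls_compose_power (fls_compose_power F M) L"
      using p by (simp add: fcp_fcp mult.commute)
    also have "\<dots> = fls_compose_power (fls_compose_power G L) N"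
      using p by (simp add: 1 fcp_fcp mult.commute)
    also have "\<dots> = fls_compose_power (fls_compose_power H N) M"
      using p by (simp add: 2 fcp_fcp mult.commute)
    finally show "puiseux_rel x z" using p fcp_inj by (auto simp: e puiseux_rel_def)
  qed
qed

lemma puiseux_relI:
  assumes "N > 0" "M > 0" "fls_compose_power F M = fls_compose_power G N"
  shows "puiseux_rel (N, F) (M, G)"
  using assms by (simp add: puiseux_rel_def)

lemma puiseux_rel_cross:
  assumes "puiseux_rel (N, F) (N', F')" "k > 0"
  shows "fls_compose_power F (N' * k) = fls_compose_power F' (N * k)"
  using assms by (simp add: puiseux_rel_def flip: fcp_fcp)

instantiation puiseux :: field
begin

lift_definition zero_puiseux :: puiseux is "(1, 0)" by (simp add: puiseux_rel_def)

lift_definition one_puiseux :: puiseux is "(1, 1)" by (simp add: puiseux_rel_def)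

lift_definition plus_puiseux :: "puiseux \<Rightarrow> puiseux \<Rightarrow> puiseux" is
  "\<lambda>(N, F) (M, G). (N * M, fls_compose_power F M + fls_compose_power G N)"
proof clarsimp
  fix N F N' F' M G M' G'
  assume r: "puiseux_rel (N, F) (N', F')" "puiseux_rel (M, G) (M', G')"
  then have p: "N > 0" "N' > 0" "M > 0" "M' > 0" by (auto simp: puiseux_rel_def)
  show "puiseux_rel (N * M, fls_compose_power F M + fls_compose_power G N)
          (N' * M', fls_compose_power F' M' + fls_compose_power G' N')"
    using p puiseux_rel_cross[OF r(1), of "M * M'"] puiseux_rel_cross[OF r(2), of "N * N'"]
    by (intro puiseux_relI) (auto simp: fcp_fcp ac_simps)
qed

lift_definition uminus_puiseux :: "puiseux \<Rightarrow> puiseux" is "\<lambda>(N, F). (N, - F)"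
  by (auto simp: puiseux_rel_def)

lift_definition times_puiseux :: "puiseux \<Rightarrow> puiseux \<Rightarrow> puiseux" is
  "\<lambda>(N, F) (M, G). (N * M, fls_compose_power F M * fls_compose_power G N)"
proof clarsimp
  fix N F N' F' M G M' G'
  assume r: "puiseux_rel (N, F) (N', F')" "puiseux_rel (M, G) (M', G')"
  then have p: "N > 0" "N' > 0" "M > 0" "M' > 0" by (auto simp: puiseux_rel_def)
  show "puiseux_rel (N * M, fls_compose_power F M * fls_compose_power G N)
          (N' * M', fls_compose_power F' M' * fls_compose_power G' N')"
    using p puiseux_rel_cross[OF r(1), of "M * M'"] puiseux_rel_cross[OF r(2), of "N * N'"]
    by (intro puiseux_relI) (auto simp: fcp_fcp ac_simps)
qed

lift_definition inverse_puiseux :: "puiseux \<Rightarrow> puiseux" is "\<lambda>(N, F). (N, inverse F)"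
  by (auto simp: puiseux_rel_def)

definition minus_puiseux :: "puiseux \<Rightarrow> puiseux \<Rightarrow> puiseux" where
  "minus_puiseux x y = x + - y"

definition divide_puiseux :: "puiseux \<Rightarrow> puiseux \<Rightarrow> puiseux" where
  "divide_puiseux x y = x * inverse y"

instance
proof
  fix a b c :: puiseux
  show "a + b + c = a + (b + c)"
    by transfer (auto simp: puiseux_rel_def fcp_fcp ac_simps)
  show "a + b = b + a"
    by transfer (auto simp: puiseux_rel_def fcp_fcp ac_simps)
  show "0 + a = a"
    by transfer (auto simp: puiseux_rel_def fcp_fcp)
  show "- a + a = 0"
    by transfer (auto simp: puiseux_rel_def fcp_fcp)
  show "a - b = a + - b" by (rule minus_puiseux_def)
  show "a * b * c = a * (b * c)"
    by transfer (auto simp: puiseux_rel_def fcp_fcp ac_simps)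
  show "a * b = b * a"
    by transfer (auto simp: puiseux_rel_def fcp_fcp ac_simps)
  show "1 * a = a"
    by transfer (auto simp: puiseux_rel_def fcp_fcp)
  show "(a + b) * c = a * c + b * c"
    by transfer (auto simp: puiseux_rel_def fcp_fcp algebra_simps)
  show "(0::puiseux) \<noteq> 1" by transfer (simp add: puiseux_rel_def)
  show "inverse a * a = 1" if "a \<noteq> 0"
    using that by transfer (auto simp: puiseux_rel_def fcp_fcp)
  show "a div b = a * inverse b" by (rule divide_puiseux_def)
  show "inverse (0::puiseux) = 0" by transfer (simp add: puiseux_rel_def)
qed

end

lift_definition puiseux_const :: "complex \<Rightarrow> puiseux" is "\<lambda>c. (1, fls_const c)"
  by (simp add: puiseux_rel_def)

text \<open>Only the value on nonzero series matters.\<close>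

lift_definition puiseux_ord :: "puiseux \<Rightarrow> rat" is
  "\<lambda>(N, F). of_int (fls_subdegree F) / of_nat N"
proof clarsimp
  fix N F M G assume r: "puiseux_rel (N, F) (M, G)"
  then have p: "N > 0" "M > 0" by (auto simp: puiseux_rel_def)
  have "int M * fls_subdegree F = int N * fls_subdegree G"
    using r p by (metis puiseux_rel_def fcp_subdegree fst_conv snd_conv)
  then have "rat_of_int (int M * fls_subdegree F) = rat_of_int (int N * fls_subdegree G)"
    by simp
  then show "rat_of_int (fls_subdegree F) / of_nat N = of_int (fls_subdegree G) / of_nat M"
    using p by (simp add: field_simps)
qed


section \<open>Formal power series in several variables\<close>

text \<open>
  The variables are indexed by the finite type \<open>'n\<close>; a series is its coefficient function
  on \<open>\<nat>\<^sup>n\<close>, and \<open>pow_ring\<close> is the ring \<open>\<complex>[[x\<^sub>1,\<dots>,x\<^sub>n]]\<close>.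
\<close>

type_synonym 'n pow = "nat ^ 'n \<Rightarrow> complex"

definition pow_mult :: "'n::finite pow \<Rightarrow> 'n pow \<Rightarrow> 'n pow" where
  "pow_mult f g = (\<lambda>\<gamma>. \<Sum>(\<alpha>, \<beta>) \<in> {(\<alpha>, \<beta>). \<alpha> + \<beta> = \<gamma>}. f \<alpha> * g \<beta>)"

definition pow_ring :: "'n::finite pow ring" where
  "pow_ring = \<lparr> carrier = UNIV, mult = pow_mult, one = (\<lambda>\<alpha>. if \<alpha> = 0 then 1 else 0),
                zero = (\<lambda>\<alpha>. 0), add = (\<lambda>f g \<alpha>. f \<alpha> + g \<alpha>) \<rparr>"

lemma finite_vec_le: "finite {\<alpha> :: nat ^ 'n::finite. \<alpha> \<le> \<gamma>}"
proof -
  have "{\<alpha>. \<alpha> \<le> \<gamma>} \<subseteq> vec_lambda ` (\<Pi>\<^sub>E i\<in>UNIV. {..\<gamma> $ i})"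
  proof
    fix \<alpha> assume "\<alpha> \<in> {\<alpha>. \<alpha> \<le> \<gamma>}"
    then have "vec_nth \<alpha> \<in> (\<Pi>\<^sub>E i\<in>UNIV. {..\<gamma> $ i})" by (auto simp: less_eq_vec_def)
    then show "\<alpha> \<in> vec_lambda ` (\<Pi>\<^sub>E i\<in>UNIV. {..\<gamma> $ i})"
      by (metis image_eqI vec_nth_inverse)
  qed
  then show ?thesis by (rule finite_subset) (intro finite_imageI finite_PiE, auto)
qed

lemma finite_antidiag: "finite {(\<alpha>, \<beta>). \<alpha> + \<beta> = (\<gamma> :: nat ^ 'n::finite)}"
  by (rule finite_subset[OF _ finite_cartesian_product[OF finite_vec_le[of \<gamma>] finite_vec_le[of \<gamma>]]])
     (auto simp: less_eq_vec_def)

lemma pow_mult_assoc: "pow_mult (pow_mult f g) h = pow_mult f (pow_mult g h)"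
proof
  fix \<gamma> :: "nat ^ 'a"
  let ?D = "\<lambda>\<gamma> :: nat ^ 'a. {(\<alpha>, \<beta>). \<alpha> + \<beta> = \<gamma>}"
  have "pow_mult (pow_mult f g) h \<gamma> =
      (\<Sum>p\<in>?D \<gamma>. \<Sum>q\<in>?D (fst p). f (fst q) * g (snd q) * h (snd p))"
    by (simp add: pow_mult_def sum_distrib_right case_prod_unfold)
  also have "\<dots> = (\<Sum>(p, q)\<in>(SIGMA p:?D \<gamma>. ?D (fst p)). f (fst q) * g (snd q) * h (snd p))"
    by (rule sum.Sigma) (use finite_antidiag in auto)
  also have "\<dots> = (\<Sum>(p, q)\<in>(SIGMA p:?D \<gamma>. ?D (snd p)). f (fst p) * (g (fst q) * h (snd q)))"
    by (rule sum.reindex_bij_witness[where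
          i = "\<lambda>(p, q). ((fst p + fst q, snd q), (fst p, fst q))" and
          j = "\<lambda>(p, q). ((fst q, snd q + snd p), (snd q, snd p))"])
       (auto simp: ac_simps)
  also have "\<dots> = (\<Sum>p\<in>?D \<gamma>. \<Sum>q\<in>?D (snd p). f (fst p) * (g (fst q) * h (snd q)))"
    by (rule sum.Sigma[symmetric]) (use finite_antidiag in auto)
  also have "\<dots> = pow_mult f (pow_mult g h) \<gamma>"
    by (simp add: pow_mult_def sum_distrib_left case_prod_unfold)
  finally show "pow_mult (pow_mult f g) h \<gamma> = pow_mult f (pow_mult g h) \<gamma>" .
qed

lemma pow_mult_comm: "pow_mult f g = pow_mult g f"
  unfolding pow_mult_def
  by (rule ext, rule sum.reindex_bij_witness[where i = prod.swap and j = prod.swap])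
     (auto simp: ac_simps)

lemma pow_mult_one:
  fixes f :: "'n::finite pow"
  shows "pow_mult (\<lambda>\<alpha>. if \<alpha> = 0 then 1 else 0) f = f"
proof
  fix \<gamma>
  have "pow_mult (\<lambda>\<alpha>. if \<alpha> = 0 then 1 else 0) f \<gamma> =
      (\<Sum>(\<alpha>, \<beta>)\<in>{(0 :: nat ^ 'n, \<gamma>)}. (if \<alpha> = 0 then 1 else 0) * f \<beta>)"
    unfolding pow_mult_def by (rule sum.mono_neutral_right) (auto simp: finite_antidiag split: if_splits)
  then show "pow_mult (\<lambda>\<alpha>. if \<alpha> = 0 then 1 else 0) f \<gamma> = f \<gamma>" by simp
qed

lemma pow_mult_distrib: "pow_mult (\<lambda>\<alpha>. f \<alpha> + g \<alpha>) h = (\<lambda>\<alpha>. pow_mult f h \<alpha> + pow_mult g h \<alpha>)"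
  by (simp add: pow_mult_def algebra_simps sum.distrib case_prod_unfold)

lemma pow_ring_simps [simp]:
  "carrier pow_ring = UNIV" "mult pow_ring = pow_mult"
  "one pow_ring = (\<lambda>\<alpha>. if \<alpha> = 0 then 1 else 0)" "zero pow_ring = (\<lambda>\<alpha>. 0)"
  "add pow_ring f g = (\<lambda>\<alpha>. f \<alpha> + g \<alpha>)"
  by (simp_all add: pow_ring_def)

lemma cring_pow_ring: "cring (pow_ring :: 'n::finite pow ring)"
proof (rule cringI)
  show "abelian_group (pow_ring :: 'n pow ring)"
  proof (rule abelian_groupI)
    fix f :: "'n pow"
    show "\<exists>g\<in>carrier pow_ring. g \<oplus>\<^bsub>pow_ring\<^esub> f = \<zero>\<^bsub>pow_ring\<^esub>"
      by (rule bexI[of _ "\<lambda>\<alpha>. - f \<alpha>"]) auto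
  qed (auto simp: ac_simps)
  show "Group.comm_monoid (pow_ring :: 'n pow ring)"
    by (rule comm_monoidI) (auto simp: pow_mult_assoc pow_mult_one intro: pow_mult_comm)
qed (auto simp: pow_mult_distrib)

definition supp :: "'n::finite pow \<Rightarrow> (nat ^ 'n) set" where
  "supp f = {\<alpha>. f \<alpha> \<noteq> 0}"

definition is_monomial :: "'n::finite pow \<Rightarrow> bool" where
  "is_monomial m \<longleftrightarrow> (\<exists>c \<alpha>. c \<noteq> 0 \<and> m = (\<lambda>\<beta>. if \<beta> = \<alpha> then c else 0))"


section \<open>Weights and initial ideals\<close>

definition U_loc :: "(real ^ 'n::finite) set" where
  "U_loc = {u. \<forall>i. 0 \<le> u $ i}"

definition wdot :: "real ^ 'n::finite \<Rightarrow> nat ^ 'n \<Rightarrow> real" where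
  "wdot u \<alpha> = (\<Sum>i\<in>UNIV. u $ i * real (\<alpha> $ i))"

text \<open>
  The infimum is attained for nonzero \<open>f\<close> (lemma \<open>wei_attained\<close>), and is \<open>\<infinity>\<close> for \<open>f = 0\<close>.
\<close>

definition wei :: "real ^ 'n::finite \<Rightarrow> 'n pow \<Rightarrow> ereal" where
  "wei u f = (INF \<alpha>\<in>supp f. ereal (wdot u \<alpha>))"

definition filt_ge :: "real ^ 'n::finite \<Rightarrow> real \<Rightarrow> 'n pow set" where
  "filt_ge u k = {f. wei u f \<ge> ereal k}"

definition filt_gt :: "real ^ 'n::finite \<Rightarrow> real \<Rightarrow> 'n pow set" where
  "filt_gt u k = {f. wei u f > ereal k}"

text \<open>
  The \<open>u\<close>-homogeneous series of weight \<open>k\<close>. They form a system of representatives of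
  the quotient of \<open>filt_ge u k\<close> by \<open>filt_gt u k\<close> (lemma \<open>filt_quotient_representative\<close>); through
  it the associated graded ring becomes the subring \<open>gr_ring u\<close> of \<open>pow_ring\<close>.
\<close>

definition gr_part :: "real ^ 'n::finite \<Rightarrow> real \<Rightarrow> 'n pow set" where
  "gr_part u k = {f. \<forall>\<alpha>\<in>supp f. wdot u \<alpha> = k}"

definition gr_carrier :: "real ^ 'n::finite \<Rightarrow> 'n pow set" where
  "gr_carrier u = {(\<lambda>\<alpha>. \<Sum>k\<in>K. h k \<alpha>) | K h. finite K \<and> (\<forall>k\<in>K. h k \<in> gr_part u k)}"

definition gr_ring :: "real ^ 'n::finite \<Rightarrow> 'n pow ring" where
  "gr_ring u = pow_ring \<lparr> carrier := gr_carrier u \<rparr>"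

definition in_form :: "real ^ 'n::finite \<Rightarrow> 'n pow \<Rightarrow> 'n pow" where
  "in_form u f = (\<lambda>\<alpha>. if ereal (wdot u \<alpha>) = wei u f then f \<alpha> else 0)"

definition in_ideal :: "real ^ 'n::finite \<Rightarrow> 'n pow set \<Rightarrow> 'n pow set" where
  "in_ideal u I = Idl\<^bsub>gr_ring u\<^esub> (in_form u ` I)"

lemma finite_weights_below:
  fixes u :: "real ^ 'n::finite"
  assumes u: "u \<in> U_loc" shows "finite {wdot u \<alpha> | \<alpha>. wdot u \<alpha> \<le> c}"
proof -
  define m where "m = Min (insert 1 {u $ i | i. u $ i > 0})"
  have fin: "finite (insert 1 {u $ i | i. u $ i > 0})" by simp
  have m0: "m > 0" unfolding m_def using fin by (subst Min_gr_iff) auto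
  have mle: "m \<le> u $ i" if "u $ i > 0" for i
    unfolding m_def by (rule Min_le[OF fin]) (use that in auto)
  define b where "b = nat \<lceil>c / m\<rceil>"
  have "{wdot u \<alpha> | \<alpha>. wdot u \<alpha> \<le> c} \<subseteq> wdot u ` {\<alpha>. \<alpha> \<le> (\<chi> i. b)}"
  proof
    fix x assume "x \<in> {wdot u \<alpha> | \<alpha>. wdot u \<alpha> \<le> c}"
    then obtain \<alpha> where x: "x = wdot u \<alpha>" and c: "wdot u \<alpha> \<le> c" by blast
    define \<beta> where "\<beta> = (\<chi> i. if u $ i > 0 then \<alpha> $ i else 0)"
    have eq: "wdot u \<alpha> = wdot u \<beta>"
      unfolding wdot_def \<beta>_def using u by (intro sum.cong) (auto simp: U_loc_def less_le)
    have "\<beta> $ i \<le> b" for i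
    proof (cases "u $ i > 0")
      case True
      have "m * real (\<alpha> $ i) \<le> u $ i * real (\<alpha> $ i)"
        using mle[OF True] by (intro mult_right_mono) auto
      also have "\<dots> \<le> wdot u \<alpha>" unfolding wdot_def
        using u by (intro member_le_sum) (auto simp: U_loc_def)
      finally have "real (\<alpha> $ i) \<le> c / m" using c m0 by (simp add: field_simps)
      then show ?thesis using True unfolding b_def \<beta>_def by simp linarith
    qed (simp add: \<beta>_def)
    then show "x \<in> wdot u ` {\<alpha>. \<alpha> \<le> (\<chi> i. b)}" using x eq by (auto simp: less_eq_vec_def)
  qed
  then show ?thesis by (rule finite_subset) (intro finite_imageI finite_vec_le)
qed

lemma wei_attained:
  assumes "u \<in> U_loc" "supp f \<noteq> {}"
  obtains \<alpha> where "\<alpha> \<in> supp f" "wei u f = ereal (wdot u \<alpha>)"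
    "\<And>\<beta>. \<beta> \<in> supp f \<Longrightarrow> wdot u \<alpha> \<le> wdot u \<beta>"
proof -
  obtain \<alpha>0 where a0: "\<alpha>0 \<in> supp f" using assms by blast
  define W where "W = wdot u ` {\<alpha> \<in> supp f. wdot u \<alpha> \<le> wdot u \<alpha>0}"
  have finW: "finite W"
    by (rule finite_subset[OF _ finite_weights_below[OF assms(1), of "wdot u \<alpha>0"]])
       (auto simp: W_def)
  have "W \<noteq> {}" using a0 by (auto simp: W_def)
  with finW have "Min W \<in> W" by simp
  then obtain \<alpha> where a: "\<alpha> \<in> supp f" "wdot u \<alpha> \<le> wdot u \<alpha>0" "Min W = wdot u \<alpha>"
    by (auto simp: W_def)
  have le: "wdot u \<alpha> \<le> wdot u \<beta>" if "\<beta> \<in> supp f" for \<beta>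
  proof (cases "wdot u \<beta> \<le> wdot u \<alpha>0")
    case True
    with that have "wdot u \<beta> \<in> W" by (auto simp: W_def)
    then show ?thesis using finW a(3) by (metis Min_le)
  qed (use a(2) in linarith)
  have "wei u f = ereal (wdot u \<alpha>)" unfolding wei_def
    by (rule antisym) (use a(1) le in \<open>auto intro!: INF_lower INF_greatest\<close>)
  with a(1) le show thesis using that by blast
qed

lemma filt_ge_iff: "f \<in> filt_ge u k \<longleftrightarrow> (\<forall>\<alpha>\<in>supp f. k \<le> wdot u \<alpha>)"
  by (simp add: filt_ge_def wei_def le_INF_iff)

lemma filt_gt_iff:
  assumes "u \<in> U_loc" shows "f \<in> filt_gt u k \<longleftrightarrow> (\<forall>\<alpha>\<in>supp f. k < wdot u \<alpha>)"
proof (cases "supp f = {}")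
  case True
  then show ?thesis by (simp add: filt_gt_def wei_def top_ereal_def)
next
  case False
  obtain \<alpha> where "\<alpha> \<in> supp f" "wei u f = ereal (wdot u \<alpha>)"
    "\<And>\<beta>. \<beta> \<in> supp f \<Longrightarrow> wdot u \<alpha> \<le> wdot u \<beta>"
    using wei_attained[OF assms False] by metis
  then show ?thesis by (force simp: filt_gt_def)
qed

lemma filt_quotient_representative:
  assumes u: "u \<in> U_loc" and f: "f \<in> filt_ge u k"
  shows "\<exists>!h. h \<in> gr_part u k \<and> (\<lambda>\<alpha>. f \<alpha> - h \<alpha>) \<in> filt_gt u k"
proof (rule ex1I)
  let ?h = "\<lambda>\<alpha>. if wdot u \<alpha> = k then f \<alpha> else 0"
  show "?h \<in> gr_part u k \<and> (\<lambda>\<alpha>. f \<alpha> - ?h \<alpha>) \<in> filt_gt u k"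
    using f unfolding filt_gt_iff[OF u] filt_ge_iff gr_part_def
    by (auto simp: supp_def less_le)
  fix h assume h: "h \<in> gr_part u k \<and> (\<lambda>\<alpha>. f \<alpha> - h \<alpha>) \<in> filt_gt u k"
  show "h = ?h"
  proof
    fix \<alpha>
    show "h \<alpha> = ?h \<alpha>"
      using h unfolding filt_gt_iff[OF u] gr_part_def by (auto simp: supp_def) (metis less_irrefl)
  qed
qed

lemma gr_carrier_iff: "f \<in> gr_carrier u \<longleftrightarrow> finite (wdot u ` supp f)"
proof
  assume "f \<in> gr_carrier u"
  then obtain K h where f: "f = (\<lambda>\<alpha>. \<Sum>k\<in>K. h k \<alpha>)" and K: "finite K"
    and h: "\<forall>k\<in>K. h k \<in> gr_part u k" unfolding gr_carrier_def by blast
  have "wdot u ` supp f \<subseteq> K"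
  proof clarify
    fix \<alpha> assume "\<alpha> \<in> supp f"
    then have "(\<Sum>k\<in>K. h k \<alpha>) \<noteq> 0" by (simp add: supp_def f)
    then obtain k where "k \<in> K" "h k \<alpha> \<noteq> 0" by (meson sum.neutral)
    then show "wdot u \<alpha> \<in> K" using h by (auto simp: gr_part_def supp_def)
  qed
  then show "finite (wdot u ` supp f)" using K finite_subset by blast
next
  assume fin: "finite (wdot u ` supp f)"
  have "f = (\<lambda>\<alpha>. \<Sum>k\<in>wdot u ` supp f. if wdot u \<alpha> = k then f \<alpha> else 0)"
    by (rule ext, subst sum.delta'[OF fin]) (auto simp: supp_def)
  then show "f \<in> gr_carrier u" unfolding gr_carrier_def using fin
    by (intro CollectI exI[of _ "wdot u ` supp f"] exI[of _ "\<lambda>k \<alpha>. if wdot u \<alpha> = k then f \<alpha> else 0"])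
       (auto simp: gr_part_def supp_def)
qed

lemma subcring_gr_carrier: "subcring (gr_carrier u) pow_ring"
proof -
  interpret R: cring "pow_ring :: 'a pow ring" by (rule cring_pow_ring)
  have minus: "\<ominus>\<^bsub>pow_ring\<^esub> f = (\<lambda>\<alpha>. - f \<alpha>)" for f :: "'a pow"
    by (rule R.minus_equality) auto
  show ?thesis
  proof (rule R.subcringI', rule R.subringI)
    show "\<one>\<^bsub>pow_ring\<^esub> \<in> gr_carrier u"
      unfolding gr_carrier_iff by (rule finite_subset[of _ "{wdot u 0}"]) (auto simp: supp_def)
    fix f assume f: "f \<in> gr_carrier u"
    show "\<ominus>\<^bsub>pow_ring\<^esub> f \<in> gr_carrier u"
      using f by (simp add: minus gr_carrier_iff supp_def)
    fix g assume g: "g \<in> gr_carrier u"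
    have "wdot u ` supp (f \<oplus>\<^bsub>pow_ring\<^esub> g) \<subseteq> wdot u ` supp f \<union> wdot u ` supp g"
      by (auto simp: supp_def)
    then show "f \<oplus>\<^bsub>pow_ring\<^esub> g \<in> gr_carrier u"
      using f g unfolding gr_carrier_iff by (meson finite_UnI finite_subset)
    have "wdot u ` supp (f \<otimes>\<^bsub>pow_ring\<^esub> g) \<subseteq>
        (\<lambda>(x, y). x + y) ` (wdot u ` supp f \<times> wdot u ` supp g)"
    proof clarify
      fix \<gamma> assume "\<gamma> \<in> supp (f \<otimes>\<^bsub>pow_ring\<^esub> g)"
      then have "pow_mult f g \<gamma> \<noteq> 0" by (simp add: supp_def)
      then obtain p where "p \<in> {(\<alpha>, \<beta>). \<alpha> + \<beta> = \<gamma>}" "(case p of (\<alpha>, \<beta>) \<Rightarrow> f \<alpha> * g \<beta>) \<noteq> 0"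
        unfolding pow_mult_def by (meson sum.neutral)
      then obtain \<alpha> \<beta> where "\<alpha> + \<beta> = \<gamma>" "\<alpha> \<in> supp f" "\<beta> \<in> supp g"
        by (auto simp: supp_def)
      moreover from this have "wdot u \<gamma> = wdot u \<alpha> + wdot u \<beta>"
        by (auto simp: wdot_def algebra_simps sum.distrib)
      ultimately show "wdot u \<gamma> \<in> (\<lambda>(x, y). x + y) ` (wdot u ` supp f \<times> wdot u ` supp g)"
        by force
    qed
    then show "f \<otimes>\<^bsub>pow_ring\<^esub> g \<in> gr_carrier u"
      using f g unfolding gr_carrier_iff by (meson finite_SigmaI finite_imageI finite_subset)
  qed auto
qed

lemma cring_gr_ring: "cring (gr_ring u)"
proof -
  interpret R: cring "pow_ring :: 'a pow ring" by (rule cring_pow_ring)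
  show ?thesis
    using subcring_gr_carrier[of u] R.subcring_iff[of "gr_carrier u"] by (simp add: gr_ring_def)
qed


section \<open>The local Groebner fan\<close>

definition loc_equiv :: "'n::finite pow set \<Rightarrow> real ^ 'n \<Rightarrow> real ^ 'n \<Rightarrow> bool" where
  "loc_equiv I u u' \<longleftrightarrow> {i. u $ i \<noteq> 0} = {i. u' $ i \<noteq> 0} \<and> in_ideal u I = in_ideal u' I"

definition groebner_class :: "'n::finite pow set \<Rightarrow> real ^ 'n \<Rightarrow> (real ^ 'n) set" where
  "groebner_class I u = {u' \<in> U_loc. loc_equiv I u u'}"

definition LGF :: "'n::finite pow set \<Rightarrow> (real ^ 'n) set set" where
  "LGF I = {closure (groebner_class I u) | u. u \<in> U_loc}"

text \<open>The library counts the empty set as a face of every convex set, hence \<open>D \<noteq> {}\<close>.\<close>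

definition polyhedral_fan :: "'a::euclidean_space set set \<Rightarrow> bool" where
  "polyhedral_fan F \<longleftrightarrow>
     finite F \<and>
     (\<forall>C\<in>F. polyhedron C \<and> cone C \<and> C \<noteq> {}) \<and>
     (\<forall>C\<in>F. \<forall>D. D face_of C \<and> D \<noteq> {} \<longrightarrow> D \<in> F) \<and>
     (\<forall>C\<in>F. \<forall>D\<in>F. C \<inter> D face_of C \<and> C \<inter> D face_of D)"

definition is_subfan :: "'a::euclidean_space set \<Rightarrow> 'a set set \<Rightarrow> bool" where
  "is_subfan X F \<longleftrightarrow> (\<exists>S\<subseteq>F. polyhedral_fan S \<and> X = \<Union>S)"


section \<open>The local tropical variety\<close>

text \<open>
  A subset \<open>J\<close> of the variables plays the role of the index \<open>\<lambda>\<close>. The space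
  \<open>\<nat>\<close> to the power of the complement of \<open>J\<close> is embedded in \<open>\<nat>\<^sup>n\<close> by extending with zeros on \<open>J\<close>.
\<close>

definition stratum :: "'n::finite set \<Rightarrow> (real ^ 'n) set" where
  "stratum J = {u. (\<forall>j\<in>J. u $ j = 0) \<and> (\<forall>i. i \<notin> J \<longrightarrow> 0 < u $ i)}"

definition proj :: "'n::finite set \<Rightarrow> nat ^ 'n \<Rightarrow> nat ^ 'n" where
  "proj J \<alpha> = (\<chi> i. if i \<in> J then 0 else \<alpha> $ i)"

definition upset :: "'n::finite set \<Rightarrow> (nat ^ 'n) set \<Rightarrow> (nat ^ 'n) set" where
  "upset J B = {\<beta> + \<gamma> | \<beta> \<gamma>. \<beta> \<in> B \<and> (\<forall>j\<in>J. \<gamma> $ j = 0)}"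

definition is_min_gens :: "'n::finite set \<Rightarrow> 'n pow \<Rightarrow> (nat ^ 'n) set \<Rightarrow> bool" where
  "is_min_gens J f B \<longleftrightarrow>
     B \<subseteq> proj J ` supp f \<and> upset J B = upset J (proj J ` supp f) \<and>
     (\<forall>B'. B' \<subset> B \<longrightarrow> upset J B' \<noteq> upset J (proj J ` supp f))"

text \<open>Existence, uniqueness and finiteness are shown in \<open>min_gens_unique\<close> and \<open>finite_min_gens\<close>.\<close>

definition min_gens :: "'n::finite set \<Rightarrow> 'n pow \<Rightarrow> (nat ^ 'n) set" where
  "min_gens J f = (THE B. is_min_gens J f B)"

definition fibre :: "'n::finite set \<Rightarrow> 'n pow \<Rightarrow> nat ^ 'n \<Rightarrow> (nat ^ 'n) set" where
  "fibre J f \<beta> = {\<alpha> \<in> supp f. proj J \<alpha> = \<beta>}"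

text \<open>
  \<open>A f J \<beta>\<close> is the set chosen from the fibre \<open>E\<close> over the minimal generator \<open>\<beta>\<close>. Since \<open>E\<close> may
  be infinite, having at least two elements is expressed as not being a singleton; \<open>E\<close> is nonempty.
\<close>

definition admissible_choice ::
  "('n::finite pow \<Rightarrow> 'n set \<Rightarrow> nat ^ 'n \<Rightarrow> (nat ^ 'n) set) \<Rightarrow> bool" where
  "admissible_choice A \<longleftrightarrow>
     (\<forall>f J. J \<noteq> UNIV \<longrightarrow> (\<forall>\<beta>\<in>min_gens J f.
        if is_singleton (fibre J f \<beta>) then A f J \<beta> = fibre J f \<beta>
        else A f J \<beta> \<subseteq> fibre J f \<beta> \<and> card (A f J \<beta>) = 2))"

definition f_hat ::
  "('n::finite pow \<Rightarrow> 'n set \<Rightarrow> nat ^ 'n \<Rightarrow> (nat ^ 'n) set) \<Rightarrow> 'n set \<Rightarrow> 'n pow \<Rightarrow> 'n pow" where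
  "f_hat A J f =
     (if J = UNIV then (\<lambda>\<alpha>. 0)
      else (\<lambda>\<alpha>. if \<alpha> \<in> (\<Union>\<beta>\<in>min_gens J f. A f J \<beta>) then f \<alpha> else 0))"

text \<open>For polynomials, that is, series with finite support.\<close>

definition poly_eval :: "'n::finite pow \<Rightarrow> puiseux ^ 'n \<Rightarrow> puiseux" where
  "poly_eval g v = (\<Sum>\<alpha>\<in>supp g. puiseux_const (g \<alpha>) * (\<Prod>i\<in>UNIV. (v $ i) ^ (\<alpha> $ i)))"

definition torus_zeros :: "'n::finite pow \<Rightarrow> (puiseux ^ 'n) set" where
  "torus_zeros g = {v. (\<forall>i. v $ i \<noteq> 0) \<and> poly_eval g v = 0}"

definition ord_vec :: "puiseux ^ 'n::finite \<Rightarrow> real ^ 'n" where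
  "ord_vec v = (\<chi> i. of_rat (puiseux_ord (v $ i)))"

definition T_loc ::
  "('n::finite pow \<Rightarrow> 'n set \<Rightarrow> nat ^ 'n \<Rightarrow> (nat ^ 'n) set) \<Rightarrow> 'n pow set \<Rightarrow> (real ^ 'n) set" where
  "T_loc A I =
     (\<Union>J\<in>UNIV. (\<Inter>f\<in>I. closure (ord_vec ` torus_zeros (f_hat A J f))) \<inter> stratum J)"

lemma upset_iff:
  "\<gamma> \<in> upset J (proj J ` S) \<longleftrightarrow> proj J \<gamma> = \<gamma> \<and> (\<exists>\<alpha>\<in>S. proj J \<alpha> \<le> \<gamma>)"
proof
  assume "proj J \<gamma> = \<gamma> \<and> (\<exists>\<alpha>\<in>S. proj J \<alpha> \<le> \<gamma>)"
  then obtain \<alpha> where a: "\<alpha> \<in> S" "proj J \<alpha> \<le> \<gamma>" and g: "proj J \<gamma> = \<gamma>" by blast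
  have "\<gamma> = proj J \<alpha> + (\<chi> i. \<gamma> $ i - proj J \<alpha> $ i)"
    using a(2) by (simp add: vec_eq_iff less_eq_vec_def)
  moreover have "\<gamma> $ j = 0" if "j \<in> J" for j
    using arg_cong[OF g, of "\<lambda>x. x $ j"] that by (simp add: proj_def)
  ultimately show "\<gamma> \<in> upset J (proj J ` S)"
    unfolding upset_def using a(1)
    by (intro CollectI exI[of _ "proj J \<alpha>"] exI[of _ "\<chi> i. \<gamma> $ i - proj J \<alpha> $ i"]) auto
next
  assume "\<gamma> \<in> upset J (proj J ` S)"
  then obtain \<alpha> \<delta> where a: "\<alpha> \<in> S" and g: "\<gamma> = proj J \<alpha> + \<delta>" and d: "\<forall>j\<in>J. \<delta> $ j = 0"
    unfolding upset_def by blast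
  have "proj J \<gamma> = \<gamma>" using d by (simp add: g proj_def vec_eq_iff)
  moreover have "proj J \<alpha> \<le> \<gamma>" by (simp add: g less_eq_vec_def)
  ultimately show "proj J \<gamma> = \<gamma> \<and> (\<exists>\<alpha>\<in>S. proj J \<alpha> \<le> \<gamma>)" using a by blast
qed

lemma nat_seq_mono_subseq:
  fixes s :: "nat \<Rightarrow> nat" shows "\<exists>r. strict_mono r \<and> incseq (s \<circ> r)"
proof -
  obtain r where r: "strict_mono r" "monoseq (\<lambda>n. s (r n))" using seq_monosub[of s] by blast
  consider "incseq (\<lambda>n. s (r n))" | "decseq (\<lambda>n. s (r n))" using r(2) by (auto simp: monoseq_iff)
  then show ?thesis
  proof cases
    case 1
    then show ?thesis using r(1) by (auto simp: comp_def)
  next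
    case 2
    obtain N where N: "\<And>n. s (r N) \<le> s (r n)"
      using ex_has_least_nat[of "\<lambda>_. True" 0 "\<lambda>n. s (r n)"] by auto
    have "s (r n) = s (r N)" if "n \<ge> N" for n
      using N[of n] decseqD[OF 2 that] by simp
    then have "s \<circ> (r \<circ> (\<lambda>n. n + N)) = (\<lambda>_. s (r N))"
      unfolding fun_eq_iff comp_apply using le_add2 by blast
    then have "incseq (s \<circ> (r \<circ> (\<lambda>n. n + N)))" by simp
    moreover have "strict_mono (r \<circ> (\<lambda>n. n + N))"
      using r(1) by (auto simp: strict_mono_def)
    ultimately show ?thesis by blast
  qed
qed

lemma vec_seq_mono_subseq:
  fixes s :: "nat \<Rightarrow> nat ^ 'n::finite" shows "\<exists>r. strict_mono r \<and> incseq (s \<circ> r)"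
proof -
  have "\<exists>r. strict_mono r \<and> (\<forall>i\<in>X. incseq (\<lambda>n. s (r n) $ i))" if "finite X" for X
    using that
  proof induction
    case empty
    then show ?case using strict_mono_id by auto
  next
    case (insert i X)
    then obtain r where r: "strict_mono r" "\<forall>i\<in>X. incseq (\<lambda>n. s (r n) $ i)" by blast
    obtain q where q: "strict_mono q" "incseq ((\<lambda>n. s (r n) $ i) \<circ> q)"
      using nat_seq_mono_subseq by blast
    have "strict_mono (r \<circ> q)" using r(1) q(1) by (rule strict_mono_o)
    moreover have "incseq (\<lambda>n. s (r (q n)) $ j)" if "j \<in> X" for j
      using r(2) that q(1) by (auto simp: incseq_def strict_mono_less_eq)
    ultimately show ?case using q(2) by (intro exI[of _ "r \<circ> q"]) (auto simp: comp_def)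
  qed
  from this[of UNIV] show ?thesis by (auto simp: incseq_def less_eq_vec_def)
qed

lemma finite_minimal_elements:
  fixes P :: "(nat ^ 'n::finite) set"
  shows "finite {\<beta> \<in> P. \<forall>\<gamma>\<in>P. \<gamma> \<le> \<beta> \<longrightarrow> \<gamma> = \<beta>}" (is "finite ?M")
proof (rule ccontr)
  assume "infinite ?M"
  then obtain s :: "nat \<Rightarrow> nat ^ 'n" where s: "inj s" "range s \<subseteq> ?M"
    using infinite_countable_subset by blast
  obtain r where r: "strict_mono r" "incseq (s \<circ> r)" using vec_seq_mono_subseq by blast
  have "s (r 0) \<le> s (r 1)" using r(2) by (simp add: incseq_def)
  then have "s (r 0) = s (r 1)" using s(2) by blast
  then have "r 0 = r 1" using s(1) by (simp add: inj_eq)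
  then show False using r(1) by (simp add: strict_mono_eq)
qed

lemma minimal_element_below:
  fixes P :: "(nat ^ 'n::finite) set"
  assumes "\<alpha> \<in> P" shows "\<exists>\<beta>\<in>P. \<beta> \<le> \<alpha> \<and> (\<forall>\<gamma>\<in>P. \<gamma> \<le> \<beta> \<longrightarrow> \<gamma> = \<beta>)"
proof -
  have "finite {\<beta> \<in> P. \<beta> \<le> \<alpha>}" by (rule finite_subset[OF _ finite_vec_le[of \<alpha>]]) auto
  then obtain \<beta> where b: "\<beta> \<in> {\<beta> \<in> P. \<beta> \<le> \<alpha>}"
      "\<And>\<gamma>. \<gamma> \<in> {\<beta> \<in> P. \<beta> \<le> \<alpha>} \<Longrightarrow> \<gamma> \<le> \<beta> \<Longrightarrow> \<beta> = \<gamma>"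
    using finite_has_minimal[of "{\<beta> \<in> P. \<beta> \<le> \<alpha>}"] assms by blast
  then show ?thesis using order_trans by (intro bexI[of _ \<beta>]) auto
qed

lemma min_gens_unique:
  fixes f :: "'n::finite pow" and J :: "'n set"
  defines "P \<equiv> proj J ` supp f"
  shows "is_min_gens J f B \<longleftrightarrow> B = {\<beta> \<in> P. \<forall>\<gamma>\<in>P. \<gamma> \<le> \<beta> \<longrightarrow> \<gamma> = \<beta>}"
proof -
  let ?M = "{\<beta> \<in> P. \<forall>\<gamma>\<in>P. \<gamma> \<le> \<beta> \<longrightarrow> \<gamma> = \<beta>}"
  have pp: "proj J (proj J \<alpha>) = proj J \<alpha>" for \<alpha> :: "nat ^ 'n" by (simp add: proj_def vec_eq_iff)
  have up: "\<gamma> \<in> upset J B \<longleftrightarrow> proj J \<gamma> = \<gamma> \<and> (\<exists>\<beta>\<in>B. \<beta> \<le> \<gamma>)" if "B \<subseteq> P" for B \<gamma>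
  proof -
    have fx: "\<forall>\<beta>\<in>B. proj J \<beta> = \<beta>" using that pp by (auto simp: P_def)
    then have "proj J ` B = B" by auto
    with fx show ?thesis using upset_iff[of \<gamma> J B] by auto
  qed
  have M: "upset J ?M = upset J P"
  proof (rule Set.set_eqI)
    fix \<gamma>
    have "(\<exists>\<beta>\<in>?M. \<beta> \<le> \<gamma>) \<longleftrightarrow> (\<exists>\<beta>\<in>P. \<beta> \<le> \<gamma>)"
    proof
      assume "\<exists>\<beta>\<in>P. \<beta> \<le> \<gamma>"
      then obtain \<alpha> where a: "\<alpha> \<in> P" "\<alpha> \<le> \<gamma>" by blast
      obtain \<beta> where "\<beta> \<in> ?M" "\<beta> \<le> \<alpha>" using minimal_element_below[OF a(1)] by blast
      with a(2) show "\<exists>\<beta>\<in>?M. \<beta> \<le> \<gamma>" by (meson order_trans)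
    qed blast
    moreover have "?M \<subseteq> P" by blast
    ultimately show "\<gamma> \<in> upset J ?M \<longleftrightarrow> \<gamma> \<in> upset J P"
      using up[of ?M \<gamma>] up[of P \<gamma>] by simp
  qed
  have sub: "?M \<subseteq> B" if B: "B \<subseteq> P" "upset J B = upset J P" for B
  proof
    fix \<beta> assume b: "\<beta> \<in> ?M"
    then have "\<beta> \<in> P" "proj J \<beta> = \<beta>" by (auto simp: P_def pp)
    then have "\<beta> \<in> upset J P" using up[of P \<beta>] by blast
    then obtain \<gamma> where "\<gamma> \<in> B" "\<gamma> \<le> \<beta>" using up[OF B(1), of \<beta>] B(2) by blast
    then show "\<beta> \<in> B" using b B(1) by auto
  qed
  show ?thesis
  proof
    assume "is_min_gens J f B"
    then have B: "B \<subseteq> P" "upset J B = upset J P" "\<And>B'. B' \<subset> B \<Longrightarrow> upset J B' \<noteq> upset J P"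
      by (auto simp: is_min_gens_def P_def)
    from sub[OF B(1,2)] B(3) M show "B = ?M" by blast
  next
    assume B: "B = ?M"
    show "is_min_gens J f B" unfolding is_min_gens_def P_def[symmetric]
    proof (intro conjI allI impI)
      show "B \<subseteq> P" using B by auto
      show "upset J B = upset J P" using B M by simp
      fix B' assume "B' \<subset> B"
      then show "upset J B' \<noteq> upset J P" using sub[of B'] B by auto
    qed
  qed
qed

lemma min_gens_is_min_gens: "is_min_gens J f (min_gens J f)"
  unfolding min_gens_def by (rule theI') (auto simp: min_gens_unique)

lemma finite_min_gens: "finite (min_gens J f)"
  using min_gens_is_min_gens[of J f] finite_minimal_elements[of "proj J ` supp f"]
  by (simp add: min_gens_unique)

lemma finite_supp_f_hat:
  assumes "admissible_choice A" shows "finite (supp (f_hat A J f))"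
proof (cases "J = UNIV")
  case False
  have "finite (A f J \<beta>)" if "\<beta> \<in> min_gens J f" for \<beta>
  proof (cases "is_singleton (fibre J f \<beta>)")
    case True
    then have "A f J \<beta> = fibre J f \<beta>"
      using assms False that unfolding admissible_choice_def by fastforce
    then show ?thesis using True by (auto simp: is_singleton_def)
  next
    case F: False
    then have "card (A f J \<beta>) = 2"
      using assms False that unfolding admissible_choice_def by fastforce
    then show ?thesis by (intro card_ge_0_finite) simp
  qed
  then have "finite (\<Union>\<beta>\<in>min_gens J f. A f J \<beta>)" using finite_min_gens by blast
  then show ?thesis by (rule finite_subset[rotated]) (use False in \<open>auto simp: f_hat_def supp_def\<close>)
qed (simp add: f_hat_def supp_def)

text \<open>
  The stratum of \<open>J = {1,\<dots>,n}\<close> is \<open>{0}\<close>, where the convention \<open>f_hat A UNIV f = 0\<close> imposes no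
  condition. Hence \<open>0\<close> always belongs to the local tropical variety, whereas the initial ideal
  of weight \<open>0\<close> is \<open>I\<close> itself, which may contain a monomial.
\<close>

lemma zero_in_T_loc: "0 \<in> T_loc A I"
proof -
  have 1: "ord_vec (\<chi> i. 1) = 0"
    by (simp add: ord_vec_def vec_eq_iff) (transfer, simp)
  have "(\<chi> i. 1) \<in> torus_zeros (f_hat A UNIV f)" for f
    by (simp add: torus_zeros_def poly_eval_def f_hat_def supp_def)
  then have "0 \<in> closure (ord_vec ` torus_zeros (f_hat A UNIV f))" for f
    using 1 closure_subset by (metis imageI subsetD)
  then show ?thesis by (auto simp: T_loc_def stratum_def intro!: exI[of _ UNIV])
qed

lemma in_ideal_0:
  assumes "ideal I (pow_ring :: 'n::finite pow ring)" shows "in_ideal 0 I = I"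
proof -
  have w: "wdot 0 \<alpha> = 0" for \<alpha> :: "nat ^ 'n" by (simp add: wdot_def)
  have "gr_carrier (0 :: real ^ 'n) = UNIV"
  proof -
    have "finite (wdot 0 ` supp f)" for f :: "'n pow"
      by (rule finite_subset[of _ "{0}"]) (auto simp: w)
    then show ?thesis by (auto simp: gr_carrier_iff)
  qed
  then have gr: "gr_ring (0 :: real ^ 'n) = pow_ring" by (simp add: gr_ring_def pow_ring_def)
  have "in_form 0 f = f" for f :: "'n pow"
  proof (cases "supp f = {}")
    case False
    then have "wei 0 f = 0" by (simp add: wei_def w zero_ereal_def)
    then show ?thesis by (simp add: in_form_def w zero_ereal_def)
  qed (auto simp: in_form_def supp_def)
  then have im: "in_form 0 ` I = I" by simp
  interpret R: cring "pow_ring :: 'n pow ring" by (rule cring_pow_ring)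
  show ?thesis unfolding in_ideal_def gr im
    using R.genideal_minimal[OF assms, of I] R.genideal_self[of I] by auto
qed

end

theory Submission
  imports Defs "HOL-Computational_Algebra.Fundamental_Theorem_Algebra"
begin

text \<open>
Two independent results are combined: outside the origin both descriptions of the local tropical
variety say the same about a single series, and the weights fall into finitely many open cones on
which the initial ideal is constant.

Call an exponent of \<open>f\<close> leading for the weight \<open>w\<close> if all
other exponents of \<open>f\<close> have strictly larger weight. The homogeneous components of an element of
\<open>in\<^sub>w(I)\<close> are initial forms of elements of \<open>I\<close> (\<open>part_eq_in_form_lift\<close>), so \<open>in\<^sub>w(I)\<close> contains a
monomial iff some \<open>f \<in> I\<close> has a leading exponent (\<open>monomial_in_in_ideal_iff\<close>). On the other side,
let \<open>w\<close> lie in the stratum of \<open>J\<close>, where \<open>J\<close> does not contain all variables. Then \<open>w\<close> is in the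
closure of the orders of the zeros of the truncation of \<open>f\<close> iff \<open>f\<close> has no leading exponent
(\<open>stratum_hypersurface\<close>). Indeed \<open>w\<close> is positive off \<open>J\<close>, so the terms of minimal weight lie over
minimal generators, and the truncation keeps two terms over a generator whenever \<open>f\<close> has two; what
remains is Kapranov's theorem for polynomials with constant coefficients. A single term of smallest
order cannot cancel (\<open>unique_min_not_tropical\<close>). If two terms tie (\<open>two_minimizers_tropical\<close>), move
\<open>w\<close> to a nearby rational weight with the same ties and put \<open>x\<^sub>i = t\<^bsup>w\<^sub>i\<^esup> s\<^bsup>a\<^sub>i\<^esup>\<close> for exponents \<open>a\<close> that
separate the terms. This leaves one polynomial equation for \<open>s\<close> over \<open>\<complex>[[t]]\<close>, whose reduction
modulo \<open>t\<close> has at least two terms and hence a nonzero root, and the root lifts by the Newton-Puiseux theorem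
(\<open>newton_puiseux_root\<close>). At the origin there is nothing to compare: \<open>0\<close> always belongs to the local
tropical variety, and \<open>in\<^sub>0(I) = I\<close>. This is why the two cases of the theorem are separated by whether
\<open>I\<close> itself contains a monomial.

For the fan structure, standard bases are used with weight vectors in place of term orders. For a generic
weight \<open>v\<close>, positive and injective on exponents, let \<open>E\<close> be the set of leading exponents of \<open>I\<close>. Only
finitely many sets \<open>E\<close> occur (\<open>finite_lead_exps\<close>), and each has a reduced basis: for every minimal
element \<open>\<alpha>\<close> of \<open>E\<close> a series in \<open>I\<close> of the form \<open>x\<^sup>\<alpha>\<close> plus terms outside \<open>E\<close>. The weights for which each
\<open>x\<^sup>\<alpha>\<close> is among the terms of smallest weight of its basis element form a polyhedral cone. These finitely
many closed cones cover all weights because generic weights are dense (\<open>compatible_covering\<close>). Inside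
one of them, and for any second weight, being in the same Groebner class means lying in the
relative interior of the same face (\<open>loc_equiv_iff_same_face\<close>): an initial ideal has no nonzero
element supported outside \<open>E\<close> (\<open>in_ideal_meets_lead_exps\<close>), which forces equal initial ideals to have
equal initial forms of the basis elements. Every class is thus the relative interior of a face of each
cone that it meets, and this alone makes the closures of the classes a fan
(\<open>polyhedral_fan_of_sign_classes\<close>). A leading exponent stays leading under small changes of the weight
(\<open>closure_class_monomial_free\<close>), so the monomial-free weights are a union of closures of classes.
\<close>

section \<open>Newton-Puiseux roots\<close>

lemma poly_fps_cong_upto:
  fixes D :: "'a::comm_ring_1 fps poly"
  assumes "\<And>j. j \<le> n \<Longrightarrow> fps_nth a j = fps_nth b j"
  shows "j \<le> n \<Longrightarrow> fps_nth (poly D a) j = fps_nth (poly D b) j"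
proof (induction D arbitrary: j)
  case (pCons c D)
  then show ?case using assms by (auto simp: fps_mult_nth intro!: sum.cong)
qed simp

lemma poly_taylor_2:
  fixes p :: "'a::idom poly"
  shows "\<exists>w. poly p (x + e) = poly p x + e * poly (pderiv p) x + e^2 * w"
proof (induction p)
  case (pCons c p)
  then obtain w where w: "poly p (x + e) = poly p x + e * poly (pderiv p) x + e^2 * w" by blast
  show ?case
    by (rule exI[of _ "x * w + poly (pderiv p) x + e * w"])
       (unfold pderiv_pCons poly_pCons poly_add w, simp add: algebra_simps power2_eq_square)
qed simp

lemma fps_nth_poly_0:
  fixes p :: "'a::comm_ring_1 fps poly"
  shows "fps_nth (poly p s) 0 = poly (map_poly (\<lambda>c. fps_nth c 0) p) (fps_nth s 0)"
  by (induction p) (auto simp: map_poly_pCons)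

text \<open>
Newton iteration, one coefficient at a time: adding \<open>e = c t\<^bsup>n+1\<^esup>\<close> to an approximate root \<open>x\<close> changes
\<open>D(x)\<close> by \<open>e D'(x)\<close> modulo \<open>t\<^bsup>n+2\<^esup>\<close>, and \<open>D'(x)\<close> is a unit.
\<close>

lemma fps_simple_root_lift:
  fixes D :: "complex fps poly"
  assumes 0: "fps_nth (poly.coeff D 0) 0 = 0" and 1: "fps_nth (poly.coeff D 1) 0 \<noteq> 0"
  shows "\<exists>s. fps_nth s 0 = 0 \<and> poly D s = 0"
proof -
  let ?P = "\<lambda>n s. fps_nth s 0 = 0 \<and> (\<forall>j\<le>n. fps_nth (poly D s) j = 0)"
  let ?Q = "\<lambda>n s s'. \<forall>j\<le>n. fps_nth s' j = fps_nth s j"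
  have "\<exists>f. \<forall>n. ?P n (f n) \<and> ?Q n (f n) (f (Suc n))"
  proof (rule dependent_nat_choice)
    show "\<exists>x. ?P 0 x" using 0 by (intro exI[of _ 0]) (auto simp: poly_0_coeff_0)
  next
    fix x n assume x: "?P n x"
    define d where "d = fps_nth (poly (pderiv D) x) 0"
    have "d = fps_nth (poly.coeff D 1) 0"
      using x by (simp add: d_def fps_nth_poly_0 poly_0_coeff_0 coeff_map_poly coeff_pderiv)
    with 1 have d: "d \<noteq> 0" by simp
    define c where "c = - fps_nth (poly D x) (Suc n) / d"
    define e where "e = fps_X ^ (Suc n) * fps_const c"
    obtain w where w: "poly D (x + e) = poly D x + e * poly (pderiv D) x + e^2 * w"
      using poly_taylor_2 by blast
    have "e * poly (pderiv D) x = fps_X ^ (Suc n) * (fps_const c * poly (pderiv D) x)"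
      by (simp add: e_def)
    then have e1: "fps_nth (e * poly (pderiv D) x) j = (if j < Suc n then 0 else c * fps_nth (poly (pderiv D) x) (j - Suc n))" for j
      by (simp only: fps_X_power_mult_nth) simp
    have "e\<^sup>2 * w = fps_X ^ (Suc n * 2) * (fps_const c ^ 2 * w)"
      by (simp only: e_def power_mult_distrib power_mult mult.assoc)
    then have e2: "fps_nth (e\<^sup>2 * w) j = 0" if "j \<le> Suc n" for j
      using that by (simp only: fps_X_power_mult_nth) simp
    show "\<exists>y. ?P (Suc n) y \<and> ?Q n x y"
    proof (intro exI[of _ "x + e"] conjI allI impI)
      have en: "fps_nth e j = 0" if "j \<le> n" for j
        using that unfolding e_def by (simp only: fps_X_power_mult_nth) simp
      show "fps_nth (x + e) 0 = 0" using x en by simp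
      show "fps_nth (x + e) j = fps_nth x j" if "j \<le> n" for j using en that by simp
      show "fps_nth (poly D (x + e)) j = 0" if "j \<le> Suc n" for j
        using that x d e2[OF that] unfolding w fps_add_nth e1
        by (cases "j = Suc n") (auto simp: c_def d_def[symmetric])
    qed
  qed
  then obtain f where f: "\<And>n. ?P n (f n)" "\<And>n. ?Q n (f n) (f (Suc n))" by blast
  define s where "s = Abs_fps (\<lambda>j. fps_nth (f j) j)"
  have stab: "fps_nth (f (j + k)) j = fps_nth (f j) j" for j k
    by (induction k) (use f(2) in auto)
  have "fps_nth s j = fps_nth (f n) j" if "j \<le> n" for j n
    using stab[of j "n - j"] that by (simp add: s_def)
  then have "fps_nth (poly D s) n = fps_nth (poly D (f n)) n" for n
    by (rule poly_fps_cong_upto) auto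
  then have "poly D s = 0" using f(1) by (intro fps_ext) auto
  moreover have "fps_nth s 0 = 0" using f(1) by (simp add: s_def)
  ultimately show ?thesis by blast
qed

lemma map_poly_hom_shift:
  fixes \<phi> :: "'a::comm_ring_1 \<Rightarrow> 'b::comm_ring_1"
  assumes "\<phi> 0 = 0" "\<phi> 1 = 1" "\<And>a b. \<phi> (a + b) = \<phi> a + \<phi> b" "\<And>a b. \<phi> (a * b) = \<phi> a * \<phi> b"
  shows "map_poly \<phi> (pcompose p [:a, 1:]) = pcompose (map_poly \<phi> p) [:\<phi> a, 1:]"
proof (induction p)
  case (pCons c p)
  have add: "map_poly \<phi> (q + r) = map_poly \<phi> q + map_poly \<phi> r" for q r
    by (rule poly_eqI) (simp add: coeff_map_poly assms)
  have sm: "map_poly \<phi> (Polynomial.smult b q) = Polynomial.smult (\<phi> b) (map_poly \<phi> q)" for b q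
    by (rule poly_eqI) (simp add: coeff_map_poly assms)
  show ?case
    by (simp add: pcompose_pCons map_poly_pCons assms add sm pCons.IH[symmetric])
qed (simp add: assms)

text \<open>
Replacing \<open>t\<close> by \<open>t\<^sup>L\<close> adjoins an \<open>L\<close>-th root of \<open>t\<close> while staying inside \<open>\<complex>[[t]]\<close>.
\<close>

definition ramify :: "nat \<Rightarrow> complex fps \<Rightarrow> complex fps" where
  "ramify L f = fps_compose f (fps_X ^ L)"

lemma ramify_hom:
  assumes "L > 0"
  shows "ramify L 0 = 0" "ramify L 1 = 1" "ramify L (f + g) = ramify L f + ramify L g"
    "ramify L (f * g) = ramify L f * ramify L g" "ramify L (fps_const c) = fps_const c"
    "ramify L (f ^ k) = ramify L f ^ k"
    "ramify L fps_X = fps_X ^ L"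
  using assms by (simp_all add: ramify_def fps_compose_add_distrib fps_compose_mult_distrib fps_compose_power)

lemma ramify_ramify: "L > 0 \<Longrightarrow> M > 0 \<Longrightarrow> ramify M (ramify L f) = ramify (L * M) f"
  by (simp add: ramify_def fps_compose_assoc[symmetric] fps_compose_power[symmetric] power_mult[symmetric] mult.commute)

lemma ramify_nth_0: "L > 0 \<Longrightarrow> fps_nth (ramify L f) 0 = fps_nth f 0"
  by (simp add: ramify_def)

lemma subdegree_ramify: "L > 0 \<Longrightarrow> subdegree (ramify L f) = L * subdegree f"
  by (simp add: ramify_def subdegree_fps_compose)

lemma ramify_eq_0: "L > 0 \<Longrightarrow> ramify L f = 0 \<longleftrightarrow> f = 0"
  by (simp add: ramify_def fps_compose_eq_0_iff)

lemma poly_ramify_shift: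
  assumes "L > 0"
  shows "poly (map_poly (ramify L) (pcompose P [:a, 1:])) \<sigma> = poly (map_poly (ramify L) P) (ramify L a + \<sigma>)"
proof -
  have "map_poly (ramify L) (pcompose P [:a, 1:]) = pcompose (map_poly (ramify L) P) [:ramify L a, 1:]"
    by (rule map_poly_hom_shift) (simp_all add: ramify_hom assms)
  then show ?thesis by (simp add: poly_pcompose)
qed

lemma poly_eq_sum_le:
  fixes p :: "'a::comm_semiring_1 poly"
  assumes "Polynomial.degree p \<le> n" shows "poly p x = (\<Sum>i\<le>n. poly.coeff p i * x ^ i)"
  unfolding poly_altdef
  by (rule sum.mono_neutral_left) (use assms in \<open>auto simp: coeff_eq_0 not_le\<close>)

lemma degree_map_poly_le: "\<phi> 0 = 0 \<Longrightarrow> degree (map_poly \<phi> p) \<le> degree p"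
  by (rule degree_le) (auto simp: coeff_map_poly coeff_eq_0)

text \<open>
The Taylor coefficients at \<open>s\<close>, needed to translate vanishing of a derivative at \<open>s\<close> into vanishing
of a coefficient after the shift by \<open>s\<close>.
\<close>

lemma poly_higher_pderiv_eq_coeff_shift:
  fixes P :: "'a::{idom,semiring_char_0} poly"
  shows "poly ((pderiv ^^ k) P) s = fact k * poly.coeff (pcompose P [:s, 1:]) k"
proof -
  have "(pderiv ^^ k) (pcompose P [:s, 1:]) = pcompose ((pderiv ^^ k) P) [:s, 1:]"
    by (induction k) (simp_all add: pderiv_pcompose pderiv_pCons)
  then have "poly.coeff ((pderiv ^^ k) (pcompose P [:s, 1:])) 0 = poly ((pderiv ^^ k) P) s"
    by simp
  then show ?thesis by (simp add: coeff_higher_pderiv pochhammer_fact)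
qed

lemma const_coeff_shift:
  fixes P :: "complex fps poly"
  shows "map_poly (\<lambda>c. fps_nth c 0) (pcompose P [:s, 1:]) =
         pcompose (map_poly (\<lambda>c. fps_nth c 0) P) [:fps_nth s 0, 1:]"
  by (rule map_poly_hom_shift) simp_all

text \<open>
Induction on the multiplicity \<open>m\<close> of the root \<open>0\<close> of the reduction modulo \<open>t\<close>. The derivative of order
\<open>m - 1\<close> has a simple root there, which lifts to a power series \<open>s0\<close>; shifting by \<open>s0\<close> removes the
coefficient of \<open>s\<^bsup>m-1\<^esup>\<close>. Rescaling \<open>s\<close> along the segment of the Newton polygon that ends at \<open>m\<close>
yields a polynomial with a reduction of degree \<open>m\<close> in which the coefficient of \<open>s\<^bsup>m-1\<^esup>\<close> is still zero
and a lower coefficient is not. Such a reduction is not a multiple of an \<open>m\<close>-th power of a linear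
polynomial, so all its roots have multiplicity below \<open>m\<close>.
\<close>

theorem newton_puiseux_root:
  fixes P :: "complex fps poly"
  assumes "m \<ge> 1" "\<And>i. i < m \<Longrightarrow> fps_nth (poly.coeff P i) 0 = 0" "fps_nth (poly.coeff P m) 0 \<noteq> 0"
  shows "\<exists>L \<sigma>. L > 0 \<and> fps_nth \<sigma> 0 = 0 \<and> poly (map_poly (ramify L) P) \<sigma> = 0"
  using assms
proof (induction m arbitrary: P rule: less_induct)
  case (less m P)
  let ?red = "map_poly (\<lambda>c :: complex fps. fps_nth c 0)"
  \<comment> \<open>the shift by \<open>s0\<close> plays the role of a Tschirnhaus transformation\<close>
  define D where "D = (pderiv ^^ (m - 1)) P"
  have "fps_nth (poly.coeff D 0) 0 = 0"
    using less.prems by (simp add: D_def coeff_higher_pderiv)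
  moreover have "fps_nth (poly.coeff D 1) 0 \<noteq> 0"
  proof -
    have "poly.coeff D 1 = of_nat (pochhammer (Suc 1) (m - 1)) * poly.coeff P m"
      using less.prems(1) unfolding D_def coeff_higher_pderiv pochhammer_of_nat by simp
    moreover have "pochhammer (Suc 1) (m - 1) > 0" by (rule pochhammer_pos) simp
    ultimately show ?thesis using less.prems(3) by (simp add: fps_of_nat[symmetric])
  qed
  ultimately obtain s0 where s0: "fps_nth s0 0 = 0" "poly D s0 = 0"
    using fps_simple_root_lift by blast
  define Q where "Q = pcompose P [:s0, 1:]"
  have redQ: "?red Q = ?red P" unfolding Q_def const_coeff_shift s0 by simp
  have Q0: "fps_nth (poly.coeff Q i) 0 = fps_nth (poly.coeff P i) 0" for i
    using arg_cong[OF redQ, of "\<lambda>p. poly.coeff p i"] by (simp add: coeff_map_poly)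
  have Qm1: "poly.coeff Q (m - 1) = 0"
    using s0(2) unfolding D_def Q_def poly_higher_pderiv_eq_coeff_shift by simp
  have rootQ: "\<exists>L \<sigma>. L > 0 \<and> fps_nth \<sigma> 0 = 0 \<and> poly (map_poly (ramify L) Q) \<sigma> = 0"
  proof (cases "\<forall>i<m. poly.coeff Q i = 0")
    case True
    then have "poly Q 0 = 0" using less.prems(1) by (simp add: poly_0_coeff_0)
    then have "poly (map_poly (ramify 1) Q) 0 = 0"
      by (simp add: poly_0_coeff_0 coeff_map_poly ramify_hom)
    then show ?thesis by (intro exI[of _ 1] exI[of _ 0]) simp
  next
    case False
    define N where "N = {i. i < m \<and> poly.coeff Q i \<noteq> 0}"
    have "finite N" "N \<noteq> {}" using False by (auto simp: N_def)
    then obtain i0 where i0: "i0 \<in> N" and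
      i0_min: "\<And>i. i \<in> N \<Longrightarrow> real (subdegree (poly.coeff Q i0)) / real (m - i0) \<le> real (subdegree (poly.coeff Q i)) / real (m - i)"
      using ex_is_arg_min_if_finite[of N "\<lambda>i. real (subdegree (poly.coeff Q i)) / real (m - i)"]
      by (auto simp: is_arg_min_linorder)
    \<comment> \<open>\<open>h / d\<close> is the slope of the segment of the Newton polygon that ends at \<open>m\<close>\<close>
    define d where "d = m - i0"
    define h where "h = subdegree (poly.coeff Q i0)"
    have i0m: "i0 < m" "poly.coeff Q i0 \<noteq> 0" using i0 by (auto simp: N_def)
    have d: "d > 0" using i0m by (simp add: d_def)
    have h: "h > 0" unfolding h_def using i0m Q0[of i0] less.prems(2)[of i0]
      by (simp add: subdegree_eq_0_iff flip: neq0_conv)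
    have slope: "h * (m - i) \<le> d * subdegree (poly.coeff Q i)" if "i \<in> N" for i
    proof -
      have "i < m" using that by (simp add: N_def)
      with i0_min[OF that] d have "real h * real (m - i) \<le> real (subdegree (poly.coeff Q i)) * real d"
        by (simp add: field_simps h_def d_def)
      then have "h * (m - i) \<le> subdegree (poly.coeff Q i) * d"
        by (metis of_nat_le_iff of_nat_mult)
      then show ?thesis by (simp add: mult.commute)
    qed
    \<comment> \<open>the coefficients of \<open>t\<^bsup>-hm\<^esup> Q(t\<^sup>h s)\<close> after replacing \<open>t\<close> by \<open>t\<^sup>d\<close> in those of \<open>Q\<close>\<close>
    define r where "r i = (if i \<le> m then fps_shift (h * (m - i)) (ramify d (poly.coeff Q i))
                           else fps_X ^ (h * (i - m)) * ramify d (poly.coeff Q i))" for i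
    have r0: "r i = 0" if "poly.coeff Q i = 0" for i
      using that d by (simp add: r_def ramify_hom)
    have rX: "fps_X ^ (h * m) * r i = fps_X ^ (h * i) * ramify d (poly.coeff Q i)" for i
    proof (cases "i \<le> m \<and> poly.coeff Q i \<noteq> 0")
      case True
      have "h * (m - i) \<le> subdegree (ramify d (poly.coeff Q i))"
        using True slope[of i] d by (cases "i = m") (auto simp: subdegree_ramify N_def)
      then have "r i * fps_X ^ (h * (m - i)) = ramify d (poly.coeff Q i)"
        using True by (simp add: r_def fps_shift_times_fps_X_power)
      moreover have "h * m = h * i + h * (m - i)"
        using True by (simp flip: distrib_left)
      ultimately show ?thesis by (simp add: power_add ac_simps)
    next
      case F: False
      show ?thesis
      proof (cases "poly.coeff Q i = 0")
        case True
        then show ?thesis using d by (simp add: r0 ramify_hom)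
      next
        case False
        then have "h * i = h * m + h * (i - m)" using F by (simp flip: distrib_left)
        then show ?thesis using F False by (simp add: r_def power_add ac_simps)
      qed
    qed
    define R where "R = (\<Sum>i\<le>degree Q. Polynomial.monom (r i) i)"
    have Rc: "poly.coeff R i = r i" for i
      unfolding R_def by (auto simp: coeff_sum r0 coeff_eq_0)
    have degR: "degree R \<le> degree Q"
      by (rule degree_le) (auto simp: Rc r0 coeff_eq_0)
    have scale: "fps_X ^ (h * m * L) * poly (map_poly (ramify L) R) \<sigma> =
        poly (map_poly (ramify (d * L)) Q) (fps_X ^ (h * L) * \<sigma>)" if L: "L > 0" for L \<sigma>
    proof -
      have e: "fps_X ^ (h * m * L) * ramify L (r i) = fps_X ^ (h * L * i) * ramify (d * L) (poly.coeff Q i)" for i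
      proof -
        have "ramify L (fps_X ^ (h * m) * r i) = ramify L (fps_X ^ (h * i) * ramify d (poly.coeff Q i))"
          by (simp only: rX)
        then show ?thesis using L d
          by (simp add: ramify_hom ramify_ramify ac_simps flip: power_mult)
      qed
      have "fps_X ^ (h * m * L) * poly (map_poly (ramify L) R) \<sigma> =
         (\<Sum>i\<le>degree Q. fps_X ^ (h * m * L) * ramify L (r i) * \<sigma> ^ i)"
        by (subst poly_eq_sum_le[of _ "degree Q"])
           (use degR L in \<open>auto simp: coeff_map_poly ramify_hom Rc sum_distrib_left ac_simps
              intro: order.trans[OF degree_map_poly_le]\<close>)
      also have "\<dots> = (\<Sum>i\<le>degree Q. ramify (d * L) (poly.coeff Q i) * (fps_X ^ (h * L) * \<sigma>) ^ i)"
        by (intro sum.cong refl, subst e) (simp only: power_mult_distrib power_mult[symmetric] ac_simps)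
      also have "\<dots> = poly (map_poly (ramify (d * L)) Q) (fps_X ^ (h * L) * \<sigma>)"
        by (subst poly_eq_sum_le[of _ "degree Q"])
           (use L d in \<open>auto simp: coeff_map_poly ramify_hom intro: degree_map_poly_le\<close>)
      finally show ?thesis .
    qed
    define \<rho> where "\<rho> = ?red R"
    have \<rho>c: "poly.coeff \<rho> i = fps_nth (r i) 0" for i by (simp add: \<rho>_def coeff_map_poly Rc)
    have \<rho>m: "poly.coeff \<rho> m \<noteq> 0"
      using less.prems(3) d by (simp add: \<rho>c r_def ramify_nth_0 Q0)
    have \<rho>gt: "poly.coeff \<rho> i = 0" if "i > m" for i
      using that h by (simp add: \<rho>c r_def)
    have \<rho>m1: "poly.coeff \<rho> (m - 1) = 0" using Qm1 by (simp add: \<rho>c r0)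
    have \<rho>i0: "poly.coeff \<rho> i0 \<noteq> 0"
    proof -
      have "fps_nth (ramify d (poly.coeff Q i0)) (subdegree (ramify d (poly.coeff Q i0))) \<noteq> 0"
        using i0m d by (intro nth_subdegree_nonzero) (simp add: ramify_eq_0)
      then show ?thesis using i0m d
        by (simp add: \<rho>c r_def subdegree_ramify flip: d_def h_def) (simp add: mult.commute)
    qed
    have deg\<rho>: "degree \<rho> = m"
      by (rule antisym) (use \<rho>gt \<rho>m in \<open>auto intro: degree_le le_degree\<close>)
    have "\<not> constant (poly \<rho>)" using deg\<rho> less.prems(1) by (simp add: constant_degree)
    then obtain z where z: "poly \<rho> z = 0" using fundamental_theorem_of_algebra by blast
    define \<tau> where "\<tau> = pcompose \<rho> [:z, 1:]"
    have \<tau>0: "poly.coeff \<tau> 0 = 0" using z by (simp add: \<tau>_def)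
    have "\<exists>i<m. poly.coeff \<tau> i \<noteq> 0"
    proof (cases "poly.coeff \<tau> (m - 1) = 0")
      case True
      let ?D = "(pderiv ^^ (m - 1)) \<rho>"
      have "degree ?D \<le> 1" using deg\<rho> by (simp add: degree_higher_pderiv)
      then have "poly ?D z = poly.coeff ?D 0 + poly.coeff ?D 1 * z"
        by (simp add: poly_eq_sum_le)
      moreover have "poly ?D z = 0"
        using True by (simp add: poly_higher_pderiv_eq_coeff_shift \<tau>_def)
      moreover have "poly.coeff ?D 0 = 0" using \<rho>m1 by (simp add: coeff_higher_pderiv)
      moreover have "poly.coeff ?D 1 \<noteq> 0"
      proof -
        have "poly.coeff ?D 1 = of_nat (pochhammer (Suc 1) (m - 1)) * poly.coeff \<rho> m"
          using less.prems(1) unfolding coeff_higher_pderiv pochhammer_of_nat by simp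
        moreover have "pochhammer (Suc 1) (m - 1) > 0" by (rule pochhammer_pos) simp
        ultimately show ?thesis using \<rho>m by (simp)
      qed
      ultimately have "z = 0" by simp
      then have "\<tau> = \<rho>" by (simp add: \<tau>_def)
      with \<rho>i0 i0m show ?thesis by blast
    next
      case False
      then show ?thesis using less.prems(1) by (intro exI[of _ "m - 1"]) simp
    qed
    then obtain k where k: "k < m" "poly.coeff \<tau> k \<noteq> 0" "\<And>i. i < k \<Longrightarrow> poly.coeff \<tau> i = 0"
      using exists_least_iff[of "\<lambda>i. i < m \<and> poly.coeff \<tau> i \<noteq> 0"] by force
    define S where "S = pcompose R [:fps_const z, 1:]"
    have "?red S = \<tau>" unfolding S_def \<tau>_def \<rho>_def const_coeff_shift by simp
    then have Sc: "fps_nth (poly.coeff S i) 0 = poly.coeff \<tau> i" for i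
      by (auto simp: coeff_map_poly)
    have "k \<ge> 1" using k(2) \<tau>0 by (cases k) auto
    then obtain L \<sigma> where L: "L > 0" "fps_nth \<sigma> 0 = 0" "poly (map_poly (ramify L) S) \<sigma> = 0"
      using less.IH[of k S] k Sc by auto
    have "poly (map_poly (ramify L) R) (fps_const z + \<sigma>) = 0"
      using L by (simp add: S_def poly_ramify_shift ramify_hom)
    then have "poly (map_poly (ramify (d * L)) Q) (fps_X ^ (h * L) * (fps_const z + \<sigma>)) = 0"
      using scale[OF L(1), of "fps_const z + \<sigma>"] by simp
    moreover have "fps_nth (fps_X ^ (h * L) * (fps_const z + \<sigma>)) 0 = 0"
      using h L(1) by simp
    ultimately show ?thesis using d L(1)
      by (intro exI[of _ "d * L"] exI[of _ "fps_X ^ (h * L) * (fps_const z + \<sigma>)"]) simp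
  qed
  then obtain L \<sigma> where L: "L > 0" "fps_nth \<sigma> 0 = 0" "poly (map_poly (ramify L) Q) \<sigma> = 0" by blast
  then have "poly (map_poly (ramify L) P) (ramify L s0 + \<sigma>) = 0"
    by (simp add: Q_def poly_ramify_shift)
  then show ?case using L s0
    by (intro exI[of _ L] exI[of _ "ramify L s0 + \<sigma>"]) (simp add: ramify_nth_0)
qed

corollary newton_puiseux_root_over:
  fixes P :: "complex fps poly"
  assumes "map_poly (\<lambda>c. fps_nth c 0) P \<noteq> 0" "poly (map_poly (\<lambda>c. fps_nth c 0) P) z = 0"
  shows "\<exists>L \<sigma>. L > 0 \<and> fps_nth \<sigma> 0 = z \<and> poly (map_poly (ramify L) P) \<sigma> = 0"
proof -
  let ?\<rho> = "map_poly (\<lambda>c. fps_nth c 0) P"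
  define \<tau> where "\<tau> = pcompose ?\<rho> [:z, 1:]"
  have "\<tau> \<noteq> 0" using assms(1) by (simp add: \<tau>_def pcompose_eq_0_iff)
  then obtain k where k: "poly.coeff \<tau> k \<noteq> 0" "\<And>i. i < k \<Longrightarrow> poly.coeff \<tau> i = 0"
    using exists_least_iff[of "\<lambda>i. poly.coeff \<tau> i \<noteq> 0"] by (auto simp: poly_eq_iff)
  have "poly.coeff \<tau> 0 = 0" using assms(2) by (simp add: \<tau>_def)
  then have "k \<ge> 1" using k(1) by (cases k) auto
  define S where "S = pcompose P [:fps_const z, 1:]"
  have "map_poly (\<lambda>c. fps_nth c 0) S = \<tau>" unfolding S_def \<tau>_def const_coeff_shift by simp
  then have Sc: "fps_nth (poly.coeff S i) 0 = poly.coeff \<tau> i" for i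
    by (auto simp: coeff_map_poly)
  obtain L \<sigma> where L: "L > 0" "fps_nth \<sigma> 0 = 0" "poly (map_poly (ramify L) S) \<sigma> = 0"
    using newton_puiseux_root[of k S] \<open>k \<ge> 1\<close> k Sc by auto
  then have "poly (map_poly (ramify L) P) (fps_const z + \<sigma>) = 0"
    by (simp add: S_def poly_ramify_shift ramify_hom)
  with L show ?thesis by (intro exI[of _ L] exI[of _ "fps_const z + \<sigma>"]) simp
qed

section \<open>Orders of Puiseux series\<close>

text \<open>
Laurent series are lifted to Puiseux series as such, not through their coefficient functions.
\<close>

lifting_forget fls.lifting

text \<open>
The embedding \<open>F(t) \<mapsto> F(t\<^bsup>1/N\<^esup>)\<close>. Raising \<open>N\<close> to at least \<open>1\<close> keeps the pair inside the domain of the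
partial quotient.
\<close>

lift_definition puiseux_of :: "nat \<Rightarrow> complex fls \<Rightarrow> puiseux" is "\<lambda>N F. (max 1 N, F)"
  by (simp add: puiseux_rel_def)

lemma puiseux_of_hom:
  assumes N: "N > 0"
  shows "puiseux_of N (F + G) = puiseux_of N F + puiseux_of N G"
    "puiseux_of N (F * G) = puiseux_of N F * puiseux_of N G"
    "puiseux_of N (fls_const c) = puiseux_const c"
    "puiseux_of N 0 = 0" "puiseux_of N 1 = 1"
  using N by (transfer; simp add: puiseux_rel_def fcp_fcp ac_simps max_def)+

lemma puiseux_of_eq_0: "N > 0 \<Longrightarrow> puiseux_of N F = 0 \<longleftrightarrow> F = 0"
  by transfer (auto simp: puiseux_rel_def max_def)

lemma puiseux_ord_of: "N > 0 \<Longrightarrow> puiseux_ord (puiseux_of N F) = of_int (fls_subdegree F) / of_nat N"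
  by transfer (simp add: max_def)

lemma puiseux_of_cases:
  obtains N F where "N > 0" "x = puiseux_of N F"
proof -
  have "\<exists>N F. N > 0 \<and> x = puiseux_of N F"
  proof (transfer, clarify)
    fix N F assume "puiseux_rel (N, F) (N, F)"
    then show "\<exists>M G. M > 0 \<and> puiseux_rel (N, F) (max 1 M, G)"
      by (intro exI[of _ N] exI[of _ F]) (auto simp: puiseux_rel_def max_def)
  qed
  then show thesis using that by blast
qed

lemma puiseux_of_rescale:
  "N > 0 \<Longrightarrow> M > 0 \<Longrightarrow> puiseux_of N F = puiseux_of (N * M) (fls_compose_power F M)"
  by transfer (auto simp: puiseux_rel_def max_def fcp_fcp ac_simps)

text \<open>
Sums are computed over a common denominator of the exponents; this reduces every statement about two
Puiseux series to Laurent series.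
\<close>

lemma puiseux_of_common:
  obtains N F G where "N > 0" "x = puiseux_of N F" "y = puiseux_of N G"
proof -
  obtain N F where 1: "N > 0" "x = puiseux_of N F" by (rule puiseux_of_cases)
  obtain M G where 2: "M > 0" "y = puiseux_of M G" by (rule puiseux_of_cases)
  show thesis
    by (rule that[of "N * M" "fls_compose_power F M" "fls_compose_power G N"])
       (use 1 2 puiseux_of_rescale[of N M F] puiseux_of_rescale[of M N G] in \<open>auto simp: mult.commute\<close>)
qed

lemma puiseux_of_sum: "N > 0 \<Longrightarrow> puiseux_of N (\<Sum>x\<in>X. f x) = (\<Sum>x\<in>X. puiseux_of N (f x))"
  by (induction X rule: infinite_finite_induct) (auto simp: puiseux_of_hom)

lemma puiseux_of_prod: "N > 0 \<Longrightarrow> puiseux_of N (\<Prod>x\<in>X. f x) = (\<Prod>x\<in>X. puiseux_of N (f x))"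
  by (induction X rule: infinite_finite_induct) (auto simp: puiseux_of_hom)

lemma puiseux_of_power: "N > 0 \<Longrightarrow> puiseux_of N (F ^ k) = puiseux_of N F ^ k"
  by (induction k) (auto simp: puiseux_of_hom)

lemma puiseux_ord_mult:
  assumes "x \<noteq> 0" "y \<noteq> 0" shows "puiseux_ord (x * y) = puiseux_ord x + puiseux_ord y"
proof -
  obtain N F G where N: "N > 0" "x = puiseux_of N F" "y = puiseux_of N G" by (rule puiseux_of_common)
  with assms have "F \<noteq> 0" "G \<noteq> 0" by (auto simp: puiseux_of_eq_0)
  with N show ?thesis
    by (simp add: puiseux_ord_of add_divide_distrib flip: puiseux_of_hom)
qed

lemma puiseux_const_eq_0: "puiseux_const c = 0 \<longleftrightarrow> c = 0"
  using puiseux_of_eq_0[of 1 "fls_const c"] by (simp add: puiseux_of_hom fls_const_nonzero)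

lemma puiseux_ord_const: "puiseux_ord (puiseux_const c) = 0"
  using puiseux_ord_of[of 1 "fls_const c"] by (simp add: puiseux_of_hom)

lemma puiseux_ord_power: "x \<noteq> 0 \<Longrightarrow> puiseux_ord (x ^ k) = of_nat k * puiseux_ord x"
proof (induction k)
  case 0
  show ?case using puiseux_ord_const[of 1] puiseux_of_hom(3)[of 1 1] by (simp add: puiseux_of_hom)
qed (simp add: puiseux_ord_mult algebra_simps)

lemma puiseux_ord_prod:
  "finite X \<Longrightarrow> (\<And>x. x \<in> X \<Longrightarrow> f x \<noteq> 0) \<Longrightarrow> puiseux_ord (\<Prod>x\<in>X. f x) = (\<Sum>x\<in>X. puiseux_ord (f x))"
proof (induction X rule: finite_induct)
  case empty
  show ?case using puiseux_ord_power[of 1 0] by simp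
qed (simp add: puiseux_ord_mult prod_zero_iff)

lemma puiseux_ord_add_gt:
  assumes "x = 0 \<or> puiseux_ord x > c" "y = 0 \<or> puiseux_ord y > c"
  shows "x + y = 0 \<or> puiseux_ord (x + y) > c"
proof (cases "x = 0 \<or> y = 0 \<or> x + y = 0")
  case False
  obtain N F G where N: "N > 0" "x = puiseux_of N F" "y = puiseux_of N G" by (rule puiseux_of_common)
  have "F + G \<noteq> 0" using False N by (auto simp: puiseux_of_eq_0 simp flip: puiseux_of_hom)
  then have "fls_subdegree (F + G) \<ge> min (fls_subdegree F) (fls_subdegree G)"
    by (rule fls_plus_subdegree)
  then have "rat_of_int (fls_subdegree (F + G)) \<ge> of_int (min (fls_subdegree F) (fls_subdegree G))"
    by (simp only: of_int_le_iff)
  moreover have "rat_of_int (min (fls_subdegree F) (fls_subdegree G)) > c * of_nat N"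
    using assms False N by (simp add: puiseux_ord_of field_simps min_def)
  ultimately have "rat_of_int (fls_subdegree (F + G)) > c * of_nat N" by linarith
  then show ?thesis using N by (simp add: puiseux_ord_of field_simps flip: puiseux_of_hom)
qed (use assms in auto)

lemma puiseux_ord_sum_gt:
  "finite X \<Longrightarrow> (\<And>x. x \<in> X \<Longrightarrow> puiseux_ord (f x) > c) \<Longrightarrow> sum f X = 0 \<or> puiseux_ord (sum f X) > c"
proof (induction X rule: finite_induct)
  case (insert x X)
  then show ?case using puiseux_ord_add_gt[of "f x" c "sum f X"] by auto
qed simp

section \<open>Tropical hypersurfaces with constant coefficients\<close>

definition monomial_value :: "puiseux ^ 'n::finite \<Rightarrow> nat ^ 'n \<Rightarrow> puiseux" where
  "monomial_value v \<alpha> = (\<Prod>i\<in>UNIV. (v $ i) ^ (\<alpha> $ i))"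

lemma ord_monomial_value:
  assumes v: "\<And>i. v $ i \<noteq> 0"
  shows "monomial_value v \<alpha> \<noteq> 0" "of_rat (puiseux_ord (monomial_value v \<alpha>)) = wdot (ord_vec v) \<alpha>"
proof -
  show "monomial_value v \<alpha> \<noteq> 0" using v by (simp add: monomial_value_def prod_zero_iff)
  have "puiseux_ord (monomial_value v \<alpha>) = (\<Sum>i\<in>UNIV. of_nat (\<alpha> $ i) * puiseux_ord (v $ i))"
    unfolding monomial_value_def using v
    by (subst puiseux_ord_prod) (simp_all add: puiseux_ord_power)
  then show "of_rat (puiseux_ord (monomial_value v \<alpha>)) = wdot (ord_vec v) \<alpha>"
    by (simp add: wdot_def ord_vec_def of_rat_sum of_rat_mult mult.commute)
qed

lemma continuous_wdot: "continuous_on UNIV (\<lambda>u. wdot u \<alpha>)"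
  unfolding wdot_def by (intro continuous_intros)

lemma strict_min_nhd:
  assumes "finite B" "\<And>\<beta>. \<beta> \<in> B \<Longrightarrow> wdot w \<alpha> < wdot w \<beta>"
  shows "\<exists>U. open U \<and> w \<in> U \<and> (\<forall>u\<in>U. \<forall>\<beta>\<in>B. wdot u \<alpha> < wdot u \<beta>)"
proof (intro exI conjI)
  show "open (\<Inter>\<beta>\<in>B. {u. wdot u \<alpha> < wdot u \<beta>})"
    using assms(1) by (intro open_INT ballI open_Collect_less continuous_wdot) auto
qed (use assms in auto)

text \<open>
Strictness of the minimum persists on a neighbourhood of \<open>w\<close>. At a zero with order vector there, one
term would have a strictly smaller order than all others, and the sum could not vanish.
\<close>

lemma unique_min_not_tropical:
  fixes p :: "'n::finite pow"
  assumes fin: "finite (supp p)" and \<alpha>: "\<alpha> \<in> supp p"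
    and min: "\<And>\<beta>. \<beta> \<in> supp p \<Longrightarrow> \<beta> \<noteq> \<alpha> \<Longrightarrow> wdot w \<alpha> < wdot w \<beta>"
  shows "w \<notin> closure (ord_vec ` torus_zeros p)"
proof
  assume w: "w \<in> closure (ord_vec ` torus_zeros p)"
  obtain U where U: "open U" "w \<in> U" "\<And>u \<beta>. u \<in> U \<Longrightarrow> \<beta> \<in> supp p - {\<alpha>} \<Longrightarrow> wdot u \<alpha> < wdot u \<beta>"
    using strict_min_nhd[of "supp p - {\<alpha>}" w \<alpha>] fin min by auto
  have "U \<inter> ord_vec ` torus_zeros p \<noteq> {}"
    using w U(2) open_Int_closure_eq_empty[OF U(1), of "ord_vec ` torus_zeros p"] by blast
  then obtain v where v: "v \<in> torus_zeros p" "ord_vec v \<in> U" by auto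
  then have v0: "\<And>i. v $ i \<noteq> 0" by (simp add: torus_zeros_def)
  define T where "T \<beta> = puiseux_const (p \<beta>) * monomial_value v \<beta>" for \<beta>
  have T0: "T \<beta> \<noteq> 0" and Tord: "of_rat (puiseux_ord (T \<beta>)) = wdot (ord_vec v) \<beta>"
    if "\<beta> \<in> supp p" for \<beta>
    using that ord_monomial_value[OF v0]
    by (auto simp: T_def supp_def puiseux_const_eq_0 puiseux_ord_mult puiseux_ord_const)
  have "sum T (supp p) = 0"
    using v by (simp add: torus_zeros_def poly_eval_def T_def monomial_value_def)
  then have s: "T \<alpha> = - sum T (supp p - {\<alpha>})"
    using fin \<alpha> by (simp add: sum.remove eq_neg_iff_add_eq_0)
  have "puiseux_ord (T \<alpha>) < puiseux_ord (T \<beta>)" if "\<beta> \<in> supp p - {\<alpha>}" for \<beta>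
    using U(3)[OF v(2) that] Tord that \<alpha> by (metis DiffD1 of_rat_less)
  then have "sum T (supp p - {\<alpha>}) = 0 \<or> puiseux_ord (sum T (supp p - {\<alpha>})) > puiseux_ord (T \<alpha>)"
    using fin by (intro puiseux_ord_sum_gt) auto
  moreover have "puiseux_ord (- x) = puiseux_ord x" for x
    by transfer (auto split: prod.splits)
  ultimately show False using s T0[OF \<alpha>] by auto
qed

text \<open>
The coordinates are read as digits: a new coordinate gets as factor a base larger than all values
obtained from the previous ones.
\<close>

lemma separating_exponent:
  fixes M :: "(nat ^ 'n::finite) set"
  assumes "finite M"
  shows "\<exists>a :: 'n \<Rightarrow> nat. inj_on (\<lambda>\<alpha>. \<Sum>i\<in>UNIV. a i * \<alpha> $ i) M"
proof -
  have "\<exists>a :: 'n \<Rightarrow> nat. \<forall>\<alpha>\<in>M. \<forall>\<beta>\<in>M. (\<Sum>i\<in>X. a i * \<alpha> $ i) = (\<Sum>i\<in>X. a i * \<beta> $ i) \<longrightarrow> (\<forall>i\<in>X. \<alpha> $ i = \<beta> $ i)"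
    if "finite X" for X :: "'n set"
    using that
  proof (induction X rule: finite_induct)
    case (insert j X)
    then obtain a :: "'n \<Rightarrow> nat" where a:
      "\<And>\<alpha> \<beta>. \<alpha> \<in> M \<Longrightarrow> \<beta> \<in> M \<Longrightarrow> (\<Sum>i\<in>X. a i * \<alpha> $ i) = (\<Sum>i\<in>X. a i * \<beta> $ i) \<Longrightarrow> \<forall>i\<in>X. \<alpha> $ i = \<beta> $ i"
      by metis
    define s where "s \<alpha> = (\<Sum>i\<in>X. a i * \<alpha> $ i)" for \<alpha> :: "nat ^ 'n"
    define B where "B = Suc (\<Sum>\<alpha>\<in>M. s \<alpha>)"
    have sB: "s \<alpha> < B" if "\<alpha> \<in> M" for \<alpha>
      unfolding B_def using assms that by (auto simp: less_Suc_eq_le intro: member_le_sum)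
    define a' where "a' = a(j := B)"
    have s': "(\<Sum>i\<in>insert j X. a' i * \<alpha> $ i) = B * \<alpha> $ j + s \<alpha>" for \<alpha> :: "nat ^ 'n"
      using insert.hyps by (auto simp: s_def a'_def intro!: sum.cong)
    show ?case
    proof (rule exI[of _ a'], intro ballI impI)
      fix \<alpha> \<beta> i assume m: "\<alpha> \<in> M" "\<beta> \<in> M" and i: "i \<in> insert j X"
        and "(\<Sum>i\<in>insert j X. a' i * \<alpha> $ i) = (\<Sum>i\<in>insert j X. a' i * \<beta> $ i)"
      then have e: "B * \<alpha> $ j + s \<alpha> = B * \<beta> $ j + s \<beta>" by (simp add: s')
      have "s \<alpha> = (B * \<alpha> $ j + s \<alpha>) mod B" "s \<beta> = (B * \<beta> $ j + s \<beta>) mod B"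
        using sB m by simp_all
      with e have "s \<alpha> = s \<beta>" by simp
      moreover from this e have "\<alpha> $ j = \<beta> $ j" using sB[OF m(1)] by simp
      ultimately show "\<alpha> $ i = \<beta> $ i" using a[OF m] i by (auto simp: s_def)
    qed
  qed simp
  from this[OF finite_class.finite_UNIV] obtain a :: "'n \<Rightarrow> nat" where
    "\<forall>\<alpha>\<in>M. \<forall>\<beta>\<in>M. (\<Sum>i\<in>UNIV. a i * \<alpha> $ i) = (\<Sum>i\<in>UNIV. a i * \<beta> $ i) \<longrightarrow> (\<forall>i\<in>UNIV. \<alpha> $ i = \<beta> $ i)"
    ..
  then show ?thesis unfolding inj_on_def vec_eq_iff by blast
qed

lemma nonzero_root_if_two_terms:
  fixes p :: "complex poly"
  assumes "poly.coeff p i \<noteq> 0" "poly.coeff p j \<noteq> 0" "i \<noteq> j"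
  shows "\<exists>z. z \<noteq> 0 \<and> poly p z = 0"
proof -
  have p0: "p \<noteq> 0" using assms by auto
  then obtain q where q: "p = [:-0, 1:] ^ Polynomial.order 0 p * q" "\<not> [:-0, 1:] dvd q"
    using order_decomp by blast
  have q0: "poly q 0 \<noteq> 0" using q(2) poly_eq_0_iff_dvd[of q 0] by simp
  have "degree q \<noteq> 0"
  proof
    assume "degree q = 0"
    then obtain c where "q = [:c:]" by (metis degree_eq_zeroE)
    then have "p = Polynomial.monom c (Polynomial.order 0 p)"
      using q(1) by (simp add: monom_altdef)
    then have "poly.coeff p n = poly.coeff (Polynomial.monom c (Polynomial.order 0 p)) n" for n
      by (rule arg_cong)
    then have "poly.coeff p n = (if Polynomial.order 0 p = n then c else 0)" for n
      by (simp only: Polynomial.coeff_monom)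
    then show False using assms by (metis (full_types))
  qed
  then have "\<not> constant (poly q)" by (simp add: constant_degree)
  then obtain z where z: "poly q z = 0" using fundamental_theorem_of_algebra by blast
  then have "z \<noteq> 0" using q0 by auto
  moreover have "poly p z = 0" using z arg_cong[OF q(1), of "\<lambda>p. poly p z"] by (simp only: poly_mult)  simp
  ultimately show ?thesis by blast
qed

lemma fls_X_intpow_prod:
  "finite X \<Longrightarrow> (\<Prod>i\<in>X. (fls_X_intpow (e i) :: complex fls)) = fls_X_intpow (\<Sum>i\<in>X. e i)"
  by (induction X rule: finite_induct) (auto simp: fls_X_intpow_times_fls_X_intpow)

lemma poly_map_ramify_sum:
  assumes "finite X" "L > 0"
  shows "poly (map_poly (ramify L) (\<Sum>\<alpha>\<in>X. Polynomial.monom (c \<alpha>) (e \<alpha>))) \<sigma> = (\<Sum>\<alpha>\<in>X. ramify L (c \<alpha>) * \<sigma> ^ e \<alpha>)"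
  using assms(1)
proof (induction X rule: finite_induct)
  case (insert x X)
  have add: "map_poly (ramify L) (p + q) = map_poly (ramify L) p + map_poly (ramify L) q" for p q
    using assms(2) by (intro poly_eqI) (simp add: coeff_map_poly ramify_hom)
  show ?case using insert assms(2)
    by (simp add: add map_poly_monom ramify_hom poly_monom)
qed (simp add: ramify_hom)

text \<open>
Substituting \<open>x\<^sub>i = t\<^bsup>w\<^sub>i\<^esup> s\<^bsup>a\<^sub>i\<^esup>\<close> and dividing by the smallest power of \<open>t\<close> turns \<open>p\<close> into a polynomial \<open>P\<close>
in \<open>s\<close> over \<open>\<complex>[[t]]\<close>. As \<open>a\<close> separates the terms of \<open>p\<close>, the two tied terms survive in the reduction of
\<open>P\<close> at different powers of \<open>s\<close>, so the reduction has a nonzero root. A lift of it is a unit, and the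
order of \<open>x\<^sub>i\<close> is \<open>w\<^sub>i\<close>.
\<close>

lemma two_minimizers_rational_tropical:
  fixes p :: "'n::finite pow" and k :: "'n \<Rightarrow> int"
  assumes fin: "finite (supp p)" and N: "N > 0" and w: "\<And>i. w $ i = real_of_int (k i) / real N"
    and mem: "\<alpha>1 \<in> supp p" "\<alpha>2 \<in> supp p" "\<alpha>1 \<noteq> \<alpha>2" "wdot w \<alpha>1 = wdot w \<alpha>2"
    and min: "\<And>\<beta>. \<beta> \<in> supp p \<Longrightarrow> wdot w \<alpha>1 \<le> wdot w \<beta>"
  shows "w \<in> ord_vec ` torus_zeros p"
proof -
  obtain a :: "'n \<Rightarrow> nat" where a: "inj_on (\<lambda>\<alpha>. \<Sum>i\<in>UNIV. a i * \<alpha> $ i) (supp p)"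
    using separating_exponent[OF fin] by blast
  define A where "A \<alpha> = (\<Sum>i\<in>UNIV. a i * \<alpha> $ i)" for \<alpha> :: "nat ^ 'n"
  define e where "e \<alpha> = (\<Sum>i\<in>UNIV. k i * int (\<alpha> $ i))" for \<alpha> :: "nat ^ 'n"
  have we: "wdot w \<alpha> = of_int (e \<alpha>) / real N" for \<alpha>
    by (simp add: wdot_def w e_def sum_divide_distrib)
  define e0 where "e0 = e \<alpha>1"
  have e2: "e \<alpha>2 = e0" using mem(4) N by (simp add: we e0_def)
  have ege: "e \<beta> \<ge> e0" if "\<beta> \<in> supp p" for \<beta>
    using min[OF that] N by (simp add: we e0_def divide_le_cancel)
  define c where "c \<alpha> = fps_const (p \<alpha>) * fps_X ^ nat (e \<alpha> - e0)" for \<alpha>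
  define P where "P = (\<Sum>\<alpha>\<in>supp p. Polynomial.monom (c \<alpha>) (A \<alpha>))"
  have Pc: "poly.coeff P (A \<alpha>) = c \<alpha>" if "\<alpha> \<in> supp p" for \<alpha>
  proof -
    have "poly.coeff P (A \<alpha>) = (\<Sum>\<beta>\<in>supp p. if \<beta> = \<alpha> then c \<alpha> else 0)"
      unfolding P_def coeff_sum
      using a that by (intro sum.cong) (auto simp: inj_on_def A_def)
    then show ?thesis using fin that by simp
  qed
  define \<rho> where "\<rho> = map_poly (\<lambda>c. fps_nth c 0) P"
  have "poly.coeff \<rho> (A \<alpha>1) \<noteq> 0" "poly.coeff \<rho> (A \<alpha>2) \<noteq> 0"
    using Pc mem e2 by (simp_all add: \<rho>_def coeff_map_poly c_def e0_def supp_def)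
  moreover have "A \<alpha>1 \<noteq> A \<alpha>2" using a mem by (auto simp: inj_on_def A_def)
  ultimately obtain z where z: "z \<noteq> 0" "poly \<rho> z = 0" and "\<rho> \<noteq> 0"
    using nonzero_root_if_two_terms[of \<rho>] by (metis coeff_0)
  then obtain L \<sigma> where L: "L > 0" and \<sigma>: "fps_nth \<sigma> 0 = z" "poly (map_poly (ramify L) P) \<sigma> = 0"
    using newton_puiseux_root_over[of P z] by (auto simp: \<rho>_def)
  have NL: "N * L > 0" using N L by simp
  have \<sigma>0: "\<sigma> \<noteq> 0" "subdegree \<sigma> = 0" using \<sigma>(1) z(1) by auto
  define F where "F i = fls_X_intpow (int L * k i) * fps_to_fls \<sigma> ^ a i" for i
  have F0: "F i \<noteq> 0" for i using \<sigma>0 by (simp add: F_def)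
  have Fs: "fls_subdegree (F i) = int L * k i" for i
    using \<sigma>0 by (simp add: F_def fls_subdegree_pow fls_subdegree_fls_to_fps)
  define v :: "puiseux ^ 'n" where "v = (\<chi> i. puiseux_of (N * L) (F i))"
  have v0: "v $ i \<noteq> 0" for i using F0 NL by (simp add: v_def puiseux_of_eq_0)
  have ordv: "ord_vec v = w"
    using L N by (simp add: ord_vec_def vec_eq_iff v_def puiseux_ord_of Fs w of_rat_divide)
  have mv: "(\<Prod>i\<in>UNIV. (v $ i) ^ (\<alpha> $ i)) =
      puiseux_of (N * L) (fls_X_intpow (int L * e \<alpha>) * fps_to_fls \<sigma> ^ A \<alpha>)" for \<alpha>
  proof -
    have "(\<Prod>i\<in>UNIV. (F i) ^ (\<alpha> $ i)) = fls_X_intpow (int L * e \<alpha>) * fps_to_fls \<sigma> ^ A \<alpha>"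
    proof -
      have "(F i) ^ (\<alpha> $ i) = fls_X_intpow (int L * (k i * int (\<alpha> $ i))) * fps_to_fls \<sigma> ^ (a i * \<alpha> $ i)" for i
        by (simp add: F_def power_mult_distrib power_mult fls_X_intpow_power ac_simps)
      then show ?thesis
        by (simp add: prod.distrib fls_X_intpow_prod e_def A_def sum_distrib_left power_sum)
    qed
    then show ?thesis using NL
      by (simp add: v_def puiseux_of_power[OF NL, symmetric] puiseux_of_prod[OF NL, symmetric])
  qed
  have Xs: "(fls_X_intpow (int L * e \<alpha>) :: complex fls) = fls_X_intpow (int L * e0) * fps_to_fls (fps_X ^ (L * nat (e \<alpha> - e0)))"
    if "\<alpha> \<in> supp p" for \<alpha>
  proof -
    have "(fps_to_fls (fps_X ^ (L * nat (e \<alpha> - e0))) :: complex fls) = fls_X_intpow (int L * (e \<alpha> - e0))"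
      using ege[OF that] by (simp add: fps_to_fls_power fls_X_power_conv_shift_1)
    then show ?thesis
      by (simp only: fls_X_intpow_times_fls_X_intpow) (simp add: algebra_simps)
  qed
  have "poly_eval p v = puiseux_of (N * L)
      (\<Sum>\<alpha>\<in>supp p. fls_const (p \<alpha>) * (fls_X_intpow (int L * e \<alpha>) * fps_to_fls \<sigma> ^ A \<alpha>))"
    unfolding poly_eval_def mv
    by (simp add: puiseux_of_sum[OF NL] puiseux_of_hom(2)[OF NL] puiseux_of_hom(3)[OF NL])
  also have "(\<Sum>\<alpha>\<in>supp p. fls_const (p \<alpha>) * (fls_X_intpow (int L * e \<alpha>) * fps_to_fls \<sigma> ^ A \<alpha>)) =
      (\<Sum>\<alpha>\<in>supp p. fls_X_intpow (int L * e0) * fps_to_fls (ramify L (c \<alpha>) * \<sigma> ^ A \<alpha>))"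
    using L by (intro sum.cong refl, subst Xs)
      (simp_all add: c_def ramify_hom fls_times_fps_to_fls fps_to_fls_power power_mult)
  also have "\<dots> = fls_X_intpow (int L * e0) * fps_to_fls (\<Sum>\<alpha>\<in>supp p. ramify L (c \<alpha>) * \<sigma> ^ A \<alpha>)"
  proof -
    have "fps_to_fls (sum f X) = (\<Sum>x\<in>X. fps_to_fls (f x))" for f :: "(nat ^ 'n) \<Rightarrow> complex fps" and X
      by (induction X rule: infinite_finite_induct) auto
    then show ?thesis by (simp add: sum_distrib_left)
  qed
  also have "(\<Sum>\<alpha>\<in>supp p. ramify L (c \<alpha>) * \<sigma> ^ A \<alpha>) = 0"
    using \<sigma>(2) by (simp add: P_def poly_map_ramify_sum[OF fin L])
  finally have "poly_eval p v = 0" using NL by (simp add: puiseux_of_hom)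
  then have "v \<in> torus_zeros p" using v0 by (simp add: torus_zeros_def)
  then show ?thesis using ordv by blast
qed

lemma vector_space_real_over_rat: "vector_space (\<lambda>(q::rat) (x::real). of_rat q * x)"
  by unfold_locales (simp_all add: algebra_simps of_rat_add of_rat_mult)

lemma rational_sequence:
  fixes b :: real
  shows "\<exists>r :: nat \<Rightarrow> rat. (\<lambda>m. real_of_rat (r m)) \<longlonglongrightarrow> b"
proof -
  have "\<forall>m. \<exists>q. b < real_of_rat q \<and> real_of_rat q < b + 1 / real (Suc m)"
    by (intro allI of_rat_dense) simp
  then obtain r where r: "\<And>m. b < real_of_rat (r m) \<and> real_of_rat (r m) < b + 1 / real (Suc m)" by metis
  have "(\<lambda>m. b + 1 / real (Suc m)) \<longlonglongrightarrow> b"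
    using LIMSEQ_inverse_real_of_nat_add[of b] by (simp add: inverse_eq_divide)
  then have "(\<lambda>m. real_of_rat (r m)) \<longlonglongrightarrow> b"
    by (rule tendsto_sandwich[rotated 2, OF tendsto_const])
       (use r in \<open>auto intro!: always_eventually less_imp_le\<close>)
  then show ?thesis by blast
qed

lemma common_denominator:
  fixes r :: "'n::finite \<Rightarrow> rat"
  shows "\<exists>N>0. \<exists>k :: 'n \<Rightarrow> int. \<forall>i. r i = of_int (k i) / of_nat N"
proof -
  have "\<forall>i. \<exists>a b. b > 0 \<and> r i = of_int a / of_int b"
    by (metis quotient_of_denom_pos' quotient_of_div prod.collapse)
  then obtain a b where ab: "\<And>i. b i > 0" "\<And>i. r i = of_int (a i) / of_int (b i)" by metis
  define N where "N = nat (\<Prod>i\<in>UNIV. b i)"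
  have Np: "(\<Prod>i\<in>UNIV. b i) > 0" by (rule prod_pos) (use ab in auto)
  have Ni: "rat_of_nat N = of_int (\<Prod>i\<in>UNIV. b i)" using Np by (simp add: N_def)
  have "r i = of_int (a i * (\<Prod>j\<in>UNIV - {i}. b j)) / of_nat N" for i
  proof -
    define P where "P = (\<Prod>j\<in>UNIV - {i}. b j)"
    have "(\<Prod>i\<in>UNIV. b i) = b i * P" unfolding P_def by (rule prod.remove) auto
    moreover have "P > 0" unfolding P_def by (rule prod_pos) (use ab in auto)
    ultimately show ?thesis using ab(1)[of i] unfolding Ni ab(2) P_def[symmetric]
      by (simp add: field_simps)
  qed
  moreover have "N > 0" using Np by (simp add: N_def)
  ultimately show ?thesis by (intro exI[of _ N] exI conjI allI)
qed

text \<open>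
Express the coordinates of \<open>w\<close> through a \<open>\<rat>\<close>-basis \<open>B\<close> of their span. Every rational relation between
the coordinates then holds identically in the elements of \<open>B\<close>, so it survives when these elements are
replaced by rational approximations.
\<close>

lemma rational_approximation_keeping_relations:
  fixes w :: "real ^ 'n::finite"
  shows "\<exists>W. W \<longlonglongrightarrow> w \<and>
     (\<forall>m. (\<exists>N>0. \<exists>k. \<forall>i. W m $ i = real_of_int (k i) / real N) \<and>
          (\<forall>c. (\<Sum>i\<in>UNIV. real_of_int (c i) * w $ i) = 0 \<longrightarrow> (\<Sum>i\<in>UNIV. real_of_int (c i) * W m $ i) = 0))"
proof -
  interpret Q: vector_space "\<lambda>(q::rat) (x::real). of_rat q * x" by (rule vector_space_real_over_rat)
  obtain B where B: "B \<subseteq> range (vec_nth w)" "Q.independent B" "range (vec_nth w) \<subseteq> Q.span B"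
    by (rule Q.maximal_independent_subset)
  have finB: "finite B" using B(1) by (rule finite_subset) simp
  have "\<forall>i. \<exists>u. w $ i = (\<Sum>b\<in>B. real_of_rat (u b) * b)"
  proof
    fix i
    have "w $ i \<in> range (\<lambda>u. \<Sum>b\<in>B. real_of_rat (u b) * b)"
      using B(3) unfolding Q.span_finite[OF finB] by (rule subsetD) (rule rangeI)
    then show "\<exists>u. w $ i = (\<Sum>b\<in>B. real_of_rat (u b) * b)" by (rule rangeE) (rule exI)
  qed
  then obtain q where q: "\<And>i. w $ i = (\<Sum>b\<in>B. real_of_rat (q i b) * b)" by metis
  obtain r :: "real \<Rightarrow> nat \<Rightarrow> rat" where r: "\<And>b. (\<lambda>m. real_of_rat (r b m)) \<longlonglongrightarrow> b"
    using rational_sequence by metis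
  define W :: "nat \<Rightarrow> real ^ 'n" where "W m = (\<chi> i. \<Sum>b\<in>B. real_of_rat (q i b) * real_of_rat (r b m))" for m
  have lim: "W \<longlonglongrightarrow> w"
    by (rule vec_tendstoI) (auto simp: W_def q intro!: tendsto_intros r)
  have rat: "\<exists>N>0. \<exists>k. \<forall>i. W m $ i = real_of_int (k i) / real N" for m
  proof -
    obtain N k where Nk: "N > 0" "\<And>i. (\<Sum>b\<in>B. q i b * r b m) = of_int (k i) / of_nat N"
      using common_denominator[of "\<lambda>i. \<Sum>b\<in>B. q i b * r b m"] by auto
    have "W m $ i = real_of_rat (\<Sum>b\<in>B. q i b * r b m)" for i
      by (simp add: W_def of_rat_sum of_rat_mult)
    then have "W m $ i = real_of_int (k i) / real N" for i
      unfolding Nk(2) by (simp add: of_rat_divide)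
    with Nk(1) show ?thesis by blast
  qed
  have rel: "(\<Sum>i\<in>UNIV. real_of_int (c i) * W m $ i) = 0"
    if c: "(\<Sum>i\<in>UNIV. real_of_int (c i) * w $ i) = 0" for m c
  proof -
    define d where "d b = (\<Sum>i\<in>UNIV. of_int (c i) * q i b)" for b
    have swap: "(\<Sum>i\<in>UNIV. real_of_int (c i) * (\<Sum>b\<in>B. real_of_rat (q i b) * y b)) = (\<Sum>b\<in>B. real_of_rat (d b) * y b)" for y
      unfolding d_def of_rat_sum of_rat_mult of_rat_of_int_eq sum_distrib_left sum_distrib_right
      by (subst sum.swap) (simp add: mult.assoc)
    have "(\<Sum>b\<in>B. real_of_rat (d b) * b) = 0" using c unfolding q swap .
    then have "d b = 0" if "b \<in> B" for b
      using Q.independentD[OF B(2) finB order_refl] that by blast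
    then show ?thesis by (simp add: W_def swap)
  qed
  show ?thesis using lim rat rel by blast
qed

text \<open>
A rational approximation of \<open>w\<close> that respects the integral relations of \<open>w\<close> keeps all ties, and once it
is close enough to \<open>w\<close> it keeps the strict inequalities as well.
\<close>

theorem two_minimizers_tropical:
  fixes p :: "'n::finite pow"
  assumes fin: "finite (supp p)"
    and mem: "\<alpha>1 \<in> supp p" "\<alpha>2 \<in> supp p" "\<alpha>1 \<noteq> \<alpha>2" "wdot w \<alpha>1 = wdot w \<alpha>2"
    and min: "\<And>\<beta>. \<beta> \<in> supp p \<Longrightarrow> wdot w \<alpha>1 \<le> wdot w \<beta>"
  shows "w \<in> closure (ord_vec ` torus_zeros p)"
proof -
  obtain W where W: "W \<longlonglongrightarrow> w" "\<And>m. \<exists>N>0. \<exists>k. \<forall>i. W m $ i = real_of_int (k i) / real N"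
    "\<And>m c. (\<Sum>i\<in>UNIV. real_of_int (c i) * w $ i) = 0 \<Longrightarrow> (\<Sum>i\<in>UNIV. real_of_int (c i) * W m $ i) = 0"
    using rational_approximation_keeping_relations[of w] by blast
  have tie: "wdot (W m) \<alpha>1 = wdot (W m) \<beta>" if "wdot w \<alpha>1 = wdot w \<beta>" for m \<beta>
    using W(3)[of "\<lambda>i. int (\<alpha>1 $ i) - int (\<beta> $ i)" m] that
    by (simp add: wdot_def algebra_simps sum_subtractf)
  obtain U where U: "open U" "w \<in> U"
    "\<And>u \<beta>. u \<in> U \<Longrightarrow> \<beta> \<in> {\<beta> \<in> supp p. wdot w \<alpha>1 \<noteq> wdot w \<beta>} \<Longrightarrow> wdot u \<alpha>1 < wdot u \<beta>"
    using strict_min_nhd[of "{\<beta> \<in> supp p. wdot w \<alpha>1 \<noteq> wdot w \<beta>}" w \<alpha>1] fin min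
    by (auto simp: less_le)
  have "eventually (\<lambda>m. W m \<in> U) sequentially"
    using W(1) U(1,2) by (rule topological_tendstoD)
  then have "eventually (\<lambda>m. W m \<in> closure (ord_vec ` torus_zeros p)) sequentially"
  proof eventually_elim
    case (elim m)
    obtain N k where Nk: "N > 0" "\<And>i. W m $ i = real_of_int (k i) / real N" using W(2) by blast
    have "wdot (W m) \<alpha>1 \<le> wdot (W m) \<beta>" if "\<beta> \<in> supp p" for \<beta>
      using U(3)[OF elim, of \<beta>] tie[of \<beta> m] that by (cases "wdot w \<alpha>1 = wdot w \<beta>") auto
    then have "W m \<in> ord_vec ` torus_zeros p"
      by (rule two_minimizers_rational_tropical[OF fin Nk mem(1-3) tie[OF mem(4)]])
    then show ?case by (rule subsetD[OF closure_subset])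
  qed
  then show ?thesis using W(1) closed_closure Lim_in_closed_set
    by (metis trivial_limit_sequentially)
qed

section \<open>Homogeneous parts and initial ideals\<close>

definition weight_part :: "real ^ 'n::finite \<Rightarrow> real \<Rightarrow> 'n pow \<Rightarrow> 'n pow" where
  "weight_part u k f = (\<lambda>\<alpha>. if wdot u \<alpha> = k then f \<alpha> else 0)"

lemma wdot_add: "wdot u (\<alpha> + \<beta>) = wdot u \<alpha> + wdot u \<beta>"
  by (simp add: wdot_def algebra_simps sum.distrib)

lemma supp_pow_mult:
  assumes "\<gamma> \<in> supp (pow_mult f g)"
  obtains \<alpha> \<beta> where "\<alpha> \<in> supp f" "\<beta> \<in> supp g" "\<gamma> = \<alpha> + \<beta>"
proof -
  have "(\<Sum>(\<alpha>, \<beta>) \<in> {(\<alpha>, \<beta>). \<alpha> + \<beta> = \<gamma>}. f \<alpha> * g \<beta>) \<noteq> 0"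
    using assms by (simp add: supp_def pow_mult_def)
  then obtain p where "p \<in> {(\<alpha>, \<beta>). \<alpha> + \<beta> = \<gamma>}" "(case p of (\<alpha>, \<beta>) \<Rightarrow> f \<alpha> * g \<beta>) \<noteq> 0"
    by (meson sum.neutral)
  then show thesis using that by (auto simp: supp_def)
qed

lemma filt_ge_mult:
  assumes "f \<in> filt_ge u j" "g \<in> filt_ge u k" shows "pow_mult f g \<in> filt_ge u (j + k)"
  unfolding filt_ge_iff
proof
  fix \<gamma> assume "\<gamma> \<in> supp (pow_mult f g)"
  then obtain \<alpha> \<beta> where "\<alpha> \<in> supp f" "\<beta> \<in> supp g" "\<gamma> = \<alpha> + \<beta>" by (rule supp_pow_mult)
  with assms show "j + k \<le> wdot u \<gamma>" by (auto simp: filt_ge_iff wdot_add intro: add_mono)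
qed

text \<open>
Products of lowest parts are lowest parts of products. The statement holds for any lower bounds \<open>j\<close>
and \<open>k\<close> of the weights, attained or not, which spares all distinctions about vanishing parts later on.
\<close>

lemma part_mult:
  assumes f: "f \<in> filt_ge u j" and g: "g \<in> filt_ge u k"
  shows "weight_part u (j + k) (pow_mult f g) = pow_mult (weight_part u j f) (weight_part u k g)"
proof
  fix \<gamma>
  have "f \<alpha> * g \<beta> = weight_part u j f \<alpha> * weight_part u k g \<beta>" if "\<alpha> + \<beta> = \<gamma>" "wdot u \<gamma> = j + k" for \<alpha> \<beta>
  proof (cases "f \<alpha> = 0 \<or> g \<beta> = 0")
    case False
    then have "j \<le> wdot u \<alpha>" "k \<le> wdot u \<beta>" using f g by (auto simp: filt_ge_iff supp_def)
    moreover have "wdot u \<alpha> + wdot u \<beta> = j + k" using that wdot_add[of u \<alpha> \<beta>] by simp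
    ultimately show ?thesis by (simp add: weight_part_def)
  qed (auto simp: weight_part_def)
  moreover have "weight_part u j f \<alpha> * weight_part u k g \<beta> = 0" if "\<alpha> + \<beta> = \<gamma>" "wdot u \<gamma> \<noteq> j + k" for \<alpha> \<beta>
    using that wdot_add[of u \<alpha> \<beta>] by (auto simp: weight_part_def)
  ultimately show "weight_part u (j + k) (pow_mult f g) \<gamma> = pow_mult (weight_part u j f) (weight_part u k g) \<gamma>"
    unfolding weight_part_def[of u "j + k"] pow_mult_def
    by (cases "wdot u \<gamma> = j + k") (auto intro!: sum.cong sum.neutral sum.neutral[symmetric])
qed

lemma part_add: "weight_part u k (\<lambda>\<alpha>. f \<alpha> + g \<alpha>) = (\<lambda>\<alpha>. weight_part u k f \<alpha> + weight_part u k g \<alpha>)"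
  by (auto simp: weight_part_def)

lemma part_sum: "weight_part u k (\<lambda>\<alpha>. \<Sum>x\<in>X. f x \<alpha>) = (\<lambda>\<alpha>. \<Sum>x\<in>X. weight_part u k (f x) \<alpha>)"
  by (auto simp: weight_part_def)

lemma part_part: "weight_part u j (weight_part u k f) = (if j = k then weight_part u k f else (\<lambda>\<alpha>. 0))"
  by (auto simp: weight_part_def)

lemma part_in_filt_ge: "weight_part u k f \<in> filt_ge u k"
  by (auto simp: filt_ge_iff weight_part_def supp_def)

lemma part_in_gr_carrier: "weight_part u k f \<in> gr_carrier u"
  unfolding gr_carrier_iff by (rule finite_subset[of _ "{k}"]) (auto simp: weight_part_def supp_def)

lemma filt_ge_add: "f \<in> filt_ge u k \<Longrightarrow> g \<in> filt_ge u k \<Longrightarrow> (\<lambda>\<alpha>. f \<alpha> + g \<alpha>) \<in> filt_ge u k"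
  unfolding filt_ge_iff supp_def by force

lemma filt_ge_sum:
  "(\<And>x. x \<in> X \<Longrightarrow> f x \<in> filt_ge u k) \<Longrightarrow> (\<lambda>\<alpha>. \<Sum>x\<in>X. f x \<alpha>) \<in> filt_ge u k"
  unfolding filt_ge_iff supp_def by (metis (mono_tags, lifting) mem_Collect_eq sum.neutral)

lemma in_form_eq_part:
  assumes "u \<in> U_loc" "g \<in> filt_ge u k" "weight_part u k g \<noteq> (\<lambda>\<alpha>. 0)"
  shows "in_form u g = weight_part u k g"
proof -
  obtain \<alpha> where a: "\<alpha> \<in> supp g" "wdot u \<alpha> = k"
    using assms(3) by (auto simp: weight_part_def supp_def fun_eq_iff split: if_splits)
  have "wei u g = ereal k"
    unfolding wei_def
    by (rule antisym) (use a assms(2) in \<open>auto simp: filt_ge_iff intro!: INF_greatest INF_lower2\<close>)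
  then show ?thesis by (auto simp: in_form_def weight_part_def)
qed

text \<open>
Reasoning about initial forms is reduced to weight parts by this case distinction; the zero series,
whose weight is infinite, has to be kept apart.
\<close>

lemma in_form_cases:
  assumes "u \<in> U_loc"
  obtains "g = (\<lambda>\<alpha>. 0)" "in_form u g = (\<lambda>\<alpha>. 0)"
  | k where "g \<in> filt_ge u k" "weight_part u k g \<noteq> (\<lambda>\<alpha>. 0)" "in_form u g = weight_part u k g"
proof (cases "supp g = {}")
  case True
  then have "g = (\<lambda>\<alpha>. 0)" by (auto simp: supp_def)
  then show thesis using that(1) by (auto simp: in_form_def)
next
  case False
  obtain \<alpha> where a: "\<alpha> \<in> supp g" "\<And>\<beta>. \<beta> \<in> supp g \<Longrightarrow> wdot u \<alpha> \<le> wdot u \<beta>"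
    using wei_attained[OF assms False] by metis
  have 1: "g \<in> filt_ge u (wdot u \<alpha>)" using a(2) by (simp add: filt_ge_iff)
  have 2: "weight_part u (wdot u \<alpha>) g \<noteq> (\<lambda>\<alpha>. 0)" using a(1) by (auto simp: weight_part_def supp_def fun_eq_iff)
  show thesis using that(2)[OF 1 2] in_form_eq_part[OF assms 1 2] by blast
qed

lemma in_form_in_gr_carrier: "u \<in> U_loc \<Longrightarrow> in_form u g \<in> gr_carrier u"
  by (rule in_form_cases[of u g]) (auto simp: part_in_gr_carrier, simp add: gr_carrier_iff supp_def)

locale pow_ideal =
  fixes I :: "'n::finite pow set"
  assumes I_ideal: "ideal I pow_ring"
begin

lemma I_zero: "(\<lambda>\<alpha>. 0) \<in> I"
  using additive_subgroup.zero_closed[OF ideal.axioms(1)[OF I_ideal]] by simp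

lemma I_add: "f \<in> I \<Longrightarrow> g \<in> I \<Longrightarrow> (\<lambda>\<alpha>. f \<alpha> + g \<alpha>) \<in> I"
  using additive_subgroup.a_closed[OF ideal.axioms(1)[OF I_ideal], of f g] by simp

lemma I_mult: "f \<in> I \<Longrightarrow> pow_mult a f \<in> I"
  using ideal.I_l_closed[OF I_ideal, of f a] by simp

lemma I_sum: "(\<And>x. x \<in> X \<Longrightarrow> f x \<in> I) \<Longrightarrow> (\<lambda>\<alpha>. \<Sum>x\<in>X. f x \<alpha>) \<in> I"
  by (induction X rule: infinite_finite_induct) (auto simp: I_zero intro: I_add)

end

lemma pow_mult_monomial:
  "pow_mult (\<lambda>\<beta>. if \<beta> = \<alpha> then c else 0) f = (\<lambda>\<gamma>. if \<alpha> \<le> \<gamma> then c * f (\<gamma> - \<alpha>) else 0)"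
proof
  fix \<gamma>
  have "pow_mult (\<lambda>\<beta>. if \<beta> = \<alpha> then c else 0) f \<gamma> =
      (\<Sum>(\<delta>, \<beta>) \<in> (if \<alpha> \<le> \<gamma> then {(\<alpha>, \<gamma> - \<alpha>)} else {}). (if \<delta> = \<alpha> then c else 0) * f \<beta>)"
    unfolding pow_mult_def
  proof (rule sum.mono_neutral_right[OF finite_antidiag])
    have "\<alpha> + (\<gamma> - \<alpha>) = \<gamma>" if "\<alpha> \<le> \<gamma>"
      using that by (simp add: vec_eq_iff less_eq_vec_def)
    then show "(if \<alpha> \<le> \<gamma> then {(\<alpha>, \<gamma> - \<alpha>)} else {}) \<subseteq> {(\<alpha>, \<beta>). \<alpha> + \<beta> = \<gamma>}" by auto
    have "\<alpha> \<le> \<alpha> + \<beta>" "\<alpha> + \<beta> - \<alpha> = \<beta>" for \<beta> :: "nat ^ 'a"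
      by (simp_all add: vec_eq_iff less_eq_vec_def)
    then show "\<forall>i\<in>{(\<alpha>, \<beta>). \<alpha> + \<beta> = \<gamma>} - (if \<alpha> \<le> \<gamma> then {(\<alpha>, \<gamma> - \<alpha>)} else {}).
       (case i of (\<delta>, \<beta>) \<Rightarrow> (if \<delta> = \<alpha> then c else 0) * f \<beta>) = 0"
      by (auto split: if_splits)
  qed
  then show "pow_mult (\<lambda>\<beta>. if \<beta> = \<alpha> then c else 0) f \<gamma> = (if \<alpha> \<le> \<gamma> then c * f (\<gamma> - \<alpha>) else 0)"
    by auto
qed

context pow_ideal
begin

lemma I_scale: "f \<in> I \<Longrightarrow> (\<lambda>\<alpha>. c * f \<alpha>) \<in> I"
  using I_mult[of f "\<lambda>\<beta>. if \<beta> = 0 then c else 0"] unfolding pow_mult_monomial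
  by (simp add: less_eq_vec_def)

lemma I_diff: "f \<in> I \<Longrightarrow> g \<in> I \<Longrightarrow> (\<lambda>\<alpha>. f \<alpha> - g \<alpha>) \<in> I"
  using I_add[of f "\<lambda>\<alpha>. (-1) * g \<alpha>"] I_scale[of g "-1"] by simp

lemma in_form_in_in_ideal: "u \<in> U_loc \<Longrightarrow> g \<in> I \<Longrightarrow> in_form u g \<in> in_ideal u I"
proof -
  assume "u \<in> U_loc" "g \<in> I"
  interpret G: cring "gr_ring u" by (rule cring_gr_ring)
  have "in_form u ` I \<subseteq> carrier (gr_ring u)"
    using \<open>u \<in> U_loc\<close> in_form_in_gr_carrier by (auto simp: gr_ring_def)
  from G.genideal_self[OF this] show ?thesis using \<open>g \<in> I\<close> by (auto simp: in_ideal_def)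
qed

text \<open>
The elements of the graded ring all of whose homogeneous components are lowest parts of elements of
\<open>I\<close> form an ideal: a component of a product \<open>a p\<close> is a finite sum of products of components, and each
summand is realised by multiplying a lift with a homogeneous series. This ideal contains the
generators of \<open>in\<^sub>u(I)\<close>.
\<close>

lemma part_eq_in_form_lift:
  assumes u: "u \<in> U_loc" and p: "p \<in> in_ideal u I"
  shows "\<exists>g\<in>I. g \<in> filt_ge u k \<and> weight_part u k g = weight_part u k p"
proof -
  define S where "S = {p \<in> gr_carrier u. \<forall>k. \<exists>g\<in>I. g \<in> filt_ge u k \<and> weight_part u k g = weight_part u k p}"
  interpret G: cring "gr_ring u" by (rule cring_gr_ring)
  have Gs: "carrier (gr_ring u) = gr_carrier u" "mult (gr_ring u) = pow_mult"
    "add (gr_ring u) f g = (\<lambda>\<alpha>. f \<alpha> + g \<alpha>)" "zero (gr_ring u) = (\<lambda>\<alpha>. 0)" for f g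
    by (simp_all add: gr_ring_def pow_ring_def)
  have Gadd: "(\<lambda>\<alpha>. f \<alpha> + g \<alpha>) \<in> gr_carrier u" if "f \<in> gr_carrier u" "g \<in> gr_carrier u" for f g
    using G.a_closed[of f g] that by (simp add: Gs)
  have Gmult: "pow_mult f g \<in> gr_carrier u" if "f \<in> gr_carrier u" "g \<in> gr_carrier u" for f g
    using G.m_closed[of f g] that by (simp add: Gs)
  have Sadd: "(\<lambda>\<alpha>. f \<alpha> + g \<alpha>) \<in> S" if f: "f \<in> S" and g: "g \<in> S" for f g
  proof -
    have "\<exists>h\<in>I. h \<in> filt_ge u k \<and> weight_part u k h = weight_part u k (\<lambda>\<alpha>. f \<alpha> + g \<alpha>)" for k
    proof -
      obtain a b where "a \<in> I" "a \<in> filt_ge u k" "weight_part u k a = weight_part u k f"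
        "b \<in> I" "b \<in> filt_ge u k" "weight_part u k b = weight_part u k g"
        using f g unfolding S_def by blast
      then show ?thesis by (intro bexI[of _ "\<lambda>\<alpha>. a \<alpha> + b \<alpha>"]) (auto simp: part_add filt_ge_add I_add)
    qed
    then show ?thesis using that Gadd by (simp add: S_def)
  qed
  have Smult: "pow_mult a f \<in> S" if a: "a \<in> gr_carrier u" and f: "f \<in> S" for a f
  proof -
    have "\<exists>h\<in>I. h \<in> filt_ge u k \<and> weight_part u k h = weight_part u k (pow_mult a f)" for k
    proof -
      define W where "W = wdot u ` supp f"
      have W: "finite W" using f by (auto simp: S_def gr_carrier_iff W_def)
      have "\<forall>j. \<exists>g. g \<in> I \<and> g \<in> filt_ge u j \<and> weight_part u j g = weight_part u j f" using f by (auto simp: S_def)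
      then obtain g where g: "\<And>j. g j \<in> I" "\<And>j. g j \<in> filt_ge u j" "\<And>j. weight_part u j (g j) = weight_part u j f"
        by metis
      define h where "h = (\<lambda>\<alpha>. \<Sum>j\<in>W. pow_mult (weight_part u (k - j) a) (g j) \<alpha>)"
      have m: "pow_mult (weight_part u (k - j) a) (g j) \<in> filt_ge u k"
        "weight_part u k (pow_mult (weight_part u (k - j) a) (g j)) = pow_mult (weight_part u (k - j) a) (weight_part u j f)" for j
        using filt_ge_mult[OF part_in_filt_ge[of u "k - j" a] g(2)[of j]]
          part_mult[OF part_in_filt_ge[of u "k - j" a] g(2)[of j]]
        by (simp_all add: g(3) part_part)
      have "weight_part u k (pow_mult a f) = (\<lambda>\<alpha>. \<Sum>j\<in>W. pow_mult (weight_part u (k - j) a) (weight_part u j f) \<alpha>)"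
      proof
        fix \<gamma>
        have "weight_part u k (pow_mult a f) \<gamma> = (\<Sum>(\<alpha>, \<beta>)\<in>{(\<alpha>, \<beta>). \<alpha> + \<beta> = \<gamma>}. if wdot u \<gamma> = k then a \<alpha> * f \<beta> else 0)"
          by (simp add: weight_part_def pow_mult_def)
        also have "\<dots> = (\<Sum>(\<alpha>, \<beta>)\<in>{(\<alpha>, \<beta>). \<alpha> + \<beta> = \<gamma>}. \<Sum>j\<in>W. weight_part u (k - j) a \<alpha> * weight_part u j f \<beta>)"
        proof (rule sum.cong[OF refl], clarify)
          fix \<alpha> \<beta> assume g: "\<gamma> = \<alpha> + \<beta>"
          have "(\<Sum>j\<in>W. weight_part u (k - j) a \<alpha> * weight_part u j f \<beta>) =
              (\<Sum>j\<in>W. if j = wdot u \<beta> then weight_part u (k - wdot u \<beta>) a \<alpha> * f \<beta> else 0)"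
            by (intro sum.cong) (auto simp: weight_part_def)
          also have "\<dots> = weight_part u (k - wdot u \<beta>) a \<alpha> * f \<beta>"
            using W by (auto simp: W_def supp_def)
          finally show "(if wdot u (\<alpha> + \<beta>) = k then a \<alpha> * f \<beta> else 0) = (\<Sum>j\<in>W. weight_part u (k - j) a \<alpha> * weight_part u j f \<beta>)"
            by (auto simp: weight_part_def wdot_add)
        qed
        also have "\<dots> = (\<Sum>j\<in>W. pow_mult (weight_part u (k - j) a) (weight_part u j f) \<gamma>)"
          unfolding pow_mult_def case_prod_unfold by (rule sum.swap)
        finally show "weight_part u k (pow_mult a f) \<gamma> = (\<Sum>j\<in>W. pow_mult (weight_part u (k - j) a) (weight_part u j f) \<gamma>)" .
      qed
      then have "weight_part u k h = weight_part u k (pow_mult a f)"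
        unfolding h_def part_sum by (simp add: m)
      moreover have "h \<in> I" "h \<in> filt_ge u k"
        unfolding h_def by (auto intro!: I_sum I_mult filt_ge_sum m g)
      ultimately show ?thesis by blast
    qed
    then show ?thesis using that Gmult by (simp add: S_def)
  qed
  have "Ideal.ideal S (gr_ring u)"
  proof (rule idealI)
    show "subgroup S (add_monoid (gr_ring u))"
    proof (rule subgroup.intro)
      show "S \<subseteq> carrier (add_monoid (gr_ring u))" by (auto simp: S_def Gs)
      show "x \<otimes>\<^bsub>add_monoid (gr_ring u)\<^esub> y \<in> S" if "x \<in> S" "y \<in> S" for x y
        using Sadd that by (simp add: Gs)
      show "\<one>\<^bsub>add_monoid (gr_ring u)\<^esub> \<in> S"
        using I_zero by (auto simp: Gs S_def gr_carrier_iff supp_def filt_ge_iff)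
      fix x assume x: "x \<in> S"
      then have xc: "x \<in> carrier (gr_ring u)" by (simp add: S_def Gs)
      have "\<ominus>\<^bsub>gr_ring u\<^esub> x = (\<ominus>\<^bsub>gr_ring u\<^esub> \<one>\<^bsub>gr_ring u\<^esub>) \<otimes>\<^bsub>gr_ring u\<^esub> x"
        using xc by (simp add: G.l_minus)
      moreover have "\<ominus>\<^bsub>gr_ring u\<^esub> \<one>\<^bsub>gr_ring u\<^esub> \<in> gr_carrier u" 
        using G.a_inv_closed[OF G.one_closed] by (simp add: Gs)
      ultimately show "inv\<^bsub>add_monoid (gr_ring u)\<^esub> x \<in> S"
        using Smult[OF _ x] by (simp add: a_inv_def Gs)
    qed
    show "x \<otimes>\<^bsub>gr_ring u\<^esub> a \<in> S" "a \<otimes>\<^bsub>gr_ring u\<^esub> x \<in> S" if "a \<in> S" "x \<in> carrier (gr_ring u)" for a x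
      using Smult[of x a] that by (auto simp: Gs pow_mult_comm)
  qed (rule G.ring_axioms)
  moreover have "in_form u ` I \<subseteq> S"
  proof clarify
    fix f assume f: "f \<in> I"
    have "\<exists>g\<in>I. g \<in> filt_ge u k \<and> weight_part u k g = weight_part u k (in_form u f)" for k
    proof (rule in_form_cases[OF u, of f])
      assume "in_form u f = (\<lambda>\<alpha>. 0)"
      then show ?thesis using I_zero by (auto intro!: bexI[of _ "\<lambda>\<alpha>. 0"] simp: filt_ge_iff supp_def)
    next
      fix j assume j: "f \<in> filt_ge u j" "in_form u f = weight_part u j f"
      show ?thesis
      proof (cases "j = k")
        case True
        then show ?thesis using f j by (auto simp: part_part)
      next
        case False
        then show ?thesis using I_zero j
          by (auto intro!: bexI[of _ "\<lambda>\<alpha>. 0"] simp: filt_ge_iff supp_def part_part weight_part_def)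
      qed
    qed
    then show "in_form u f \<in> S" using in_form_in_gr_carrier[OF u] by (simp add: S_def)
  qed
  ultimately have "in_ideal u I \<subseteq> S"
    unfolding in_ideal_def by (rule G.genideal_minimal)
  then show ?thesis using p by (auto simp: S_def)
qed

lemma monomial_in_in_ideal_iff:
  assumes u: "u \<in> U_loc"
  shows "(\<exists>m\<in>in_ideal u I. is_monomial m) \<longleftrightarrow>
    (\<exists>g\<in>I. \<exists>\<alpha>\<in>supp g. \<forall>\<beta>\<in>supp g. \<beta> \<noteq> \<alpha> \<longrightarrow> wdot u \<alpha> < wdot u \<beta>)"
proof
  assume "\<exists>m\<in>in_ideal u I. is_monomial m"
  then obtain c \<alpha> where c: "c \<noteq> 0" "(\<lambda>\<beta>. if \<beta> = \<alpha> then c else 0) \<in> in_ideal u I"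
    by (auto simp: is_monomial_def)
  obtain g where g: "g \<in> I" "g \<in> filt_ge u (wdot u \<alpha>)"
    "weight_part u (wdot u \<alpha>) g = weight_part u (wdot u \<alpha>) (\<lambda>\<beta>. if \<beta> = \<alpha> then c else 0)"
    using part_eq_in_form_lift[OF u c(2)] by blast
  have e: "g \<beta> = (if \<beta> = \<alpha> then c else 0)" if "wdot u \<beta> = wdot u \<alpha>" for \<beta>
    using fun_cong[OF g(3), of \<beta>] that by (simp add: weight_part_def)
  show "\<exists>g\<in>I. \<exists>\<alpha>\<in>supp g. \<forall>\<beta>\<in>supp g. \<beta> \<noteq> \<alpha> \<longrightarrow> wdot u \<alpha> < wdot u \<beta>"
    using g(1,2) e c(1) by (intro bexI[of _ g] bexI[of _ \<alpha>]) (force simp: filt_ge_iff supp_def less_le)+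
next
  assume "\<exists>g\<in>I. \<exists>\<alpha>\<in>supp g. \<forall>\<beta>\<in>supp g. \<beta> \<noteq> \<alpha> \<longrightarrow> wdot u \<alpha> < wdot u \<beta>"
  then obtain g \<alpha> where g: "g \<in> I" "\<alpha> \<in> supp g" "\<And>\<beta>. \<beta> \<in> supp g \<Longrightarrow> \<beta> \<noteq> \<alpha> \<Longrightarrow> wdot u \<alpha> < wdot u \<beta>"
    by blast
  have 1: "g \<in> filt_ge u (wdot u \<alpha>)" using g(3) by (force simp: filt_ge_iff)
  have 2: "weight_part u (wdot u \<alpha>) g = (\<lambda>\<beta>. if \<beta> = \<alpha> then g \<alpha> else 0)"
    using g(3) by (force simp: weight_part_def supp_def fun_eq_iff)
  have ga: "g \<alpha> \<noteq> 0" using g(2) by (simp add: supp_def)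
  then have "weight_part u (wdot u \<alpha>) g \<noteq> (\<lambda>\<alpha>. 0)" unfolding 2 by (auto simp: fun_eq_iff)
  then have "in_form u g = (\<lambda>\<beta>. if \<beta> = \<alpha> then g \<alpha> else 0)"
    using in_form_eq_part[OF u 1] 2 by simp
  then have "is_monomial (in_form u g)" using ga unfolding is_monomial_def by blast
  then show "\<exists>m\<in>in_ideal u I. is_monomial m" using in_form_in_in_ideal[OF u g(1)] by blast
qed

end

section \<open>Division of power series\<close>

lemma U_loc_if_pos: "(\<And>i. 0 < v $ i) \<Longrightarrow> v \<in> U_loc"
  by (simp add: U_loc_def less_imp_le)

lemma wdot_mono: "u \<in> U_loc \<Longrightarrow> \<alpha> \<le> \<beta> \<Longrightarrow> wdot u \<alpha> \<le> wdot u \<beta>"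
  unfolding wdot_def by (intro sum_mono mult_left_mono) (auto simp: U_loc_def less_eq_vec_def)

lemma finite_exponents_below:
  fixes v :: "real ^ 'n::finite"
  assumes v: "\<And>i. 0 < v $ i" shows "finite {\<alpha>. wdot v \<alpha> \<le> c}"
proof -
  define b where "b = (\<chi> i. nat \<lceil>c / v $ i\<rceil>)"
  have "{\<alpha>. wdot v \<alpha> \<le> c} \<subseteq> {\<alpha>. \<alpha> \<le> b}"
  proof
    fix \<alpha> assume "\<alpha> \<in> {\<alpha>. wdot v \<alpha> \<le> c}"
    then have c: "wdot v \<alpha> \<le> c" by simp
    have "\<alpha> $ i \<le> b $ i" for i
    proof -
      have "v $ i * real (\<alpha> $ i) \<le> wdot v \<alpha>"
        unfolding wdot_def using v by (intro member_le_sum) (auto simp: less_imp_le)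
      then have "real (\<alpha> $ i) \<le> c / v $ i" using c v[of i] by (simp add: field_simps)
      then show ?thesis unfolding b_def by simp linarith
    qed
    then show "\<alpha> \<in> {\<alpha>. \<alpha> \<le> b}" by (simp add: less_eq_vec_def)
  qed
  then show ?thesis using finite_vec_le finite_subset by blast
qed

text \<open>
For a positive weight there are only finitely many exponents below any given one, so recursion and
induction along the weight are possible.
\<close>

lemma wf_weight:
  fixes v :: "real ^ 'n::finite"
  assumes v: "\<And>i. 0 < v $ i" shows "wf {(\<alpha>, \<beta>). wdot v \<alpha> < wdot v \<beta>}"
proof (rule wf_subset[OF wf_measure])
  show "{(\<alpha>, \<beta>). wdot v \<alpha> < wdot v \<beta>} \<subseteq> Wellfounded.measure (\<lambda>\<beta>. card {\<alpha>. wdot v \<alpha> < wdot v \<beta>})"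
  proof clarify
    fix \<alpha> \<beta> assume "wdot v \<alpha> < wdot v \<beta>"
    moreover have "finite {\<alpha>. wdot v \<alpha> < wdot v \<beta>}"
      by (rule finite_subset[OF _ finite_exponents_below[OF v, of "wdot v \<beta>"]]) auto
    ultimately have "card {\<alpha>'. wdot v \<alpha>' < wdot v \<alpha>} < card {\<alpha>. wdot v \<alpha> < wdot v \<beta>}"
      by (intro psubset_card_mono) auto
    then show "(\<alpha>, \<beta>) \<in> Wellfounded.measure (\<lambda>\<beta>. card {\<alpha>. wdot v \<alpha> < wdot v \<beta>})" by simp
  qed
qed

lemma exponent_diff:
  fixes \<alpha> \<beta> \<gamma> :: "nat ^ 'n::finite"
  shows "\<alpha> \<le> \<gamma> \<Longrightarrow> \<alpha> + (\<gamma> - \<alpha>) = \<gamma>" "\<alpha> + \<beta> - \<alpha> = \<beta>" "\<alpha> \<le> \<alpha> + \<beta>"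
  by (simp_all add: vec_eq_iff less_eq_vec_def)

lemma pow_mult_eq_sum_le: "pow_mult f g \<gamma> = (\<Sum>\<delta>\<in>{\<delta>. \<delta> \<le> \<gamma>}. f \<delta> * g (\<gamma> - \<delta>))"
  unfolding pow_mult_def
  by (rule sum.reindex_bij_witness[where i = "\<lambda>\<delta>. (\<delta>, \<gamma> - \<delta>)" and j = fst])
     (auto simp: exponent_diff)

definition lead_at :: "real ^ 'n::finite \<Rightarrow> 'n pow \<Rightarrow> nat ^ 'n \<Rightarrow> bool" where
  "lead_at v f \<alpha> \<longleftrightarrow> \<alpha> \<in> supp f \<and> (\<forall>\<beta>\<in>supp f. \<beta> \<noteq> \<alpha> \<longrightarrow> wdot v \<alpha> < wdot v \<beta>)"

text \<open>
With \<open>E\<close> the exponents divisible by a leading one, choose for each \<open>\<gamma> \<in> E\<close> a divisor \<open>sel \<gamma>\<close>. Subtracting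
\<open>h \<gamma>\<close> times the corresponding multiple of an element of \<open>F\<close> cancels the term at \<open>\<gamma>\<close> and creates terms of
larger weight only. So the coefficients \<open>h \<gamma>\<close> of the terms to be cancelled, or to be left over when
\<open>\<gamma> \<notin> E\<close>, are determined by recursion along the weight, which replaces a limit process.

The last property records where the terms of quotients and remainder may lie. It holds for every set
\<open>S\<close> of exponents that the individual reduction steps do not leave. Used with half spaces of other
weights, it makes one and the same division compatible with several weights at once.
\<close>

theorem division:
  fixes F :: "('n::finite pow \<times> (nat ^ 'n)) set"
  assumes fin: "finite F" and v: "\<And>i. 0 < v $ i"
    and lead: "\<And>f \<alpha>. (f, \<alpha>) \<in> F \<Longrightarrow> lead_at v f \<alpha>"
  obtains q r where "g = (\<lambda>\<gamma>. (\<Sum>p\<in>F. pow_mult (q p) (fst p) \<gamma>) + r \<gamma>)"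
    "\<And>\<gamma> p. \<gamma> \<in> supp r \<Longrightarrow> p \<in> F \<Longrightarrow> \<not> snd p \<le> \<gamma>"
    "\<And>S. supp g \<subseteq> S \<Longrightarrow> (\<And>f \<alpha> \<beta> \<delta>. (f, \<alpha>) \<in> F \<Longrightarrow> \<beta> \<in> supp f \<Longrightarrow> \<delta> + \<alpha> \<in> S \<Longrightarrow> \<delta> + \<beta> \<in> S) \<Longrightarrow>
       supp r \<subseteq> S \<and> (\<forall>p\<in>F. \<forall>\<delta>\<in>supp (q p). \<delta> + snd p \<in> S)"
proof -
  define E where "E = {\<gamma>. \<exists>p\<in>F. snd p \<le> \<gamma>}"
  have "\<forall>\<gamma>\<in>E. \<exists>p. p \<in> F \<and> snd p \<le> \<gamma>" unfolding E_def by blast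
  then obtain sel where sel: "\<And>\<gamma>. \<gamma> \<in> E \<Longrightarrow> sel \<gamma> \<in> F \<and> snd (sel \<gamma>) \<le> \<gamma>" by metis
  define R where "R = {(\<alpha>, \<beta>). wdot v \<alpha> < wdot v \<beta>}"
  have wf: "wf R" unfolding R_def by (rule wf_weight[OF v])
  define quot where "quot h p \<delta> = (if sel (\<delta> + snd p) = p then h (\<delta> + snd p) / fst p (snd p) else 0)"
    for h p \<delta>
  \<comment> \<open>the guard makes the recursion well-founded and discards exactly the leading terms\<close>
  define H where "H h \<gamma> = g \<gamma> - (\<Sum>p\<in>F. \<Sum>\<delta>\<in>{\<delta>. \<delta> \<le> \<gamma>}.
      if wdot v (\<delta> + snd p) < wdot v \<gamma> then quot h p \<delta> * fst p (\<gamma> - \<delta>) else 0)" for h \<gamma>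
  define h where "h = wfrec R H"
  have h: "h \<gamma> = H h \<gamma>" for \<gamma>
  proof -
    have "h \<gamma> = H (cut h R \<gamma>) \<gamma>" unfolding h_def by (rule wfrec[OF wf])
    also have "\<dots> = H h \<gamma>"
      unfolding H_def by (intro arg_cong2[where f = "(-)"] sum.cong refl) (auto simp: quot_def cut_def R_def)
    finally show ?thesis .
  qed
  define q where "q = quot h"
  define r where "r \<gamma> = (if \<gamma> \<in> E then 0 else h \<gamma>)" for \<gamma>
  have leadcoef: "fst p (snd p) \<noteq> 0" if "p \<in> F" for p
    using lead[of "fst p" "snd p"] that by (simp add: lead_at_def supp_def)
  have lower: "wdot v (\<delta> + snd p) < wdot v \<gamma>"
    if "p \<in> F" "\<delta> \<le> \<gamma>" "fst p (\<gamma> - \<delta>) \<noteq> 0" "\<gamma> \<noteq> \<delta> + snd p" for p \<gamma> \<delta>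
  proof -
    have g: "\<gamma> = \<delta> + (\<gamma> - \<delta>)" using that(2) by (simp add: vec_eq_iff less_eq_vec_def)
    then have "\<gamma> - \<delta> \<noteq> snd p" using that(4) by metis
    then have "wdot v (snd p) < wdot v (\<gamma> - \<delta>)"
      using lead[of "fst p" "snd p"] that(1,3) by (simp add: lead_at_def supp_def)
    then show ?thesis by (subst g) (simp add: wdot_add)
  qed
  have prod: "pow_mult (q p) (fst p) \<gamma> = (if \<gamma> \<in> E \<and> sel \<gamma> = p then h \<gamma> else 0) +
      (\<Sum>\<delta>\<in>{\<delta>. \<delta> \<le> \<gamma>}. if wdot v (\<delta> + snd p) < wdot v \<gamma> then quot h p \<delta> * fst p (\<gamma> - \<delta>) else 0)"
    if p: "p \<in> F" for p \<gamma>
  proof -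
    have "pow_mult (q p) (fst p) \<gamma> = (\<Sum>\<delta>\<in>{\<delta>. \<delta> \<le> \<gamma>}. (if \<delta> + snd p = \<gamma> then q p \<delta> * fst p (\<gamma> - \<delta>) else 0) +
        (if wdot v (\<delta> + snd p) < wdot v \<gamma> then quot h p \<delta> * fst p (\<gamma> - \<delta>) else 0))"
      unfolding pow_mult_eq_sum_le using lower[OF p]
      by (intro sum.cong refl) (auto simp: q_def)
    also have "\<dots> = (\<Sum>\<delta>\<in>{\<delta>. \<delta> \<le> \<gamma>}. (if \<delta> + snd p = \<gamma> then q p \<delta> * fst p (\<gamma> - \<delta>) else 0)) +
        (\<Sum>\<delta>\<in>{\<delta>. \<delta> \<le> \<gamma>}. if wdot v (\<delta> + snd p) < wdot v \<gamma> then quot h p \<delta> * fst p (\<gamma> - \<delta>) else 0)"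
      by (rule sum.distrib)
    also have "(\<Sum>\<delta>\<in>{\<delta>. \<delta> \<le> \<gamma>}. (if \<delta> + snd p = \<gamma> then q p \<delta> * fst p (\<gamma> - \<delta>) else 0)) =
        (if \<gamma> \<in> E \<and> sel \<gamma> = p then h \<gamma> else 0)"
    proof (cases "snd p \<le> \<gamma>")
      case True
      then have e: "\<delta> + snd p = \<gamma> \<longleftrightarrow> \<delta> = \<gamma> - snd p" for \<delta>
        using exponent_diff(1)[OF True] exponent_diff(2)[of "snd p" \<delta>] by (metis add.commute)
      have g: "\<gamma> - (\<gamma> - snd p) = snd p" "\<gamma> - snd p + snd p = \<gamma>" "\<gamma> - snd p \<le> \<gamma>"
        using True by (auto simp: vec_eq_iff less_eq_vec_def)
      have "\<gamma> \<in> E" using True p by (auto simp: E_def)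
      then show ?thesis unfolding e using g leadcoef[OF p]
        by (simp add: finite_vec_le q_def quot_def)
    next
      case False
      then have "\<delta> + snd p \<noteq> \<gamma>" for \<delta> by (auto simp: less_eq_vec_def)
      then show ?thesis using False sel[of \<gamma>] by auto
    qed
    finally show ?thesis .
  qed
  show thesis
  proof (rule that)
    show "g = (\<lambda>\<gamma>. (\<Sum>p\<in>F. pow_mult (q p) (fst p) \<gamma>) + r \<gamma>)"
    proof
      fix \<gamma>
      have e: "(\<Sum>p\<in>F. \<Sum>\<delta>\<in>{\<delta>. \<delta> \<le> \<gamma>}. if wdot v (\<delta> + snd p) < wdot v \<gamma>
          then quot h p \<delta> * fst p (\<gamma> - \<delta>) else 0) = g \<gamma> - h \<gamma>"
        using h[of \<gamma>] by (simp add: H_def)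
      have "(\<Sum>p\<in>F. pow_mult (q p) (fst p) \<gamma>) = (\<Sum>p\<in>F. if \<gamma> \<in> E \<and> sel \<gamma> = p then h \<gamma> else 0) + (g \<gamma> - h \<gamma>)"
        by (simp add: prod sum.distrib e)
      also have "(\<Sum>p\<in>F. if \<gamma> \<in> E \<and> sel \<gamma> = p then h \<gamma> else 0) = (if \<gamma> \<in> E then h \<gamma> else 0)"
        using sel[of \<gamma>] fin by auto
      finally show "g \<gamma> = (\<Sum>p\<in>F. pow_mult (q p) (fst p) \<gamma>) + r \<gamma>" by (simp add: r_def)
    qed
    show "\<not> snd p \<le> \<gamma>" if "\<gamma> \<in> supp r" "p \<in> F" for \<gamma> p
      using that by (auto simp: supp_def r_def E_def split: if_splits)
    fix S assume S: "supp g \<subseteq> S"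
      "\<And>f \<alpha> \<beta> \<delta>. (f, \<alpha>) \<in> F \<Longrightarrow> \<beta> \<in> supp f \<Longrightarrow> \<delta> + \<alpha> \<in> S \<Longrightarrow> \<delta> + \<beta> \<in> S"
    have hS: "h \<gamma> \<noteq> 0 \<Longrightarrow> \<gamma> \<in> S" for \<gamma>
    proof (induction \<gamma> rule: wf_induct_rule[OF wf])
      case (1 \<gamma>)
      show ?case
      proof (cases "g \<gamma> = 0")
        case True
        then have "(\<Sum>p\<in>F. \<Sum>\<delta>\<in>{\<delta>. \<delta> \<le> \<gamma>}.
          if wdot v (\<delta> + snd p) < wdot v \<gamma> then quot h p \<delta> * fst p (\<gamma> - \<delta>) else 0) \<noteq> 0"
          using 1(2) unfolding h[of \<gamma>] H_def by auto
        then obtain p \<delta> where p: "p \<in> F" "\<delta> \<le> \<gamma>" "wdot v (\<delta> + snd p) < wdot v \<gamma>"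
          "quot h p \<delta> \<noteq> 0" "fst p (\<gamma> - \<delta>) \<noteq> 0"
          by (auto elim!: sum.not_neutral_contains_not_neutral split: if_splits)
        then have "h (\<delta> + snd p) \<noteq> 0" by (auto simp: quot_def split: if_splits)
        then have "\<delta> + snd p \<in> S" using 1(1) p(3) by (auto simp: R_def)
        then have "\<delta> + (\<gamma> - \<delta>) \<in> S" using S(2)[of "fst p" "snd p" "\<gamma> - \<delta>" \<delta>] p by (simp add: supp_def)
        moreover have "\<delta> + (\<gamma> - \<delta>) = \<gamma>" using p(2) by (simp add: vec_eq_iff less_eq_vec_def)
        ultimately show ?thesis by simp
      qed (use S(1) in \<open>auto simp: supp_def\<close>)
    qed
    then show "supp r \<subseteq> S \<and> (\<forall>p\<in>F. \<forall>\<delta>\<in>supp (q p). \<delta> + snd p \<in> S)"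
      by (auto simp: supp_def r_def q_def quot_def split: if_splits)
  qed
qed

text \<open>
If the non-leading terms of the divisors never contribute to the coefficient of \<open>g\<close> at \<open>\<gamma>\<close>, then this
coefficient comes from a leading term.
\<close>

lemma division_cancellation_free:
  assumes g: "g = (\<lambda>\<gamma>. (\<Sum>p\<in>F. pow_mult (q p) (fst p) \<gamma>) + r \<gamma>)"
    and S: "\<forall>p\<in>F. \<forall>\<delta>\<in>supp (q p). \<delta> + snd p \<in> S"
    and above: "\<And>f \<alpha> \<beta> \<delta>. (f, \<alpha>) \<in> F \<Longrightarrow> \<beta> \<in> supp f \<Longrightarrow> \<beta> \<noteq> \<alpha> \<Longrightarrow> \<delta> + \<alpha> \<in> S \<Longrightarrow> \<delta> + \<beta> \<noteq> \<gamma>"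
    and \<gamma>: "\<gamma> \<in> supp g" "\<gamma> \<notin> supp r"
  shows "\<exists>p\<in>F. snd p \<le> \<gamma>"
proof -
  have "(\<Sum>p\<in>F. pow_mult (q p) (fst p) \<gamma>) \<noteq> 0" using \<gamma> unfolding g by (simp add: supp_def)
  then obtain p where p: "p \<in> F" "\<gamma> \<in> supp (pow_mult (q p) (fst p))"
    by (auto simp: supp_def elim: sum.not_neutral_contains_not_neutral)
  obtain \<delta> \<beta> where d: "\<delta> \<in> supp (q p)" "\<beta> \<in> supp (fst p)" "\<gamma> = \<delta> + \<beta>"
    by (rule supp_pow_mult[OF p(2)])
  have "\<beta> = snd p" using above[of "fst p" "snd p" \<beta> \<delta>] d p S by auto
  then show ?thesis using p d by (intro bexI[of _ p]) (auto simp: less_eq_vec_def)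
qed

section \<open>Finiteness of the leading exponent sets\<close>

text \<open>
Such weights replace monomial orders: they compare any two distinct exponents, and only finitely many
exponents lie below a given one.
\<close>

definition generic :: "real ^ 'n::finite \<Rightarrow> bool" where
  "generic v \<longleftrightarrow> (\<forall>i. 0 < v $ i) \<and> inj (wdot v)"

definition lead_exps :: "real ^ 'n::finite \<Rightarrow> 'n pow set \<Rightarrow> (nat ^ 'n) set" where
  "lead_exps v I = {\<gamma>. \<exists>f\<in>I. lead_at v f \<gamma>}"

definition min_exps :: "(nat ^ 'n::finite) set \<Rightarrow> (nat ^ 'n) set" where
  "min_exps E = {\<beta> \<in> E. \<forall>\<gamma>\<in>E. \<gamma> \<le> \<beta> \<longrightarrow> \<gamma> = \<beta>}"

lemma finite_min_exps: "finite (min_exps E)"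
  unfolding min_exps_def by (rule finite_minimal_elements)

lemma min_exps_below: "\<alpha> \<in> E \<Longrightarrow> \<exists>\<beta>\<in>min_exps E. \<beta> \<le> \<alpha>"
  unfolding min_exps_def using minimal_element_below[of \<alpha> E] by blast

lemma min_exps_subset: "min_exps E \<subseteq> E"
  by (auto simp: min_exps_def)

lemma lead_at_exists:
  assumes "generic v" "supp f \<noteq> {}" shows "\<exists>\<alpha>. lead_at v f \<alpha>"
proof -
  have "v \<in> U_loc" using assms(1) by (intro U_loc_if_pos) (simp add: generic_def)
  then obtain \<alpha> where a: "\<alpha> \<in> supp f" "\<And>\<beta>. \<beta> \<in> supp f \<Longrightarrow> wdot v \<alpha> \<le> wdot v \<beta>"
    using wei_attained[OF _ assms(2)] by metis
  moreover have "wdot v \<alpha> \<noteq> wdot v \<beta>" if "\<beta> \<noteq> \<alpha>" for \<beta>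
    using assms(1) that by (auto simp: generic_def inj_eq)
  ultimately show ?thesis unfolding lead_at_def by (metis less_le)
qed

text \<open>
Since the minimal exponents of a series are finite in number, so are its possible leading exponents
as the generic weight varies.
\<close>

lemma lead_at_in_min_exps:
  assumes "generic v" "lead_at v f \<alpha>" shows "\<alpha> \<in> min_exps (supp f)"
  unfolding min_exps_def
proof (intro CollectI conjI ballI impI)
  show "\<alpha> \<in> supp f" using assms(2) by (simp add: lead_at_def)
  fix \<gamma> assume g: "\<gamma> \<in> supp f" "\<gamma> \<le> \<alpha>"
  then have "wdot v \<gamma> \<le> wdot v \<alpha>"
    using assms(1) by (intro wdot_mono U_loc_if_pos) (auto simp: generic_def)
  then show "\<gamma> = \<alpha>" using assms(2) g(1) by (force simp: lead_at_def)
qed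

definition up_closed :: "(nat ^ 'n::finite) set \<Rightarrow> bool" where
  "up_closed M \<longleftrightarrow> (\<forall>\<alpha>\<in>M. \<forall>\<beta>. \<alpha> \<le> \<beta> \<longrightarrow> \<beta> \<in> M)"

text \<open>
Dickson's lemma as an ascending chain condition: choosing a new exponent at each step of a strictly
ascending chain gives a sequence without a non-decreasing pair.
\<close>

lemma wf_up_closed: "wf {(A :: (nat ^ 'n::finite) set, B). B \<subset> A \<and> up_closed A \<and> up_closed B}"
  unfolding wf_iff_no_infinite_down_chain
proof
  assume "\<exists>M :: nat \<Rightarrow> (nat ^ 'n) set. \<forall>i. (M (Suc i), M i) \<in> {(A, B). B \<subset> A \<and> up_closed A \<and> up_closed B}"
  then obtain M :: "nat \<Rightarrow> (nat ^ 'n) set" where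
    "\<forall>i. (M (Suc i), M i) \<in> {(A, B). B \<subset> A \<and> up_closed A \<and> up_closed B}" ..
  then have M: "\<And>i. M i \<subset> M (Suc i)" "\<And>i. up_closed (M i)"
    by simp_all
  have mono: "i \<le> j \<Longrightarrow> M i \<subseteq> M j" for i j by (rule lift_Suc_mono_le) (use M in auto)
  have "\<forall>i. \<exists>\<gamma>. \<gamma> \<in> M (Suc i) \<and> \<gamma> \<notin> M i" using M(1) by blast
  then obtain s where s: "\<And>i. s i \<in> M (Suc i)" "\<And>i. s i \<notin> M i" by metis
  obtain r where r: "strict_mono r" "incseq (s \<circ> r)" using vec_seq_mono_subseq by blast
  have "s (r 0) \<le> s (r 1)" using r(2) by (simp add: incseq_def)
  moreover have "Suc (r 0) \<le> r 1" using r(1) by (simp add: Suc_leI strict_mono_less)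
  then have "s (r 0) \<in> M (r 1)" using s(1) mono by blast
  ultimately have "s (r 1) \<in> M (r 1)" using M(2)[of "r 1"] by (auto simp: up_closed_def)
  then show False using s(2) by blast
qed

context pow_ideal
begin

lemma up_closed_lead_exps: "up_closed (lead_exps v I)"
  unfolding up_closed_def
proof (intro ballI allI impI)
  fix \<alpha> \<beta> assume "\<alpha> \<in> lead_exps v I" and le: "\<alpha> \<le> \<beta>"
  then obtain f where f: "f \<in> I" "lead_at v f \<alpha>" by (auto simp: lead_exps_def)
  define g where "g = pow_mult (\<lambda>\<gamma>. if \<gamma> = \<beta> - \<alpha> then 1 else 0) f"
  have g: "g = (\<lambda>\<gamma>. if \<beta> - \<alpha> \<le> \<gamma> then 1 * f (\<gamma> - (\<beta> - \<alpha>)) else 0)"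
    unfolding g_def by (rule pow_mult_monomial)
  have ab: "\<beta> - \<alpha> + \<alpha> = \<beta>" "\<beta> - \<alpha> \<le> \<beta>" "\<beta> - (\<beta> - \<alpha>) = \<alpha>"
    using le by (auto simp: vec_eq_iff less_eq_vec_def)
  have "lead_at v g \<beta>" unfolding lead_at_def
  proof (intro conjI ballI impI)
    show "\<beta> \<in> supp g" using f(2) ab by (simp add: supp_def g lead_at_def)
    fix \<gamma> assume gam: "\<gamma> \<in> supp g" "\<gamma> \<noteq> \<beta>"
    then have 1: "\<beta> - \<alpha> \<le> \<gamma>" "\<gamma> - (\<beta> - \<alpha>) \<in> supp f" by (auto simp: supp_def g split: if_splits)
    have e: "\<gamma> = (\<beta> - \<alpha>) + (\<gamma> - (\<beta> - \<alpha>))" using exponent_diff(1)[OF 1(1)] by simp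
    have "\<gamma> - (\<beta> - \<alpha>) \<noteq> \<alpha>" using e ab(1) gam(2) by metis
    then have "wdot v \<alpha> < wdot v (\<gamma> - (\<beta> - \<alpha>))" using f(2) 1(2) by (auto simp: lead_at_def)
    then have "wdot v (\<beta> - \<alpha> + \<alpha>) < wdot v ((\<beta> - \<alpha>) + (\<gamma> - (\<beta> - \<alpha>)))"
      by (simp add: wdot_add)
    then show "wdot v \<beta> < wdot v \<gamma>" using ab(1) e by simp
  qed
  moreover have "g \<in> I" unfolding g_def using f(1) by (rule I_mult)
  ultimately show "\<beta> \<in> lead_exps v I" by (auto simp: lead_exps_def)
qed

lemma supp_meets_lead_exps:
  assumes "generic v" "f \<in> I" "supp f \<inter> lead_exps v I = {}" shows "f = (\<lambda>\<alpha>. 0)"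
proof (rule ccontr)
  assume "f \<noteq> (\<lambda>\<alpha>. 0)"
  then have "supp f \<noteq> {}" by (auto simp: supp_def)
  then obtain \<alpha> where "lead_at v f \<alpha>" using lead_at_exists[OF assms(1)] by blast
  then show False using assms(2,3) by (auto simp: lead_exps_def lead_at_def)
qed

lemma remainder_in_ideal:
  assumes "g \<in> I" "g = (\<lambda>\<gamma>. (\<Sum>p\<in>F. pow_mult (q p) (fst p) \<gamma>) + r \<gamma>)" "fst ` F \<subseteq> I"
  shows "r \<in> I"
proof -
  have "(\<lambda>\<gamma>. g \<gamma> - (\<Sum>p\<in>F. pow_mult (q p) (fst p) \<gamma>)) \<in> I"
    using assms(1,3) by (intro I_diff I_sum I_mult) auto
  then show ?thesis by (simp add: assms(2))
qed

text \<open>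
Noetherian induction on the exponent ideal generated by the exponents in a finite set \<open>F\<close> of pairs
\<open>(f, \<alpha>)\<close> with \<open>f \<in> I\<close>, for the generic weights that have all these \<open>\<alpha>\<close> as leading exponents. If \<open>F\<close>
does not yet generate all leading exponents for one such weight, dividing by \<open>F\<close> gives a nonzero
\<open>r \<in> I\<close> with no exponent in the ideal. Every weight selects one of the finitely many minimal
exponents of \<open>r\<close> as leading exponent, and adding \<open>r\<close> with it to \<open>F\<close> enlarges the ideal.
\<close>

theorem finite_lead_exps: "finite {lead_exps v I | v. generic v}"
proof -
  let ?up = "\<lambda>F :: ('n pow \<times> (nat ^ 'n)) set. {\<gamma>. \<exists>p\<in>F. snd p \<le> \<gamma>}"
  let ?G = "\<lambda>F. {v. generic v \<and> (\<forall>p\<in>F. lead_at v (fst p) (snd p))}"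
  have upc: "up_closed (?up F)" for F by (auto simp: up_closed_def intro: order_trans)
  have "finite ((\<lambda>v. lead_exps v I) ` ?G F)" if "finite F" "fst ` F \<subseteq> I" for F
    using that
  proof (induction F rule: wf_induct_rule[OF wf_inv_image[OF wf_up_closed, of ?up]])
    case (1 F)
    have sub: "?up F \<subseteq> lead_exps v I" if v: "v \<in> ?G F" for v
    proof clarify
      fix \<gamma> f \<alpha> assume "(f, \<alpha>) \<in> F" "snd (f, \<alpha>) \<le> \<gamma>"
      moreover from this v 1(3) have "\<alpha> \<in> lead_exps v I" unfolding lead_exps_def by force
      ultimately show "\<gamma> \<in> lead_exps v I" using up_closed_lead_exps[of v] by (auto simp: up_closed_def)
    qed
    show ?case
    proof (cases "\<forall>v\<in>?G F. lead_exps v I = ?up F")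
      case True
      then have "(\<lambda>v. lead_exps v I) ` ?G F \<subseteq> {?up F}" by blast
      then show ?thesis by (rule finite_subset) simp
    next
      case False
      then obtain v0 where v0: "v0 \<in> ?G F" "lead_exps v0 I \<noteq> ?up F" by blast
      then obtain \<gamma> where \<gamma>: "\<gamma> \<in> lead_exps v0 I" "\<gamma> \<notin> ?up F" using sub[OF v0(1)] by blast
      then obtain g where g: "g \<in> I" "lead_at v0 g \<gamma>" by (auto simp: lead_exps_def)
      have pos: "\<And>i. 0 < v0 $ i" using v0(1) by (simp add: generic_def)
      have leads: "lead_at v0 f \<alpha>" if "(f, \<alpha>) \<in> F" for f \<alpha> using v0(1) that by auto
      obtain q r where qr: "g = (\<lambda>\<gamma>. (\<Sum>p\<in>F. pow_mult (q p) (fst p) \<gamma>) + r \<gamma>)"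
        "\<And>\<gamma> p. \<gamma> \<in> supp r \<Longrightarrow> p \<in> F \<Longrightarrow> \<not> snd p \<le> \<gamma>"
        "\<And>S. supp g \<subseteq> S \<Longrightarrow> (\<And>f \<alpha> \<beta> \<delta>. (f, \<alpha>) \<in> F \<Longrightarrow> \<beta> \<in> supp f \<Longrightarrow> \<delta> + \<alpha> \<in> S \<Longrightarrow> \<delta> + \<beta> \<in> S) \<Longrightarrow>
           supp r \<subseteq> S \<and> (\<forall>p\<in>F. \<forall>\<delta>\<in>supp (q p). \<delta> + snd p \<in> S)"
        by (rule division[OF 1(2) pos leads, of g]) (assumption | blast)+
      define S where "S = {\<gamma>'. wdot v0 \<gamma> \<le> wdot v0 \<gamma>'}"
      have gt: "wdot v0 (\<delta> + \<alpha>) < wdot v0 (\<delta> + \<beta>)" if "(f, \<alpha>) \<in> F" "\<beta> \<in> supp f" "\<beta> \<noteq> \<alpha>" for f \<alpha> \<beta> \<delta>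
        using leads[OF that(1)] that by (simp add: lead_at_def wdot_add)
      have "supp g \<subseteq> S" using g(2) by (force simp: S_def lead_at_def)
      moreover have "\<delta> + \<beta> \<in> S" if "(f, \<alpha>) \<in> F" "\<beta> \<in> supp f" "\<delta> + \<alpha> \<in> S" for f \<alpha> \<beta> \<delta>
        using gt[OF that(1,2)] that(3) by (cases "\<beta> = \<alpha>") (auto simp: S_def intro: order_trans less_imp_le)
      ultimately have q: "\<forall>p\<in>F. \<forall>\<delta>\<in>supp (q p). \<delta> + snd p \<in> S" using qr(3)[of S] by blast
      have "\<gamma> \<in> supp r"
      proof (rule ccontr)
        assume "\<gamma> \<notin> supp r"
        have "\<delta> + \<beta> \<noteq> \<gamma>" if "(f, \<alpha>) \<in> F" "\<beta> \<in> supp f" "\<beta> \<noteq> \<alpha>" "\<delta> + \<alpha> \<in> S" for f \<alpha> \<beta> \<delta>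
          using gt[OF that(1-3), of \<delta>] that(4) by (auto simp: S_def)
        then have "\<exists>p\<in>F. snd p \<le> \<gamma>"
          by (rule division_cancellation_free[OF qr(1) q])
             (use g(2) \<open>\<gamma> \<notin> supp r\<close> in \<open>auto simp: lead_at_def\<close>)
        then show False using \<gamma>(2) by blast
      qed
      then have r0: "supp r \<noteq> {}" by blast
      have rI: "r \<in> I" by (rule remainder_in_ideal[OF g(1) qr(1) 1(3)])
      have "(\<lambda>v. lead_exps v I) ` ?G F \<subseteq> (\<Union>\<beta>\<in>min_exps (supp r). (\<lambda>v. lead_exps v I) ` ?G (insert (r, \<beta>) F))"
      proof clarify
        fix v assume v: "generic v" "\<forall>p\<in>F. lead_at v (fst p) (snd p)"
        obtain \<beta> where b: "lead_at v r \<beta>" using lead_at_exists[OF v(1) r0] by blast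
        have "lead_exps v I \<in> (\<lambda>v. lead_exps v I) ` ?G (insert (r, \<beta>) F)" using v b by auto
        then show "lead_exps v I \<in> (\<Union>\<beta>\<in>min_exps (supp r). (\<lambda>v. lead_exps v I) ` ?G (insert (r, \<beta>) F))"
          using lead_at_in_min_exps[OF v(1) b] by blast
      qed
      moreover have "finite ((\<lambda>v. lead_exps v I) ` ?G (insert (r, \<beta>) F))" if "\<beta> \<in> min_exps (supp r)" for \<beta>
      proof (rule 1(1))
        have "\<beta> \<notin> ?up F" using that qr(2)[of \<beta>] min_exps_subset by blast
        then have "?up F \<subset> ?up (insert (r, \<beta>) F)" by auto
        then show "(insert (r, \<beta>) F, F) \<in> inv_image {(A, B). B \<subset> A \<and> up_closed A \<and> up_closed B} ?up"
          using upc by (simp only: in_inv_image mem_Collect_eq case_prod_conv)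
        show "finite (insert (r, \<beta>) F)" "fst ` insert (r, \<beta>) F \<subseteq> I" using 1(2,3) rI by auto
      qed
      ultimately show ?thesis using finite_min_exps finite_subset by (metis (no_types, lifting) finite_UN_I)
    qed
  qed
  from this[of "{}"] show ?thesis by (simp add: setcompr_eq_image)
qed

end

section \<open>Reduced standard bases\<close>

text \<open>
The non-generic weights in the open positive orthant lie on countably many hyperplanes, one for each
pair of distinct exponents, and their union has measure zero.
\<close>

lemma generic_dense:
  fixes u :: "real ^ 'n::finite"
  assumes u: "u \<in> U_loc" and W: "open W" "u \<in> W"
  shows "\<exists>v\<in>W. generic v"
proof -
  define P where "P = W \<inter> {v. \<forall>i. 0 < v $ i}"
  have "open {v :: real ^ 'n. \<forall>i. 0 < v $ i}"
  proof -
    have "{v :: real ^ 'n. \<forall>i. 0 < v $ i} = (\<Inter>i. {v. 0 < v $ i})" by auto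
    then show ?thesis by (auto intro!: open_INT open_Collect_less continuous_intros)
  qed
  then have oP: "open P" unfolding P_def using W(1) by (rule open_Int[rotated])
  have lim: "(\<lambda>m. u + (1 / real (Suc m)) *\<^sub>R (\<chi> i. 1)) \<longlonglongrightarrow> u + 0 *\<^sub>R (\<chi> i. 1)"
    using LIMSEQ_inverse_real_of_nat by (intro tendsto_intros) (simp add: inverse_eq_divide)
  have "eventually (\<lambda>m. u + (1 / real (Suc m)) *\<^sub>R (\<chi> i. 1) \<in> W) sequentially"
    by (rule topological_tendstoD[OF lim]) (use W in auto)
  then obtain m where "u + (1 / real (Suc m)) *\<^sub>R (\<chi> i. 1) \<in> W" by (auto simp: eventually_sequentially)
  moreover have "0 < (u + (1 / real (Suc m)) *\<^sub>R (\<chi> i. 1)) $ i" for i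
    using u by (simp add: U_loc_def add_nonneg_pos)
  ultimately have Pne: "P \<noteq> {}" by (auto simp: P_def)
  define N where "N = (\<Union>(\<alpha>, \<beta>)\<in>{(\<alpha>, \<beta>). \<alpha> \<noteq> \<beta>}. {v :: real ^ 'n. (\<chi> i. real (\<alpha> $ i) - real (\<beta> $ i)) \<bullet> v = 0})"
  have "negligible N"
    unfolding N_def
  proof (rule negligible_countable_Union, safe)
    have "countable (UNIV :: (nat ^ 'n) set)"
    proof (rule countableI')
      show "inj_on (\<lambda>\<alpha> :: nat ^ 'n. to_nat (map (vec_nth \<alpha>) (SOME xs. set xs = UNIV))) UNIV"
      proof (rule inj_onI)
        fix \<alpha> \<beta> :: "nat ^ 'n"
        assume "to_nat (map (vec_nth \<alpha>) (SOME xs. set xs = UNIV)) = to_nat (map (vec_nth \<beta>) (SOME xs. set xs = UNIV))"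
        then have e: "map (vec_nth \<alpha>) (SOME xs. set xs = UNIV) = map (vec_nth \<beta>) (SOME xs. set xs = UNIV)"
          by (simp only: to_nat_split inj_eq[OF inj_to_nat])
        have "set (SOME xs. set xs = (UNIV :: 'n set)) = UNIV"
          by (rule someI_ex) (rule finite_list, simp)
        then show "\<alpha> = \<beta>" using e by (auto simp: vec_eq_iff map_eq_conv)
      qed
    qed
    then have "countable (UNIV :: ((nat ^ 'n) \<times> (nat ^ 'n)) set)"
      by (simp add: countable_SIGMA flip: UNIV_Times_UNIV)
    then show "countable ((\<lambda>(\<alpha>, \<beta>). {v :: real ^ 'n. (\<chi> i. real (\<alpha> $ i) - real (\<beta> $ i)) \<bullet> v = 0}) ` {(\<alpha>, \<beta>). \<alpha> \<noteq> \<beta>})"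
      using countable_subset by blast
    fix \<alpha> \<beta> :: "nat ^ 'n" assume "\<alpha> \<noteq> \<beta>"
    then have "(\<chi> i. real (\<alpha> $ i) - real (\<beta> $ i)) \<noteq> 0" by (auto simp: vec_eq_iff)
    then show "negligible {v :: real ^ 'n. (\<chi> i. real (\<alpha> $ i) - real (\<beta> $ i)) \<bullet> v = 0}"
      by (intro negligible_hyperplane) auto
  qed
  then have "\<not> P \<subseteq> N" using open_not_negligible[OF oP Pne] negligible_subset by blast
  then obtain v where v: "v \<in> P" "v \<notin> N" by blast
  have "wdot v \<alpha> \<noteq> wdot v \<beta>" if "\<alpha> \<noteq> \<beta>" for \<alpha> \<beta>
  proof
    assume "wdot v \<alpha> = wdot v \<beta>"
    then have "(\<chi> i. real (\<alpha> $ i) - real (\<beta> $ i)) \<bullet> v = 0"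
      by (simp add: wdot_def inner_vec_def algebra_simps sum_subtractf)
    then show False using v(2) that by (auto simp: N_def)
  qed
  then have "generic v" using v(1) by (auto simp: generic_def P_def inj_def)
  then show ?thesis using v(1) by (auto simp: P_def)
qed

definition exp_vec :: "nat ^ 'n::finite \<Rightarrow> real ^ 'n" where
  "exp_vec \<alpha> = (\<chi> i. real (\<alpha> $ i))"

lemma wdot_eq_inner: "wdot u \<alpha> = u \<bullet> exp_vec \<alpha>"
  by (simp add: wdot_def inner_vec_def exp_vec_def)

definition half_space_cone :: "'a::euclidean_space set \<Rightarrow> 'a set" where
  "half_space_cone A = {u. \<forall>a\<in>A. 0 \<le> u \<bullet> a}"

lemma closed_half_space_cone: "closed (half_space_cone A)"
proof -
  have "half_space_cone A = (\<Inter>a\<in>A. {u. 0 \<le> u \<bullet> a})" by (auto simp: half_space_cone_def)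
  then show ?thesis by (auto intro!: closed_INT closed_Collect_le continuous_intros)
qed

context pow_ideal
begin

text \<open>
The reduced basis is made to depend on the exponent set \<open>E\<close> alone. Therefore finitely many sets \<open>E\<close>
give finitely many cones, and all generic weights with the same \<open>E\<close> are compatible with one basis.
\<close>

definition reduced_elt :: "(nat ^ 'n) set \<Rightarrow> nat ^ 'n \<Rightarrow> 'n pow" where
  "reduced_elt E \<alpha> = (SOME f. f \<in> I \<and> f \<alpha> = 1 \<and> supp f \<subseteq> insert \<alpha> (- E))"

definition reduced_basis :: "(nat ^ 'n) set \<Rightarrow> ('n pow \<times> (nat ^ 'n)) set" where
  "reduced_basis E = (\<lambda>\<alpha>. (reduced_elt E \<alpha>, \<alpha>)) ` min_exps E"

text \<open>
The closed cone of weights for which each leading exponent of the reduced basis still has smallest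
weight in its basis element, though possibly not as the only one.
\<close>

definition compatible :: "(nat ^ 'n) set \<Rightarrow> real ^ 'n \<Rightarrow> bool" where
  "compatible E u \<longleftrightarrow> u \<in> U_loc \<and> (\<forall>(f, \<alpha>)\<in>reduced_basis E. \<forall>\<beta>\<in>supp f. wdot u \<alpha> \<le> wdot u \<beta>)"

lemma finite_reduced_basis: "finite (reduced_basis E)"
  by (simp add: reduced_basis_def finite_min_exps)

text \<open>
Divide \<open>x\<^sup>\<alpha>\<close> by elements of \<open>I\<close> whose leading exponents generate \<open>E\<close>, and subtract the remainder.
\<close>

lemma reduced_elt_exists:
  assumes v: "generic v" and E: "E = lead_exps v I" and \<alpha>: "\<alpha> \<in> E"
  shows "\<exists>f. f \<in> I \<and> f \<alpha> = 1 \<and> supp f \<subseteq> insert \<alpha> (- E)"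
proof -
  have "\<forall>\<beta>\<in>min_exps E. \<exists>f. f \<in> I \<and> lead_at v f \<beta>"
    using min_exps_subset[of E] by (auto simp: E lead_exps_def)
  then obtain b where b: "\<And>\<beta>. \<beta> \<in> min_exps E \<Longrightarrow> b \<beta> \<in> I \<and> lead_at v (b \<beta>) \<beta>" by metis
  define F where "F = (\<lambda>\<beta>. (b \<beta>, \<beta>)) ` min_exps E"
  define m where "m = (\<lambda>\<beta>. if \<beta> = \<alpha> then (1::complex) else 0)"
  have pos: "\<And>i. 0 < v $ i" using v by (simp add: generic_def)
  have fin: "finite F" by (simp add: F_def finite_min_exps)
  have lead: "lead_at v f \<beta>" if "(f, \<beta>) \<in> F" for f \<beta> using b that by (auto simp: F_def)
  obtain q r where qr: "m = (\<lambda>\<gamma>. (\<Sum>p\<in>F. pow_mult (q p) (fst p) \<gamma>) + r \<gamma>)"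
    "\<And>\<gamma> p. \<gamma> \<in> supp r \<Longrightarrow> p \<in> F \<Longrightarrow> \<not> snd p \<le> \<gamma>"
    by (rule division[OF fin pos lead, of m]) (assumption | blast)+
  have rE: "\<gamma> \<notin> E" if "\<gamma> \<in> supp r" for \<gamma>
    using qr(2)[OF that] min_exps_below[of \<gamma> E] by (force simp: F_def)
  have "(\<lambda>\<gamma>. m \<gamma> - r \<gamma>) = (\<lambda>\<gamma>. \<Sum>p\<in>F. pow_mult (q p) (fst p) \<gamma>)"
    by (simp add: qr(1))
  also have "\<dots> \<in> I" using b by (intro I_sum I_mult) (auto simp: F_def)
  finally have "(\<lambda>\<gamma>. m \<gamma> - r \<gamma>) \<in> I" .
  moreover have "r \<alpha> = 0" using rE \<alpha> by (auto simp: supp_def)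
  then have "m \<alpha> - r \<alpha> = 1" by (simp add: m_def)
  moreover have "supp (\<lambda>\<gamma>. m \<gamma> - r \<gamma>) \<subseteq> insert \<alpha> (- E)"
    using rE by (auto simp: supp_def m_def split: if_splits)
  ultimately show ?thesis by blast
qed

context
  fixes v :: "real ^ 'n" and E :: "(nat ^ 'n) set"
  assumes v: "generic v" and E: "E = lead_exps v I"
begin

lemma v_pos: "0 < v $ i" using v by (simp add: generic_def)

text \<open>
The leading exponent of a basis element lies in \<open>E\<close>, and \<open>\<alpha>\<close> is the only exponent of the element
there. So these properties follow for any choice of the reduced element.
\<close>

lemma reduced_basis_props:
  assumes "(f, \<alpha>) \<in> reduced_basis E"
  shows "f \<in> I" "f \<alpha> = 1" "supp f \<subseteq> insert \<alpha> (- E)" "\<alpha> \<in> E" "lead_at v f \<alpha>" "\<alpha> \<in> supp f"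
proof -
  have a: "\<alpha> \<in> E" "f = reduced_elt E \<alpha>"
    using assms min_exps_subset[of E] by (auto simp: reduced_basis_def)
  have "f \<in> I \<and> f \<alpha> = 1 \<and> supp f \<subseteq> insert \<alpha> (- E)"
    unfolding a(2) reduced_elt_def by (rule someI_ex[OF reduced_elt_exists[OF v E a(1)]])
  then show 1: "f \<in> I" "f \<alpha> = 1" "supp f \<subseteq> insert \<alpha> (- E)" by auto
  show "\<alpha> \<in> E" by (rule a)
  show 2: "\<alpha> \<in> supp f" using 1 by (simp add: supp_def)
  then obtain \<beta> where b: "lead_at v f \<beta>" using lead_at_exists[OF v, of f] by blast
  then have "\<beta> \<in> E" using 1(1) by (auto simp: E lead_exps_def)
  then show "lead_at v f \<alpha>" using b 1(3) by (auto simp: lead_at_def)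
qed

lemma up_reduced_basis: "(\<exists>p\<in>reduced_basis E. snd p \<le> \<gamma>) \<longleftrightarrow> \<gamma> \<in> E"
proof
  assume "\<gamma> \<in> E" then show "\<exists>p\<in>reduced_basis E. snd p \<le> \<gamma>"
    using min_exps_below[of \<gamma> E] by (auto simp: reduced_basis_def)
next
  assume "\<exists>p\<in>reduced_basis E. snd p \<le> \<gamma>"
  then show "\<gamma> \<in> E" using up_closed_lead_exps[of v] min_exps_subset[of E]
    by (auto simp: reduced_basis_def up_closed_def E)
qed

text \<open>
The remainder of an element of \<open>I\<close> belongs to \<open>I\<close> and has no exponent in \<open>E\<close>, hence vanishes.
\<close>

lemma standard_representation:
  assumes g: "g \<in> I"
  obtains q where "g = (\<lambda>\<gamma>. \<Sum>p\<in>reduced_basis E. pow_mult (q p) (fst p) \<gamma>)"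
    "\<And>S. supp g \<subseteq> S \<Longrightarrow> (\<And>f \<alpha> \<beta> \<delta>. (f, \<alpha>) \<in> reduced_basis E \<Longrightarrow> \<beta> \<in> supp f \<Longrightarrow> \<delta> + \<alpha> \<in> S \<Longrightarrow> \<delta> + \<beta> \<in> S) \<Longrightarrow>
       \<forall>p\<in>reduced_basis E. \<forall>\<delta>\<in>supp (q p). \<delta> + snd p \<in> S"
proof -
  obtain q r where qr: "g = (\<lambda>\<gamma>. (\<Sum>p\<in>reduced_basis E. pow_mult (q p) (fst p) \<gamma>) + r \<gamma>)"
    "\<And>\<gamma> p. \<gamma> \<in> supp r \<Longrightarrow> p \<in> reduced_basis E \<Longrightarrow> \<not> snd p \<le> \<gamma>"
    "\<And>S. supp g \<subseteq> S \<Longrightarrow> (\<And>f \<alpha> \<beta> \<delta>. (f, \<alpha>) \<in> reduced_basis E \<Longrightarrow> \<beta> \<in> supp f \<Longrightarrow> \<delta> + \<alpha> \<in> S \<Longrightarrow> \<delta> + \<beta> \<in> S) \<Longrightarrow>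
       supp r \<subseteq> S \<and> (\<forall>p\<in>reduced_basis E. \<forall>\<delta>\<in>supp (q p). \<delta> + snd p \<in> S)"
    by (rule division[OF finite_reduced_basis v_pos reduced_basis_props(5), where g = g]) (assumption | blast)+
  have "fst ` reduced_basis E \<subseteq> I" using reduced_basis_props(1) by auto
  then have "r \<in> I" by (rule remainder_in_ideal[OF g qr(1)])
  moreover have "supp r \<inter> lead_exps v I = {}" using qr(2) up_reduced_basis E by blast
  ultimately have r: "r = (\<lambda>\<alpha>. 0)" by (rule supp_meets_lead_exps[OF v])
  show thesis
  proof (rule that[of q])
    show "g = (\<lambda>\<gamma>. \<Sum>p\<in>reduced_basis E. pow_mult (q p) (fst p) \<gamma>)" using qr(1) by (simp add: r)
  qed (use qr(3) in blast)
qed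

text \<open>
A homogeneous component of \<open>p\<close> is the lowest part of some \<open>g \<in> I\<close>. Take its leading exponent \<open>\<gamma>\<close> for \<open>v\<close>
and divide \<open>g\<close> by the reduced basis. With respect to the weight \<open>u\<close> refined by \<open>v\<close>, no step of the
division goes below \<open>\<gamma>\<close>, and the non-leading terms of the basis elements only contribute strictly
above \<open>\<gamma>\<close>. So the term of \<open>g\<close> at \<open>\<gamma>\<close> comes from a leading term, that is, \<open>\<gamma> \<in> E\<close>.
\<close>

lemma in_ideal_meets_lead_exps:
  assumes u: "compatible E u" and p: "p \<in> in_ideal u I" "p \<noteq> (\<lambda>\<alpha>. 0)"
  shows "supp p \<inter> E \<noteq> {}"
proof -
  have uU: "u \<in> U_loc" and uF: "\<And>f \<alpha> \<beta>. (f, \<alpha>) \<in> reduced_basis E \<Longrightarrow> \<beta> \<in> supp f \<Longrightarrow> wdot u \<alpha> \<le> wdot u \<beta>"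
    using u by (auto simp: compatible_def)
  obtain \<gamma>0 where "p \<gamma>0 \<noteq> 0" using p(2) by auto
  define k where "k = wdot u \<gamma>0"
  obtain g where g: "g \<in> I" "g \<in> filt_ge u k" "weight_part u k g = weight_part u k p"
    using part_eq_in_form_lift[OF uU p(1)] by blast
  have "\<gamma>0 \<in> supp (weight_part u k g)"
    unfolding g(3) using \<open>p \<gamma>0 \<noteq> 0\<close> by (simp add: supp_def weight_part_def k_def)
  then obtain \<gamma> where \<gamma>: "lead_at v (weight_part u k g) \<gamma>" using lead_at_exists[OF v, of "weight_part u k g"] by blast
  then have \<gamma>k: "wdot u \<gamma> = k" "\<gamma> \<in> supp g" by (auto simp: lead_at_def supp_def weight_part_def split: if_splits)
  \<comment> \<open>the exponents at least \<open>\<gamma>\<close> for the weight \<open>u\<close>, with ties broken by \<open>v\<close>\<close>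
  define S where "S = {\<delta>. k < wdot u \<delta> \<or> (wdot u \<delta> = k \<and> wdot v \<gamma> \<le> wdot v \<delta>)}"
  obtain q where q: "g = (\<lambda>\<gamma>. \<Sum>p\<in>reduced_basis E. pow_mult (q p) (fst p) \<gamma>)"
    "\<And>S. supp g \<subseteq> S \<Longrightarrow> (\<And>f \<alpha> \<beta> \<delta>. (f, \<alpha>) \<in> reduced_basis E \<Longrightarrow> \<beta> \<in> supp f \<Longrightarrow> \<delta> + \<alpha> \<in> S \<Longrightarrow> \<delta> + \<beta> \<in> S) \<Longrightarrow>
       \<forall>p\<in>reduced_basis E. \<forall>\<delta>\<in>supp (q p). \<delta> + snd p \<in> S"
    by (rule standard_representation[OF g(1)]) blast
  have above: "k < wdot u (\<delta> + \<beta>) \<or> (wdot u (\<delta> + \<beta>) = k \<and> wdot v \<gamma> < wdot v (\<delta> + \<beta>))"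
    if "(f, \<alpha>) \<in> reduced_basis E" "\<beta> \<in> supp f" "\<beta> \<noteq> \<alpha>" "\<delta> + \<alpha> \<in> S" for f \<alpha> \<beta> \<delta>
  proof -
    have "wdot v (\<delta> + \<alpha>) < wdot v (\<delta> + \<beta>)" "wdot u (\<delta> + \<alpha>) \<le> wdot u (\<delta> + \<beta>)"
      using reduced_basis_props(5)[OF that(1)] uF[OF that(1,2)] that(2,3)
      by (auto simp: lead_at_def wdot_add)
    then show ?thesis using that(4) unfolding S_def mem_Collect_eq by linarith
  qed
  have "supp g \<subseteq> S"
  proof
    fix \<delta> assume d: "\<delta> \<in> supp g"
    then have "k \<le> wdot u \<delta>" using g(2) by (simp add: filt_ge_iff)
    moreover have "wdot v \<gamma> \<le> wdot v \<delta>" if "wdot u \<delta> = k"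
      using \<gamma> d that by (cases "\<delta> = \<gamma>") (auto simp: lead_at_def supp_def weight_part_def split: if_splits intro: less_imp_le)
    ultimately show "\<delta> \<in> S" by (auto simp: S_def)
  qed
  moreover have "\<delta> + \<beta> \<in> S" if "(f, \<alpha>) \<in> reduced_basis E" "\<beta> \<in> supp f" "\<delta> + \<alpha> \<in> S" for f \<alpha> \<beta> \<delta>
    using above[OF that(1,2) _ that(3)] that(3) by (cases "\<beta> = \<alpha>") (auto simp: S_def)
  ultimately have qS: "\<forall>p\<in>reduced_basis E. \<forall>\<delta>\<in>supp (q p). \<delta> + snd p \<in> S"
    by (rule q(2))
  have q': "g = (\<lambda>\<gamma>. (\<Sum>p\<in>reduced_basis E. pow_mult (q p) (fst p) \<gamma>) + (\<lambda>_. 0) \<gamma>)" using q(1) by simp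
  have "\<exists>p\<in>reduced_basis E. snd p \<le> \<gamma>"
    by (rule division_cancellation_free[OF q' qS]) (use above \<gamma>k in \<open>force simp: supp_def\<close>)+
  then have "\<gamma> \<in> E" using up_reduced_basis by blast
  moreover have "\<gamma> \<in> supp p"
    using \<gamma> unfolding g(3) by (auto simp: lead_at_def supp_def weight_part_def split: if_splits)
  ultimately show ?thesis by blast
qed

end

end

section \<open>Cones of weights compatible with a reduced basis\<close>

text \<open>
If the same coordinates are positive, each of the two weights is bounded by a multiple of the other.
A set of exponents has finitely many weights iff its weights are bounded.
\<close>

lemma gr_ring_eq:
  assumes u: "u \<in> U_loc" "u' \<in> U_loc" and z: "{i. u $ i \<noteq> 0} = {i. u' $ i \<noteq> 0}"
  shows "gr_ring u = gr_ring u'"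
proof -
  have sub: "gr_carrier u \<subseteq> gr_carrier u'"
    if u: "u \<in> U_loc" "u' \<in> U_loc" and z: "{i. u $ i \<noteq> 0} = {i. u' $ i \<noteq> 0}" for u u' :: "real ^ 'a"
  proof
    fix f assume "f \<in> gr_carrier u"
    then have fin: "finite (wdot u ` supp f)" by (simp add: gr_carrier_iff)
    \<comment> \<open>summands with \<open>u $ i = 0\<close> are zero by the convention on division by zero\<close>
    define C where "C = (\<Sum>i\<in>UNIV. u' $ i / u $ i)"
    have nn: "0 \<le> u $ i" "0 \<le> u' $ i" for i using u by (auto simp: U_loc_def)
    have C: "u' $ i \<le> C * u $ i" for i
    proof (cases "u $ i = 0")
      case False
      have "u' $ i / u $ i \<le> C" unfolding C_def using nn by (intro member_le_sum) auto
      moreover have "0 < u $ i" using False nn(1)[of i] by simp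
      ultimately show ?thesis by (simp add: pos_divide_le_eq)
    next
      case True
      then have "u' $ i = 0" using z by blast
      then show ?thesis using True by simp
    qed
    have le: "wdot u' \<alpha> \<le> C * wdot u \<alpha>" for \<alpha>
      unfolding wdot_def sum_distrib_left using C
      by (intro sum_mono) (simp add: mult_right_mono mult.assoc[symmetric])
    define b where "b = Max (insert 0 ((\<lambda>\<alpha>. C * wdot u \<alpha>) ` supp f))"
    have finC: "finite ((\<lambda>\<alpha>. C * wdot u \<alpha>) ` supp f)"
      using finite_imageI[OF fin, of "\<lambda>x. C * x"] by (simp add: image_image)
    have "wdot u' \<alpha> \<le> b" if "\<alpha> \<in> supp f" for \<alpha>
    proof -
      have "C * wdot u \<alpha> \<le> b" unfolding b_def using finC that by (intro Max_ge) auto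
      with le show ?thesis by (rule order_trans)
    qed
    then have "wdot u' ` supp f \<subseteq> {wdot u' \<alpha> | \<alpha>. wdot u' \<alpha> \<le> b}" by blast
    then show "f \<in> gr_carrier u'"
      unfolding gr_carrier_iff using finite_weights_below[OF u(2)] finite_subset by blast
  qed
  have "gr_carrier u = gr_carrier u'"
    using sub[OF u z] sub[OF u(2,1) z[symmetric]] by (rule antisym)
  then show ?thesis by (simp add: gr_ring_def)
qed

lemma wdot_eq_0_iff: "u \<in> U_loc \<Longrightarrow> wdot u \<delta> = 0 \<longleftrightarrow> (\<forall>i. u $ i = 0 \<or> \<delta> $ i = 0)"
  unfolding wdot_def by (subst sum_nonneg_eq_0_iff) (auto simp: U_loc_def)

context pow_ideal
begin

lemma in_ideal_ideal: "u \<in> U_loc \<Longrightarrow> Ideal.ideal (in_ideal u I) (gr_ring u)"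
proof -
  assume u: "u \<in> U_loc"
  interpret G: cring "gr_ring u" by (rule cring_gr_ring)
  show ?thesis unfolding in_ideal_def
    by (rule G.genideal_ideal) (use in_form_in_gr_carrier[OF u] in \<open>auto simp: gr_ring_def\<close>)
qed

lemma in_ideal_zero: "u \<in> U_loc \<Longrightarrow> (\<lambda>\<alpha>. 0) \<in> in_ideal u I"
  using additive_subgroup.zero_closed[OF ideal.axioms(1)[OF in_ideal_ideal]]
  by (simp add: gr_ring_def pow_ring_def)

lemma in_ideal_add: "u \<in> U_loc \<Longrightarrow> p \<in> in_ideal u I \<Longrightarrow> q \<in> in_ideal u I \<Longrightarrow> (\<lambda>\<alpha>. p \<alpha> + q \<alpha>) \<in> in_ideal u I"
  using additive_subgroup.a_closed[OF ideal.axioms(1)[OF in_ideal_ideal], of u p q]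
  by (simp add: gr_ring_def pow_ring_def)

lemma in_ideal_mult: "u \<in> U_loc \<Longrightarrow> a \<in> gr_carrier u \<Longrightarrow> p \<in> in_ideal u I \<Longrightarrow> pow_mult a p \<in> in_ideal u I"
  using ideal.I_l_closed[OF in_ideal_ideal, of u p a]
  by (simp add: gr_ring_def pow_ring_def)

lemma in_ideal_sum:
  "u \<in> U_loc \<Longrightarrow> (\<And>x. x \<in> X \<Longrightarrow> p x \<in> in_ideal u I) \<Longrightarrow> (\<lambda>\<alpha>. \<Sum>x\<in>X. p x \<alpha>) \<in> in_ideal u I"
  by (induction X rule: infinite_finite_induct) (auto simp: in_ideal_zero intro: in_ideal_add)

lemma in_ideal_diff:
  assumes "u \<in> U_loc" "p \<in> in_ideal u I" "q \<in> in_ideal u I" shows "(\<lambda>\<alpha>. p \<alpha> - q \<alpha>) \<in> in_ideal u I"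
proof -
  have "(\<lambda>\<beta>. if \<beta> = 0 then - 1 else 0) \<in> gr_carrier u"
    unfolding gr_carrier_iff by (rule finite_subset[of _ "{wdot u 0}"]) (auto simp: supp_def)
  then have "pow_mult (\<lambda>\<beta>. if \<beta> = 0 then - 1 else 0) q \<in> in_ideal u I"
    using assms by (intro in_ideal_mult)
  then have "(\<lambda>\<alpha>. - q \<alpha>) \<in> in_ideal u I"
    unfolding pow_mult_monomial by (simp add: less_eq_vec_def)
  then show ?thesis using in_ideal_add[OF assms(1,2), of "\<lambda>\<alpha>. - q \<alpha>"] by simp
qed

text \<open>
Basis elements are power series and impose infinitely many inequalities. As weights are non-negative,
those for the minimal remaining exponents imply the others. The coordinate vectors are included
both to stay in the orthant and because Groebner classes distinguish which coordinates vanish.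
\<close>

definition cone_ineqs :: "(nat ^ 'n) set \<Rightarrow> (real ^ 'n) set" where
  "cone_ineqs E = (\<Union>(f, \<alpha>)\<in>reduced_basis E. (\<lambda>\<beta>. exp_vec \<beta> - exp_vec \<alpha>) ` min_exps (supp f - {\<alpha>}))
     \<union> range (\<lambda>i. axis i 1)"

lemma finite_cone_ineqs: "finite (cone_ineqs E)"
  unfolding cone_ineqs_def using finite_reduced_basis finite_min_exps by (auto intro!: finite_UN_I)

lemma half_space_cone_eq_compatible: "u \<in> half_space_cone (cone_ineqs E) \<longleftrightarrow> compatible E u"
proof
  assume u: "u \<in> half_space_cone (cone_ineqs E)"
  have "axis i 1 \<in> cone_ineqs E" for i by (simp add: cone_ineqs_def)
  then have "0 \<le> u \<bullet> axis i 1" for i using u by (simp add: half_space_cone_def)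
  then have U: "u \<in> U_loc" by (simp add: U_loc_def inner_axis)
  have "wdot u \<alpha> \<le> wdot u \<beta>" if f: "(f, \<alpha>) \<in> reduced_basis E" "\<beta> \<in> supp f" for f \<alpha> \<beta>
  proof (cases "\<beta> = \<alpha>")
    case False
    then obtain \<beta>0 where b: "\<beta>0 \<in> min_exps (supp f - {\<alpha>})" "\<beta>0 \<le> \<beta>"
      using min_exps_below[of \<beta> "supp f - {\<alpha>}"] f(2) by blast
    then have "exp_vec \<beta>0 - exp_vec \<alpha> \<in> cone_ineqs E" using f(1) by (auto simp: cone_ineqs_def)
    then have "wdot u \<alpha> \<le> wdot u \<beta>0"
      using u by (auto simp: half_space_cone_def wdot_eq_inner inner_diff_right)
    also have "\<dots> \<le> wdot u \<beta>" using U b(2) by (rule wdot_mono)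
    finally show ?thesis .
  qed simp
  then show "compatible E u" using U by (auto simp: compatible_def)
next
  assume u: "compatible E u"
  then show "u \<in> half_space_cone (cone_ineqs E)"
    using min_exps_subset
    by (fastforce simp: compatible_def half_space_cone_def cone_ineqs_def U_loc_def inner_axis
        wdot_eq_inner inner_diff_right)
qed

text \<open>
For an exponent \<open>\<beta>\<close> above a minimal one \<open>\<beta>0\<close>, equality of weights at \<open>\<beta>\<close> means equality at \<open>\<beta>0\<close> together
with weight zero of \<open>\<beta> - \<beta>0\<close>, and the latter depends only on which coordinates vanish.
\<close>

lemma same_face_iff:
  assumes u: "compatible E u" "compatible E u'"
  shows "(\<forall>a\<in>cone_ineqs E. u \<bullet> a = 0 \<longleftrightarrow> u' \<bullet> a = 0) \<longleftrightarrow>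
    {i. u $ i \<noteq> 0} = {i. u' $ i \<noteq> 0} \<and>
    (\<forall>(f, \<alpha>)\<in>reduced_basis E. \<forall>\<beta>\<in>supp f. wdot u \<beta> = wdot u \<alpha> \<longleftrightarrow> wdot u' \<beta> = wdot u' \<alpha>)"
    (is "?L \<longleftrightarrow> ?Z \<and> ?R")
proof
  assume L: ?L
  have "u $ i = 0 \<longleftrightarrow> u' $ i = 0" for i
    using bspec[OF L, of "axis i 1"] by (simp add: cone_ineqs_def inner_axis)
  then have Z: ?Z and z: "\<And>i. u $ i = 0 \<longleftrightarrow> u' $ i = 0" by auto
  have U: "u \<in> U_loc" "u' \<in> U_loc" using u by (auto simp: compatible_def)
  have "wdot u \<beta> = wdot u \<alpha> \<longleftrightarrow> wdot u' \<beta> = wdot u' \<alpha>" if f: "(f, \<alpha>) \<in> reduced_basis E" "\<beta> \<in> supp f" for f \<alpha> \<beta>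
  proof (cases "\<beta> = \<alpha>")
    case False
    then obtain \<beta>0 where b: "\<beta>0 \<in> min_exps (supp f - {\<alpha>})" "\<beta>0 \<le> \<beta>"
      using min_exps_below[of \<beta> "supp f - {\<alpha>}"] f(2) by blast
    then have "exp_vec \<beta>0 - exp_vec \<alpha> \<in> cone_ineqs E" using f(1) by (auto simp: cone_ineqs_def)
    then have 0: "wdot u \<beta>0 = wdot u \<alpha> \<longleftrightarrow> wdot u' \<beta>0 = wdot u' \<alpha>"
      using bspec[OF L] by (force simp: wdot_eq_inner inner_diff_right)
    have b0: "\<beta>0 \<in> supp f" using b(1) min_exps_subset by blast
    have split: "wdot w \<beta> = wdot w \<alpha> \<longleftrightarrow> wdot w \<beta>0 = wdot w \<alpha> \<and> wdot w (\<beta> - \<beta>0) = 0" if w: "compatible E w" for w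
    proof -
      have "wdot w \<beta> = wdot w \<beta>0 + wdot w (\<beta> - \<beta>0)"
        using exponent_diff(1)[OF b(2)] wdot_add[of w \<beta>0 "\<beta> - \<beta>0"] by simp
      moreover have "wdot w \<alpha> \<le> wdot w \<beta>0" using w f(1) b0 by (auto simp: compatible_def)
      moreover have "0 \<le> wdot w (\<beta> - \<beta>0)"
        using w by (auto simp: compatible_def wdot_def U_loc_def intro: sum_nonneg)
      ultimately show ?thesis by linarith
    qed
    show ?thesis unfolding split[OF u(1)] split[OF u(2)] 0
      by (simp add: wdot_eq_0_iff U z)
  qed simp
  then show "?Z \<and> ?R" using Z by blast
next
  assume R: "?Z \<and> ?R"
  then have "u $ i = 0 \<longleftrightarrow> u' $ i = 0" for i by blast
  moreover have "wdot u \<beta> = wdot u \<alpha> \<longleftrightarrow> wdot u' \<beta> = wdot u' \<alpha>"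
    if "(f, \<alpha>) \<in> reduced_basis E" "\<beta> \<in> min_exps (supp f - {\<alpha>})" for f \<alpha> \<beta>
    using R that min_exps_subset[of "supp f - {\<alpha>}"] by blast
  ultimately show ?L
    by (auto simp: cone_ineqs_def inner_axis wdot_eq_inner inner_diff_right)
qed

context
  fixes v :: "real ^ 'n" and E :: "(nat ^ 'n) set"
  assumes v: "generic v" and E: "E = lead_exps v I"
begin

lemma compatible_generic: "compatible E v"
  using reduced_basis_props(5)[OF v E] U_loc_if_pos[OF v_pos[OF v E]]
  unfolding compatible_def lead_at_def by (fastforce intro: less_imp_le)

lemma in_form_reduced_basis:
  assumes u: "compatible E u" and f: "(f, \<alpha>) \<in> reduced_basis E"
  shows "f \<in> filt_ge u (wdot u \<alpha>)" "in_form u f = weight_part u (wdot u \<alpha>) f" "in_form u f \<alpha> = 1"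
proof -
  have U: "u \<in> U_loc" using u by (simp add: compatible_def)
  show 1: "f \<in> filt_ge u (wdot u \<alpha>)" using u f by (auto simp: compatible_def filt_ge_iff)
  have a: "weight_part u (wdot u \<alpha>) f \<alpha> = 1" using reduced_basis_props(2)[OF v E f] by (simp add: weight_part_def)
  then have "weight_part u (wdot u \<alpha>) f \<noteq> (\<lambda>\<alpha>. 0)" by (metis zero_neq_one)
  then show "in_form u f = weight_part u (wdot u \<alpha>) f" using in_form_eq_part[OF U 1] by simp
  with a show "in_form u f \<alpha> = 1" by simp
qed

text \<open>
A standard representation of \<open>g\<close> does not fall below the \<open>u\<close>-weight of \<open>g\<close>, so its lowest part writes
\<open>in\<^sub>u(g)\<close> as a combination of the initial forms of the basis elements.
\<close>

lemma in_ideal_subset_if_forms_agree: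
  assumes u: "compatible E u" and u': "u' \<in> U_loc" and gr: "gr_ring u = gr_ring u'"
    and forms: "\<And>f \<alpha>. (f, \<alpha>) \<in> reduced_basis E \<Longrightarrow> in_form u f = in_form u' f"
  shows "in_ideal u I \<subseteq> in_ideal u' I"
proof -
  have U: "u \<in> U_loc" and uF: "\<And>f \<alpha> \<beta>. (f, \<alpha>) \<in> reduced_basis E \<Longrightarrow> \<beta> \<in> supp f \<Longrightarrow> wdot u \<alpha> \<le> wdot u \<beta>"
    using u by (auto simp: compatible_def)
  have grc: "gr_carrier u = gr_carrier u'" using arg_cong[OF gr, of carrier] by (simp add: gr_ring_def)
  interpret G: cring "gr_ring u" by (rule cring_gr_ring)
  have "in_form u g \<in> in_ideal u' I" if g: "g \<in> I" for g
  proof (rule in_form_cases[OF U, of g])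
    assume "in_form u g = (\<lambda>\<alpha>. 0)" then show ?thesis using in_ideal_zero[OF u'] by simp
  next
    fix k assume k: "g \<in> filt_ge u k" "in_form u g = weight_part u k g"
    obtain q where q: "g = (\<lambda>\<gamma>. \<Sum>p\<in>reduced_basis E. pow_mult (q p) (fst p) \<gamma>)"
      "\<And>S. supp g \<subseteq> S \<Longrightarrow> (\<And>f \<alpha> \<beta> \<delta>. (f, \<alpha>) \<in> reduced_basis E \<Longrightarrow> \<beta> \<in> supp f \<Longrightarrow> \<delta> + \<alpha> \<in> S \<Longrightarrow> \<delta> + \<beta> \<in> S) \<Longrightarrow>
       \<forall>p\<in>reduced_basis E. \<forall>\<delta>\<in>supp (q p). \<delta> + snd p \<in> S"
      by (rule standard_representation[OF v E g]) blast
    have "\<forall>p\<in>reduced_basis E. \<forall>\<delta>\<in>supp (q p). \<delta> + snd p \<in> {\<delta>. k \<le> wdot u \<delta>}"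
    proof (rule q(2))
      show "supp g \<subseteq> {\<delta>. k \<le> wdot u \<delta>}" using k(1) by (auto simp: filt_ge_iff)
      show "\<delta> + \<beta> \<in> {\<delta>. k \<le> wdot u \<delta>}"
        if "(f, \<alpha>) \<in> reduced_basis E" "\<beta> \<in> supp f" "\<delta> + \<alpha> \<in> {\<delta>. k \<le> wdot u \<delta>}" for f \<alpha> \<beta> \<delta>
        using uF[OF that(1,2)] that(3) by (simp add: wdot_add)
    qed
    then have qk: "q p \<in> filt_ge u (k - wdot u (snd p))" if "p \<in> reduced_basis E" for p
      using that by (simp add: filt_ge_iff wdot_add) (metis add.commute le_diff_eq diff_le_eq)
    have "weight_part u k (pow_mult (q p) (fst p)) = pow_mult (weight_part u (k - wdot u (snd p)) (q p)) (in_form u' (fst p))"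
      if p: "p \<in> reduced_basis E" for p
    proof -
      have f: "(fst p, snd p) \<in> reduced_basis E" using p by simp
      show ?thesis
        using part_mult[OF qk[OF p] in_form_reduced_basis(1)[OF u f]]
        by (simp add: in_form_reduced_basis(2)[OF u f] flip: forms[OF f])
    qed
    then have "weight_part u k g = (\<lambda>\<gamma>. \<Sum>p\<in>reduced_basis E. pow_mult (weight_part u (k - wdot u (snd p)) (q p)) (in_form u' (fst p)) \<gamma>)"
      by (subst q(1)) (simp add: part_sum)
    also have "\<dots> \<in> in_ideal u' I"
    proof (intro in_ideal_sum in_ideal_mult u' in_form_in_in_ideal)
      show "weight_part u (k - wdot u (snd p)) (q p) \<in> gr_carrier u'" for p
        using part_in_gr_carrier grc by blast
      show "fst p \<in> I" if "p \<in> reduced_basis E" for p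
        using reduced_basis_props(1)[OF v E, of "fst p" "snd p"] that by simp
    qed
    finally show ?thesis using k(2) by simp
  qed
  moreover have "Ideal.ideal (in_ideal u' I) (gr_ring u)" unfolding gr by (rule in_ideal_ideal[OF u'])
  ultimately show ?thesis unfolding in_ideal_def[of u] by (intro G.genideal_minimal) auto
qed

text \<open>
If the initial ideals agree, then \<open>in\<^bsub>u'\<^esub>(f)\<close> lies in \<open>in\<^sub>u(I)\<close> for a basis element \<open>f\<close> with exponent \<open>\<alpha>\<close>,
hence has an exponent in \<open>E\<close>, and this can only be \<open>\<alpha>\<close>. So \<open>u'\<close> is compatible as well. The
difference of the two initial forms of \<open>f\<close> has no exponent in \<open>E\<close> any more and lies in \<open>in\<^sub>u(I)\<close>, so it
vanishes. Conversely, weights in the relative interior of one face give the basis elements the same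
initial forms, and these generate the initial ideals.
\<close>

theorem loc_equiv_iff_same_face:
  assumes u: "compatible E u" and u': "u' \<in> U_loc"
  shows "loc_equiv I u u' \<longleftrightarrow> compatible E u' \<and> (\<forall>a\<in>cone_ineqs E. u \<bullet> a = 0 \<longleftrightarrow> u' \<bullet> a = 0)"
proof
  have U: "u \<in> U_loc" using u by (simp add: compatible_def)
  assume eq: "loc_equiv I u u'"
  then have z: "{i. u $ i \<noteq> 0} = {i. u' $ i \<noteq> 0}" and id: "in_ideal u I = in_ideal u' I"
    by (auto simp: loc_equiv_def)
  have key: "\<alpha> \<in> supp (in_form u' f)" if f: "(f, \<alpha>) \<in> reduced_basis E" for f \<alpha>
  proof -
    note props = reduced_basis_props[OF v E f]
    have "supp f \<noteq> {}" using props by auto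
    then have "in_form u' f \<noteq> (\<lambda>\<alpha>. 0)"
      using in_form_cases[OF u', of f] by (metis props(2) zero_neq_one)
    moreover have "in_form u' f \<in> in_ideal u I"
      unfolding id using u' props(1) by (rule in_form_in_in_ideal)
    ultimately have "supp (in_form u' f) \<inter> E \<noteq> {}" by (rule in_ideal_meets_lead_exps[OF v E u, rotated])
    moreover have "supp (in_form u' f) \<subseteq> supp f" by (auto simp: supp_def in_form_def split: if_splits)
    ultimately show ?thesis using props(3) by blast
  qed
  have cmp: "compatible E u'"
    unfolding compatible_def
  proof (intro conjI u' ballI, clarify)
    fix f \<alpha> \<beta> assume f: "(f, \<alpha>) \<in> reduced_basis E" "\<beta> \<in> supp f"
    have "ereal (wdot u' \<alpha>) = wei u' f" using key[OF f(1)] by (auto simp: supp_def in_form_def split: if_splits)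
    also have "\<dots> \<le> ereal (wdot u' \<beta>)" unfolding wei_def using f(2) by (rule INF_lower)
    finally show "wdot u' \<alpha> \<le> wdot u' \<beta>" by simp
  qed
  have forms: "in_form u f = in_form u' f" if f: "(f, \<alpha>) \<in> reduced_basis E" for f \<alpha>
  proof (rule ccontr)
    note props = reduced_basis_props[OF v E f]
    define d where "d = (\<lambda>\<alpha>. in_form u f \<alpha> - in_form u' f \<alpha>)"
    assume "in_form u f \<noteq> in_form u' f"
    then have "d \<noteq> (\<lambda>\<alpha>. 0)" by (auto simp: d_def fun_eq_iff)
    moreover have "d \<in> in_ideal u I"
      unfolding d_def using in_form_in_in_ideal[OF U props(1)] in_form_in_in_ideal[OF u' props(1)] id
      by (intro in_ideal_diff U) auto
    ultimately have "supp d \<inter> E \<noteq> {}" by (rule in_ideal_meets_lead_exps[OF v E u, rotated])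
    moreover have "d \<alpha> = 0"
      using in_form_reduced_basis(3)[OF u f] in_form_reduced_basis(3)[OF cmp f] by (simp add: d_def)
    moreover have "supp d \<subseteq> supp f" by (auto simp: d_def supp_def in_form_def split: if_splits)
    ultimately show False using props(3) by (auto simp: supp_def)
  qed
  have "wdot u \<beta> = wdot u \<alpha> \<longleftrightarrow> wdot u' \<beta> = wdot u' \<alpha>"
    if f: "(f, \<alpha>) \<in> reduced_basis E" "\<beta> \<in> supp f" for f \<alpha> \<beta>
  proof -
    have "weight_part u (wdot u \<alpha>) f \<beta> = weight_part u' (wdot u' \<alpha>) f \<beta>"
      using forms[OF f(1)] in_form_reduced_basis(2)[OF u f(1)] in_form_reduced_basis(2)[OF cmp f(1)] by simp
    then show ?thesis using f(2) by (auto simp: weight_part_def supp_def split: if_splits)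
  qed
  then show "compatible E u' \<and> (\<forall>a\<in>cone_ineqs E. u \<bullet> a = 0 \<longleftrightarrow> u' \<bullet> a = 0)"
    using cmp z same_face_iff[OF u cmp] by blast
next
  have U: "u \<in> U_loc" using u by (simp add: compatible_def)
  assume R: "compatible E u' \<and> (\<forall>a\<in>cone_ineqs E. u \<bullet> a = 0 \<longleftrightarrow> u' \<bullet> a = 0)"
  then have cmp: "compatible E u'" by blast
  then have z: "{i. u $ i \<noteq> 0} = {i. u' $ i \<noteq> 0}"
    and t: "\<And>f \<alpha> \<beta>. (f, \<alpha>) \<in> reduced_basis E \<Longrightarrow> \<beta> \<in> supp f \<Longrightarrow> wdot u \<beta> = wdot u \<alpha> \<longleftrightarrow> wdot u' \<beta> = wdot u' \<alpha>"
    using R same_face_iff[OF u cmp] by blast+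
  have forms: "in_form u f = in_form u' f" if f: "(f, \<alpha>) \<in> reduced_basis E" for f \<alpha>
    unfolding in_form_reduced_basis(2)[OF u f] in_form_reduced_basis(2)[OF cmp f]
    using t[OF f] by (auto simp: weight_part_def fun_eq_iff supp_def)
  have gr: "gr_ring u = gr_ring u'" by (rule gr_ring_eq[OF U u' z])
  have "in_ideal u I \<subseteq> in_ideal u' I"
    by (rule in_ideal_subset_if_forms_agree[OF u u' gr forms])
  moreover have "in_ideal u' I \<subseteq> in_ideal u I"
    by (rule in_ideal_subset_if_forms_agree[OF cmp U gr[symmetric] forms[symmetric]])
  ultimately show "loc_equiv I u u'" using z by (auto simp: loc_equiv_def)
qed

end

text \<open>
A weight outside all of these finitely many closed cones would have a neighbourhood outside of them,
and that neighbourhood contains a generic weight, which is compatible with its own exponent set.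
\<close>

theorem compatible_covering:
  assumes u: "u \<in> U_loc" shows "\<exists>E\<in>{lead_exps v I | v. generic v}. compatible E u"
proof (rule ccontr)
  assume none: "\<not> ?thesis"
  define W where "W = (\<Inter>E\<in>{lead_exps v I | v. generic v}. - half_space_cone (cone_ineqs E))"
  have "open W" unfolding W_def
    by (intro open_INT finite_lead_exps ballI open_Compl closed_half_space_cone)
  moreover have "u \<in> W" using none by (auto simp: W_def half_space_cone_eq_compatible)
  ultimately obtain v where v: "v \<in> W" "generic v" using generic_dense[OF u] by blast
  then have "\<not> compatible (lead_exps v I) v" by (auto simp: W_def half_space_cone_eq_compatible)
  then show False using compatible_generic[OF v(2) refl] by blast
qed

end

section \<open>Fans from sign classes\<close>

definition cone_face :: "'a::euclidean_space set \<Rightarrow> 'a \<Rightarrow> 'a set" where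
  "cone_face A u = {w \<in> half_space_cone A. \<forall>a\<in>A. u \<bullet> a = 0 \<longrightarrow> w \<bullet> a = 0}"

lemma polyhedron_cone_face:
  fixes A :: "'a::euclidean_space set"
  assumes "finite A" shows "polyhedron (cone_face A u)"
proof -
  have e: "cone_face A u = \<Inter> ((\<lambda>a. {w. - a \<bullet> w \<le> 0}) ` A \<union> (\<lambda>a. {w. a \<bullet> w \<le> 0}) ` {a \<in> A. u \<bullet> a = 0})"
  proof (rule Set.set_eqI)
    fix w :: 'a
    have "w \<bullet> a = 0 \<longleftrightarrow> 0 \<le> w \<bullet> a \<and> a \<bullet> w \<le> 0" for a by (auto simp: inner_commute)
    then show "w \<in> cone_face A u \<longleftrightarrow> w \<in> \<Inter> ((\<lambda>a. {w. - a \<bullet> w \<le> 0}) ` A \<union> (\<lambda>a. {w. a \<bullet> w \<le> 0}) ` {a \<in> A. u \<bullet> a = 0})"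
      by (simp add: cone_face_def half_space_cone_def ball_Un inner_commute) blast
  qed
  show ?thesis unfolding e
  proof (rule polyhedron_Inter)
    fix S assume "S \<in> (\<lambda>a. {w. - a \<bullet> w \<le> 0}) ` A \<union> (\<lambda>a. {w. a \<bullet> w \<le> 0}) ` {a \<in> A. u \<bullet> a = 0}"
    then show "polyhedron S" using polyhedron_halfspace_le by blast
  qed (use assms in simp)
qed

text \<open>
A point of the face is approached by adding small multiples of \<open>u\<close>, which is strictly positive on all
inequalities that are not equalities on the face.
\<close>

lemma closure_sign_class:
  assumes u: "u \<in> half_space_cone A"
  shows "closure {w \<in> half_space_cone A. \<forall>a\<in>A. u \<bullet> a = 0 \<longleftrightarrow> w \<bullet> a = 0} = cone_face A u" (is "closure ?C = _")
proof
  have "closed (cone_face A u)"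
  proof -
    have "cone_face A u = half_space_cone A \<inter> (\<Inter>a\<in>{a \<in> A. u \<bullet> a = 0}. {w. w \<bullet> a = 0})"
      by (auto simp: cone_face_def)
    then show ?thesis
      by (auto intro!: closed_Int closed_half_space_cone closed_INT closed_Collect_eq continuous_intros)
  qed
  then show "closure ?C \<subseteq> cone_face A u" by (intro closure_minimal) (auto simp: cone_face_def)
  show "cone_face A u \<subseteq> closure ?C"
  proof
    fix w assume w: "w \<in> cone_face A u"
    have pos: "0 \<le> u \<bullet> a" "0 \<le> w \<bullet> a" if "a \<in> A" for a
      using u w that by (auto simp: cone_face_def half_space_cone_def)
    have "w + (1 / real (Suc m)) *\<^sub>R u \<in> ?C" for m
    proof (intro CollectI conjI ballI)
      show "w + (1 / real (Suc m)) *\<^sub>R u \<in> half_space_cone A"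
        using pos by (auto simp: half_space_cone_def inner_add_left)
      fix a assume a: "a \<in> A"
      show "u \<bullet> a = 0 \<longleftrightarrow> (w + (1 / real (Suc m)) *\<^sub>R u) \<bullet> a = 0"
      proof
        assume "u \<bullet> a = 0"
        then show "(w + (1 / real (Suc m)) *\<^sub>R u) \<bullet> a = 0"
          using w a by (simp add: cone_face_def inner_add_left)
      next
        assume 0: "(w + (1 / real (Suc m)) *\<^sub>R u) \<bullet> a = 0"
        have "0 \<le> (1 / real (Suc m)) * (u \<bullet> a)" using pos(1)[OF a] by simp
        then have "(1 / real (Suc m)) * (u \<bullet> a) = 0"
          using 0 pos(2)[OF a] unfolding inner_add_left inner_scaleR_left by linarith
        then show "u \<bullet> a = 0" by simp
      qed
    qed
    moreover have "(\<lambda>m. w + (1 / real (Suc m)) *\<^sub>R u) \<longlonglongrightarrow> w + 0 *\<^sub>R u"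
      using LIMSEQ_inverse_real_of_nat by (intro tendsto_intros) (simp add: inverse_eq_divide)
    ultimately show "w \<in> closure ?C"
      unfolding closure_sequential by (intro exI[of _ "\<lambda>m. w + (1 / real (Suc m)) *\<^sub>R u"]) simp
  qed
qed

lemma cone_face_mono: "w \<in> cone_face A u \<Longrightarrow> cone_face A w \<subseteq> cone_face A u"
  by (auto simp: cone_face_def)

lemma cone_face_face_of:
  assumes w: "w \<in> cone_face A u" shows "cone_face A w face_of cone_face A u"
  unfolding face_of_def
proof (intro conjI ballI impI)
  show "cone_face A w \<subseteq> cone_face A u" by (rule cone_face_mono[OF w])
  show "convex (cone_face A w)"
    unfolding cone_face_def convex_def half_space_cone_def by (simp add: inner_add_left)
  fix x y z assume xyz: "x \<in> cone_face A u" "y \<in> cone_face A u" "z \<in> cone_face A w" "z \<in> open_segment x y"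
  have "x \<bullet> a = 0 \<and> y \<bullet> a = 0" if a: "a \<in> A" "w \<bullet> a = 0" for a
  proof -
    obtain t where t: "0 < t" "t < 1" "z = (1 - t) *\<^sub>R x + t *\<^sub>R y"
      using xyz(4) by (auto simp: in_segment)
    have "(1 - t) * (x \<bullet> a) + t * (y \<bullet> a) = 0"
      using xyz(3) a by (simp add: cone_face_def t(3) inner_add_left)
    moreover have "0 \<le> (1 - t) * (x \<bullet> a)" "0 \<le> t * (y \<bullet> a)"
      using xyz(1,2) a(1) t(1,2) by (auto simp: cone_face_def half_space_cone_def)
    ultimately have "(1 - t) * (x \<bullet> a) = 0" "t * (y \<bullet> a) = 0" by linarith+
    then show ?thesis using t(1,2) by auto
  qed
  then show "x \<in> cone_face A w" "y \<in> cone_face A w" using xyz(1,2) by (auto simp: cone_face_def)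
qed

text \<open>
From any point of \<open>D\<close> one can prolong the segment beyond \<open>w\<close> inside \<open>D\<close>. So an inequality that is tight
at \<open>w\<close> is tight on all of \<open>D\<close>.
\<close>

lemma subset_cone_face_if_rel_interior:
  assumes D: "convex D" "D \<subseteq> half_space_cone A" and w: "w \<in> rel_interior D"
  shows "D \<subseteq> cone_face A w"
proof
  fix x assume x: "x \<in> D"
  have "D \<noteq> {}" using x by blast
  then obtain e where e: "e > 1" "(1 - e) *\<^sub>R x + e *\<^sub>R w \<in> D"
    using w x convex_rel_interior_iff[OF D(1)] by blast
  have "x \<bullet> a = 0" if a: "a \<in> A" "w \<bullet> a = 0" for a
  proof -
    have "0 \<le> ((1 - e) *\<^sub>R x + e *\<^sub>R w) \<bullet> a" using e(2) D(2) a(1) by (auto simp: half_space_cone_def)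
    then have "0 \<le> (1 - e) * (x \<bullet> a)" using a(2) by (simp add: inner_add_left)
    moreover have "0 \<le> x \<bullet> a" using x D(2) a(1) by (auto simp: half_space_cone_def)
    ultimately show ?thesis using e(1) by (simp add: zero_le_mult_iff)
  qed
  then show "x \<in> cone_face A w" using x D(2) by (auto simp: cone_face_def)
qed

text \<open>
A point of the cone at which all inequalities tight at \<open>w\<close> are tight can be joined to \<open>w\<close> by a segment
that extends a little beyond \<open>w\<close>. A face through \<open>w\<close> has to contain such a segment.
\<close>

lemma face_of_cone_face:
  assumes fin: "finite A" and D: "D face_of cone_face A u" and w: "w \<in> rel_interior D"
  shows "D = cone_face A w"
proof
  have cD: "convex D" and sub: "D \<subseteq> cone_face A u"
    by (rule face_of_imp_convex[OF D], rule face_of_imp_subset[OF D])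
  then show "D \<subseteq> cone_face A w"
    by (intro subset_cone_face_if_rel_interior w) (auto simp: cone_face_def)
  have wD: "w \<in> D" using w rel_interior_subset by blast
  show "cone_face A w \<subseteq> D"
  proof
    fix x assume x: "x \<in> cone_face A w"
    show "x \<in> D"
    proof (cases "x = w")
      case False
      have wu: "w \<in> cone_face A u" using wD sub by blast
      have "\<forall>\<^sub>F \<epsilon> in at_right (0::real). \<forall>a\<in>A. 0 \<le> (w + \<epsilon> *\<^sub>R (w - x)) \<bullet> a"
        unfolding eventually_ball_finite_distrib[OF fin]
      proof
        fix a assume a: "a \<in> A"
        show "\<forall>\<^sub>F \<epsilon> in at_right (0::real). 0 \<le> (w + \<epsilon> *\<^sub>R (w - x)) \<bullet> a"
        proof (cases "w \<bullet> a = 0")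
          case True
          then have "x \<bullet> a = 0" using x a by (simp add: cone_face_def)
          then show ?thesis using True by (simp add: inner_add_left inner_diff_left)
        next
          case False
          then have "0 < w \<bullet> a" using wu a by (force simp: cone_face_def half_space_cone_def less_le)
          moreover have "((\<lambda>\<epsilon>. (w + \<epsilon> *\<^sub>R (w - x)) \<bullet> a) \<longlongrightarrow> (w + 0 *\<^sub>R (w - x)) \<bullet> a) (at_right (0::real))"
            by (intro tendsto_intros)
          ultimately have "\<forall>\<^sub>F \<epsilon> in at_right (0::real). 0 < (w + \<epsilon> *\<^sub>R (w - x)) \<bullet> a"
            by (intro order_tendstoD(1)) auto
          then show ?thesis by eventually_elim simp
        qed
      qed
      moreover have "\<forall>\<^sub>F \<epsilon> in at_right (0::real). 0 < \<epsilon>" by (rule eventually_at_right_less)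
      ultimately have "\<forall>\<^sub>F \<epsilon> in at_right (0::real). 0 < \<epsilon> \<and> (\<forall>a\<in>A. 0 \<le> (w + \<epsilon> *\<^sub>R (w - x)) \<bullet> a)"
        by eventually_elim simp
      then obtain \<epsilon> :: real where \<epsilon>: "0 < \<epsilon>" "\<And>a. a \<in> A \<Longrightarrow> 0 \<le> (w + \<epsilon> *\<^sub>R (w - x)) \<bullet> a"
        using eventually_happens'[of "at_right (0::real)"] trivial_limit_at_right_real by blast
      \<comment> \<open>\<open>y\<close> prolongs the segment from \<open>x\<close> beyond \<open>w\<close> within the face, so \<open>w\<close> lies strictly between them\<close>
      define y where "y = w + \<epsilon> *\<^sub>R (w - x)"
      have "y \<bullet> a = 0" if "a \<in> A" "u \<bullet> a = 0" for a
        using that wu x by (simp add: cone_face_def y_def inner_add_left inner_diff_left)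
      then have y: "y \<in> cone_face A u" using \<epsilon>(2) by (auto simp: cone_face_def half_space_cone_def y_def)
      have xu: "x \<in> cone_face A u" using x cone_face_mono[OF wu] by blast
      have "w \<in> open_segment x y"
      proof -
        have "y \<noteq> x"
        proof
          assume "y = x"
          then have "(1 + \<epsilon>) *\<^sub>R (w - x) = 0" by (simp add: y_def algebra_simps)
          then show False using \<epsilon>(1) False by simp
        qed
        moreover have "w = (1 - 1 / (1 + \<epsilon>)) *\<^sub>R x + (1 / (1 + \<epsilon>)) *\<^sub>R y"
        proof -
          have "(1 / (1 + \<epsilon>)) *\<^sub>R y = w - (\<epsilon> / (1 + \<epsilon>)) *\<^sub>R x"
          proof -
            have "y = (1 + \<epsilon>) *\<^sub>R w - \<epsilon> *\<^sub>R x" by (simp add: y_def algebra_simps)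
            then show ?thesis using \<epsilon>(1) by (simp add: scaleR_diff_right)
          qed
          moreover have "1 - 1 / (1 + \<epsilon>) = \<epsilon> / (1 + \<epsilon>)" using \<epsilon>(1) by (simp add: field_simps)
          ultimately show ?thesis by simp
        qed
        ultimately show ?thesis unfolding in_segment
          using \<epsilon>(1) by (intro conjI exI[of _ "1 / (1 + \<epsilon>)"]) auto
      qed
      then show ?thesis using D xu y wD unfolding face_of_def by blast
    qed (use wD in simp)
  qed
qed

text \<open>
Each closed class is a face of every cone containing its representative, whichever member of \<open>\<A>\<close>
defines this cone. The intersection of two closed classes is convex and, together with a point \<open>w\<close> of
its relative interior, contains the closed class of \<open>w\<close>; conversely, the inequalities that are
tight at \<open>w\<close> are tight on the whole intersection. So the intersection is a closed class itself, and
a face of both.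
\<close>

theorem polyhedral_fan_of_sign_classes:
  fixes \<A> :: "'a::euclidean_space set set" and cls :: "'a \<Rightarrow> 'a set"
  assumes fin\<A>: "finite \<A>" and finA: "\<And>A. A \<in> \<A> \<Longrightarrow> finite A"
    and cover: "\<And>u. u \<in> U \<Longrightarrow> \<exists>A\<in>\<A>. u \<in> half_space_cone A"
    and cls: "\<And>A u. A \<in> \<A> \<Longrightarrow> u \<in> half_space_cone A \<Longrightarrow>
                cls u = {w \<in> half_space_cone A. \<forall>a\<in>A. u \<bullet> a = 0 \<longleftrightarrow> w \<bullet> a = 0}"
    and X: "X \<subseteq> U" "\<And>u. u \<in> X \<Longrightarrow> closure (cls u) \<subseteq> X"
  shows "polyhedral_fan {closure (cls u) | u. u \<in> X}" "X = \<Union>{closure (cls u) | u. u \<in> X}"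
proof -
  have clo: "closure (cls u) = cone_face A u" if "A \<in> \<A>" "u \<in> half_space_cone A" for A u
    unfolding cls[OF that] by (rule closure_sign_class[OF that(2)])
  have self: "u \<in> closure (cls u)" if u: "u \<in> U" for u
  proof -
    obtain A where A: "A \<in> \<A>" "u \<in> half_space_cone A" using cover[OF u] by blast
    show ?thesis unfolding clo[OF A] using A(2) by (simp add: cone_face_def)
  qed
  show "X = \<Union>{closure (cls u) | u. u \<in> X}" using X self by blast
  show "polyhedral_fan {closure (cls u) | u. u \<in> X}"
    unfolding polyhedral_fan_def
  proof (intro conjI ballI allI impI)
    let ?Z = "\<lambda>(A, Z). {w \<in> half_space_cone A. \<forall>a\<in>Z. w \<bullet> a = 0}"
    have "{closure (cls u) | u. u \<in> X} \<subseteq> ?Z ` (SIGMA A:\<A>. Pow A)"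
    proof clarify
      fix u assume "u \<in> X"
      then have "u \<in> U" using X(1) by blast
      then obtain A where A: "A \<in> \<A>" "u \<in> half_space_cone A" using cover by blast
      have "closure (cls u) = ?Z (A, {a \<in> A. u \<bullet> a = 0})" unfolding clo[OF A] by (auto simp: cone_face_def)
      moreover have "(A, {a \<in> A. u \<bullet> a = 0}) \<in> (SIGMA A:\<A>. Pow A)" using A(1) by auto
      ultimately show "closure (cls u) \<in> ?Z ` (SIGMA A:\<A>. Pow A)" by (rule image_eqI)
    qed
    moreover have "finite (SIGMA A:\<A>. Pow A)" using fin\<A> finA by (intro finite_SigmaI) auto
    ultimately show "finite {closure (cls u) | u. u \<in> X}" by (meson finite_imageI finite_subset)
  next
    fix C assume "C \<in> {closure (cls u) | u. u \<in> X}"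
    then obtain u where u: "u \<in> X" "C = closure (cls u)" by blast
    then obtain A where A: "A \<in> \<A>" "u \<in> half_space_cone A" using cover X(1) by blast
    have C: "C = cone_face A u" using u(2) clo[OF A] by simp
    show "polyhedron C" unfolding C by (rule polyhedron_cone_face[OF finA[OF A(1)]])
    show "cone C" unfolding C cone_def by (auto simp: cone_face_def half_space_cone_def)
    show "C \<noteq> {}" using self u X(1) by blast
    fix D assume D: "D face_of C \<and> D \<noteq> {}"
    then have "convex D" by (intro face_of_imp_convex[of D C]) simp
    then obtain w where w: "w \<in> rel_interior D" using D rel_interior_eq_empty by blast
    have "D = cone_face A w"
      by (rule face_of_cone_face[OF finA[OF A(1)] _ w, of u]) (use D C in simp)
    moreover have wC: "w \<in> C"
      using subsetD[OF rel_interior_subset w] face_of_imp_subset[OF conjunct1[OF D]] by (rule rev_subsetD)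
    then have "w \<in> half_space_cone A" by (simp add: C cone_face_def)
    ultimately have "D = closure (cls w)" using clo[OF A(1)] by simp
    moreover have "w \<in> X" using X(2)[OF u(1)] wC u(2) by blast
    ultimately show "D \<in> {closure (cls u) | u. u \<in> X}" by blast
  next
    fix C C' assume "C \<in> {closure (cls u) | u. u \<in> X}" "C' \<in> {closure (cls u) | u. u \<in> X}"
    then obtain u u' where u: "u \<in> X" "C = closure (cls u)" "u' \<in> X" "C' = closure (cls u')" by blast
    obtain A A' where A: "A \<in> \<A>" "u \<in> half_space_cone A" "A' \<in> \<A>" "u' \<in> half_space_cone A'"
      using cover[OF subsetD[OF X(1) u(1)]] cover[OF subsetD[OF X(1) u(3)]] by blast
    have C: "C = cone_face A u" "C' = cone_face A' u'" using u clo A by simp_all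
    have "convex (C \<inter> C')"
      unfolding C
      by (intro convex_Int polyhedron_imp_convex polyhedron_cone_face finA A(1) A(3))
    moreover have "0 \<in> C \<inter> C'" unfolding C by (simp add: cone_face_def half_space_cone_def)
    ultimately obtain w where w: "w \<in> rel_interior (C \<inter> C')"
      using rel_interior_eq_empty by blast
    then have wC: "w \<in> cone_face A u" "w \<in> cone_face A' u'" using rel_interior_subset C by blast+
    then have wA: "w \<in> half_space_cone A" "w \<in> half_space_cone A'" by (simp_all add: cone_face_def)
    have ww: "cone_face A w = cone_face A' w"
      using clo[OF A(1) wA(1)] clo[OF A(3) wA(2)] by simp
    have "C \<inter> C' \<subseteq> cone_face A w"
      by (rule subset_cone_face_if_rel_interior[OF \<open>convex (C \<inter> C')\<close> _ w]) (auto simp: C cone_face_def)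
    moreover have "cone_face A w \<subseteq> C" unfolding C by (rule cone_face_mono[OF wC(1)])
    moreover have "cone_face A w \<subseteq> C'" unfolding C ww by (rule cone_face_mono[OF wC(2)])
    ultimately have "C \<inter> C' = cone_face A w" by blast
    then show "C \<inter> C' face_of C" "C \<inter> C' face_of C'"
      using cone_face_face_of[OF wC(1)] cone_face_face_of[OF wC(2)] ww C by simp_all
  qed
qed

section \<open>The local tropical variety\<close>

text \<open>
The orders of points of the torus are exactly the rational vectors. This covers series with zero
truncation, which impose no condition.
\<close>

lemma torus_orders_dense: "w \<in> closure (ord_vec ` {v :: puiseux ^ 'n::finite. \<forall>i. v $ i \<noteq> 0})"
proof -
  obtain W where W: "W \<longlonglongrightarrow> w" "\<And>m. \<exists>N>0. \<exists>k. \<forall>i. W m $ i = real_of_int (k i) / real N"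
    using rational_approximation_keeping_relations[of w] by blast
  have "W m \<in> ord_vec ` {v :: puiseux ^ 'n. \<forall>i. v $ i \<noteq> 0}" for m
  proof -
    obtain N k where Nk: "N > 0" "\<And>i. W m $ i = real_of_int (k i) / real N" using W(2) by blast
    define v :: "puiseux ^ 'n" where "v = (\<chi> i. puiseux_of N (fls_X_intpow (k i)))"
    have "ord_vec v = W m"
      using Nk by (simp add: ord_vec_def v_def vec_eq_iff puiseux_ord_of of_rat_divide)
    moreover have "v $ i \<noteq> 0" for i using Nk(1) by (simp add: v_def puiseux_of_eq_0)
    ultimately show ?thesis by (intro image_eqI[of _ _ v]) auto
  qed
  then show ?thesis using W(1) unfolding closure_sequential by blast
qed

lemma min_gens_eq_min_exps: "min_gens J f = min_exps (proj J ` supp f)"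
  using min_gens_is_min_gens[of J f] by (simp add: min_gens_unique min_exps_def)

lemma wdot_proj: "w \<in> stratum J \<Longrightarrow> wdot w (proj J \<alpha>) = wdot w \<alpha>"
  unfolding wdot_def by (intro sum.cong) (auto simp: stratum_def proj_def)

lemma stratum_subset_U_loc: "stratum J \<subseteq> U_loc"
  unfolding stratum_def U_loc_def by (auto simp: less_le) (metis order_refl less_imp_le)

text \<open>
On the stratum of \<open>J\<close> the weight is strictly monotone on exponents projected along \<open>J\<close>. Therefore an
exponent of minimal weight lies over a minimal generator.
\<close>

lemma wdot_proj_strict:
  assumes w: "w \<in> stratum J" and le: "proj J \<alpha> \<le> proj J \<beta>" "wdot w \<beta> \<le> wdot w \<alpha>"
  shows "proj J \<alpha> = proj J \<beta>"
proof -
  have U: "w \<in> U_loc" using w stratum_subset_U_loc by blast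
  let ?d = "proj J \<beta> - proj J \<alpha>"
  have e: "proj J \<alpha> + ?d = proj J \<beta>" by (rule exponent_diff(1)[OF le(1)])
  have "wdot w (proj J \<beta>) = wdot w (proj J \<alpha>) + wdot w ?d"
    using wdot_add[of w "proj J \<alpha>" ?d] e by simp
  moreover have "0 \<le> wdot w ?d" using U by (auto simp: wdot_def U_loc_def intro: sum_nonneg)
  ultimately have "wdot w ?d = 0" using le(2) by (simp add: wdot_proj[OF w])
  then have "\<forall>i. w $ i = 0 \<or> ?d $ i = 0" using wdot_eq_0_iff[OF U, of ?d] by simp
  moreover have "w $ i \<noteq> 0" if "i \<notin> J" for i using w that by (force simp: stratum_def)
  ultimately have "?d $ i = 0" for i
    by (cases "i \<in> J") (simp add: proj_def, blast)
  then have "?d = 0" by (simp add: vec_eq_iff)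
  then show ?thesis using e by simp
qed

lemma supp_f_hat:
  assumes "admissible_choice A" "J \<noteq> UNIV"
  shows "supp (f_hat A J f) = (\<Union>\<beta>\<in>min_gens J f. A f J \<beta>)" "supp (f_hat A J f) \<subseteq> supp f"
    "\<alpha> \<in> supp (f_hat A J f) \<Longrightarrow> f_hat A J f \<alpha> = f \<alpha>"
proof -
  have "A f J \<beta> \<subseteq> fibre J f \<beta>" if "\<beta> \<in> min_gens J f" for \<beta>
    using assms that unfolding admissible_choice_def by (metis order_refl)
  then have "(\<Union>\<beta>\<in>min_gens J f. A f J \<beta>) \<subseteq> supp f" by (force simp: fibre_def)
  then show "supp (f_hat A J f) = (\<Union>\<beta>\<in>min_gens J f. A f J \<beta>)" "supp (f_hat A J f) \<subseteq> supp f"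
    "\<alpha> \<in> supp (f_hat A J f) \<Longrightarrow> f_hat A J f \<alpha> = f \<alpha>"
    using assms(2) by (auto simp: supp_def f_hat_def)
qed

text \<open>
A leading exponent of \<open>f\<close> is the only point of its fibre, so it survives in the truncation, where it is
again leading. Otherwise two exponents of \<open>f\<close> tie. If they have different projections, the truncation
contains a term of minimal weight over each of the two generators; if they have the same projection,
the fibre has at least two elements and the truncation contains two of them.
\<close>

lemma stratum_hypersurface:
  assumes A: "admissible_choice A" and J: "J \<noteq> UNIV" and w: "w \<in> stratum J"
  shows "w \<in> closure (ord_vec ` torus_zeros (f_hat A J f)) \<longleftrightarrow> (\<nexists>\<alpha>. lead_at w f \<alpha>)"
proof
  assume cl: "w \<in> closure (ord_vec ` torus_zeros (f_hat A J f))"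
  show "\<nexists>\<alpha>. lead_at w f \<alpha>"
  proof
    assume "\<exists>\<alpha>. lead_at w f \<alpha>"
    then obtain \<alpha> where a: "\<alpha> \<in> supp f" "\<And>\<beta>. \<beta> \<in> supp f \<Longrightarrow> \<beta> \<noteq> \<alpha> \<Longrightarrow> wdot w \<alpha> < wdot w \<beta>"
      by (auto simp: lead_at_def)
    have min: "\<beta> = \<alpha>" if "\<beta> \<in> supp f" "wdot w \<beta> \<le> wdot w \<alpha>" for \<beta>
      using a(2)[OF that(1)] that(2) by force
    have "proj J \<alpha> \<in> min_gens J f"
      unfolding min_gens_eq_min_exps min_exps_def
    proof (intro CollectI conjI ballI impI)
      show "proj J \<alpha> \<in> proj J ` supp f" using a(1) by blast
      fix \<gamma> assume "\<gamma> \<in> proj J ` supp f" and le: "\<gamma> \<le> proj J \<alpha>"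
      then obtain \<beta> where b: "\<beta> \<in> supp f" "\<gamma> = proj J \<beta>" by blast
      have U: "w \<in> U_loc" using w stratum_subset_U_loc by blast
      have "wdot w \<beta> \<le> wdot w \<alpha>"
        using wdot_mono[OF U le] unfolding b(2) wdot_proj[OF w] .
      then show "\<gamma> = proj J \<alpha>" using min[OF b(1)] b(2) by simp
    qed
    moreover have fib: "fibre J f (proj J \<alpha>) = {\<alpha>}"
    proof -
      have "\<beta> = \<alpha>" if "\<beta> \<in> supp f" "proj J \<beta> = proj J \<alpha>" for \<beta>
        using min[OF that(1)] wdot_proj[OF w, of \<beta>] wdot_proj[OF w, of \<alpha>] that(2) by simp
      then show ?thesis using a(1) by (auto simp: fibre_def)
    qed
    ultimately have "A f J (proj J \<alpha>) = {\<alpha>}"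
      using A J unfolding admissible_choice_def by (metis is_singletonI)
    then have "\<alpha> \<in> supp (f_hat A J f)"
      using supp_f_hat(1)[OF A J] \<open>proj J \<alpha> \<in> min_gens J f\<close> by blast
    then have "w \<notin> closure (ord_vec ` torus_zeros (f_hat A J f))"
      using a(2) supp_f_hat(2)[OF A J]
      by (intro unique_min_not_tropical[OF finite_supp_f_hat[OF A]]) auto
    then show False using cl by blast
  qed
next
  assume nl: "\<nexists>\<alpha>. lead_at w f \<alpha>"
  have U: "w \<in> U_loc" using w stratum_subset_U_loc by blast
  show "w \<in> closure (ord_vec ` torus_zeros (f_hat A J f))"
  proof (cases "supp f = {}")
    case True
    then have "supp (f_hat A J f) = {}" using supp_f_hat(2)[OF A J, of f] by simp
    then have "torus_zeros (f_hat A J f) = {v. \<forall>i. v $ i \<noteq> 0}"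
      by (auto simp: torus_zeros_def poly_eval_def)
    then show ?thesis using torus_orders_dense by simp
  next
    case False
    obtain \<alpha> where a: "\<alpha> \<in> supp f" "\<And>\<beta>. \<beta> \<in> supp f \<Longrightarrow> wdot w \<alpha> \<le> wdot w \<beta>"
      using wei_attained[OF U False] by metis
    then obtain \<alpha>' where a': "\<alpha>' \<in> supp f" "\<alpha>' \<noteq> \<alpha>" "wdot w \<alpha>' = wdot w \<alpha>"
      using nl unfolding lead_at_def by (metis antisym not_less)
    have mg: "proj J \<beta> \<in> min_gens J f" if b: "\<beta> \<in> supp f" "wdot w \<beta> = wdot w \<alpha>" for \<beta>
      unfolding min_gens_eq_min_exps min_exps_def
      using b a(2) by (auto intro!: wdot_proj_strict[OF w])
    have sub: "A f J \<beta> \<subseteq> fibre J f \<beta>" and ne: "A f J \<beta> \<noteq> {}"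
      and two: "\<not> is_singleton (fibre J f \<beta>) \<Longrightarrow> card (A f J \<beta>) = 2"
      if "\<beta> \<in> min_gens J f" for \<beta>
    proof -
      have ch: "if is_singleton (fibre J f \<beta>) then A f J \<beta> = fibre J f \<beta>
          else A f J \<beta> \<subseteq> fibre J f \<beta> \<and> card (A f J \<beta>) = 2"
        using A J that unfolding admissible_choice_def by blast
      then show "A f J \<beta> \<subseteq> fibre J f \<beta>" by (auto split: if_splits)
      show "\<not> is_singleton (fibre J f \<beta>) \<Longrightarrow> card (A f J \<beta>) = 2" using ch by simp
      show "A f J \<beta> \<noteq> {}" using ch by (auto split: if_splits simp: is_singleton_def)
    qed
    have "\<exists>\<delta> \<delta>'. \<delta> \<noteq> \<delta>' \<and> \<delta> \<in> A f J (proj J \<alpha>) \<and> \<delta>' \<in> A f J (proj J \<alpha>')"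
    proof (cases "proj J \<alpha> = proj J \<alpha>'")
      case True
      have "\<alpha> \<in> fibre J f (proj J \<alpha>)" "\<alpha>' \<in> fibre J f (proj J \<alpha>)" using True a(1) a'(1) by (auto simp: fibre_def)
      then have "\<not> is_singleton (fibre J f (proj J \<alpha>))" using a'(2) by (auto simp: is_singleton_def)
      then have "card (A f J (proj J \<alpha>)) = 2" by (rule two[OF mg[OF a(1) refl]])
      then show ?thesis using True by (auto simp: card_2_iff)
    next
      case False
      have m: "proj J \<alpha> \<in> min_gens J f" "proj J \<alpha>' \<in> min_gens J f" using mg a(1) a'(1,3) by auto
      obtain \<delta> \<delta>' where d: "\<delta> \<in> A f J (proj J \<alpha>)" "\<delta>' \<in> A f J (proj J \<alpha>')" using ne m by blast
      then have "proj J \<delta> = proj J \<alpha>" "proj J \<delta>' = proj J \<alpha>'" using sub[OF m(1)] sub[OF m(2)] by (auto simp: fibre_def)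
      then show ?thesis using d False by metis
    qed
    then obtain \<delta> \<delta>' where d: "\<delta> \<noteq> \<delta>'" "\<delta> \<in> A f J (proj J \<alpha>)" "\<delta>' \<in> A f J (proj J \<alpha>')" by blast
    have "proj J \<alpha> \<in> min_gens J f" "proj J \<alpha>' \<in> min_gens J f" using mg a(1) a'(1,3) by auto
    then have s: "\<delta> \<in> supp (f_hat A J f)" "\<delta>' \<in> supp (f_hat A J f)"
      and "proj J \<delta> = proj J \<alpha>" "proj J \<delta>' = proj J \<alpha>'"
      using d sub unfolding supp_f_hat(1)[OF A J] by (auto simp: fibre_def)
    then have "wdot w \<delta> = wdot w \<alpha>" "wdot w \<delta>' = wdot w \<alpha>'"
      using wdot_proj[OF w, of \<delta>] wdot_proj[OF w, of \<delta>'] wdot_proj[OF w, of \<alpha>] wdot_proj[OF w, of \<alpha>'] by simp_all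
    then show ?thesis
      using two_minimizers_tropical[OF finite_supp_f_hat[OF A] s d(1), of w] a(2) a'(3) supp_f_hat(2)[OF A J, of f]
      by auto
  qed
qed

context pow_ideal
begin

definition monomial_free_weights :: "(real ^ 'n) set" where
  "monomial_free_weights = {w \<in> U_loc. \<not> (\<exists>m\<in>in_ideal w I. is_monomial m)}"

lemma monomial_free_weights_iff:
  "w \<in> monomial_free_weights \<longleftrightarrow> w \<in> U_loc \<and> (\<forall>g\<in>I. \<nexists>\<alpha>. lead_at w g \<alpha>)"
  using monomial_in_in_ideal_iff[of w] unfolding monomial_free_weights_def lead_at_def by blast

text \<open>
The strata are disjoint, so only the truncations belonging to \<open>J\<close> matter for \<open>w\<close>.
\<close>

lemma T_loc_stratum:
  assumes A: "admissible_choice A" and J: "J \<noteq> UNIV" and w: "w \<in> stratum J"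
  shows "w \<in> T_loc A I \<longleftrightarrow> w \<in> monomial_free_weights"
proof -
  have "J' = J" if "w \<in> stratum J'" for J'
    using w that unfolding stratum_def by (auto; metis less_irrefl)
  then have "w \<in> T_loc A I \<longleftrightarrow> (\<forall>f\<in>I. w \<in> closure (ord_vec ` torus_zeros (f_hat A J f)))"
    using w unfolding T_loc_def by blast
  then show ?thesis
    using w stratum_subset_U_loc by (auto simp: stratum_hypersurface[OF A J w] monomial_free_weights_iff)
qed

lemma U_loc_strata: "w \<in> U_loc \<Longrightarrow> w \<in> stratum {i. w $ i = 0}"
  by (auto simp: U_loc_def stratum_def less_le)

lemma T_loc_subset_U_loc: "T_loc A I \<subseteq> U_loc"
  unfolding T_loc_def using stratum_subset_U_loc by blast

text \<open>
The stratum of all variables is \<open>{0}\<close> and its truncations vanish, so the origin is always included.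
\<close>

lemma T_loc_eq:
  assumes A: "admissible_choice A"
  shows "T_loc A I = insert 0 monomial_free_weights"
proof (rule Set.set_eqI)
  fix w
  show "w \<in> T_loc A I \<longleftrightarrow> w \<in> insert 0 monomial_free_weights"
  proof (cases "w \<in> U_loc \<and> w \<noteq> 0")
    case True
    then have "{i. w $ i = 0} \<noteq> UNIV" by (auto simp: vec_eq_iff)
    then show ?thesis using T_loc_stratum[OF A _ U_loc_strata] True by blast
  next
    case False
    then show ?thesis using T_loc_subset_U_loc[of A] zero_in_T_loc[of A I]
      by (auto simp: monomial_free_weights_def)
  qed
qed

lemma closed_U_loc: "closed (U_loc :: (real ^ 'n) set)"
proof -
  have e: "(U_loc :: (real ^ 'n) set) = (\<Inter>i. {u. 0 \<le> u $ i})" by (auto simp: U_loc_def)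
  show ?thesis unfolding e by (auto intro!: closed_INT closed_Collect_le continuous_intros)
qed

text \<open>
If \<open>g \<in> I\<close> has a leading exponent for a limit weight \<open>w\<close>, then also for all weights of the orthant near
\<open>w\<close>, possibly with more positive coordinates: only the finitely many minimal other exponents have to
be kept above it. Among these weights there are members of the class.
\<close>

lemma closure_class_monomial_free:
  assumes u: "u \<in> monomial_free_weights"
  shows "closure (groebner_class I u) \<subseteq> monomial_free_weights"
proof
  fix w assume w: "w \<in> closure (groebner_class I u)"
  have "closure (groebner_class I u) \<subseteq> U_loc"
    by (rule closure_minimal[OF _ closed_U_loc]) (auto simp: groebner_class_def)
  then have wU: "w \<in> U_loc" using w by blast
  show "w \<in> monomial_free_weights"
  proof (rule ccontr)
    assume "w \<notin> monomial_free_weights"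
    then obtain g \<alpha> where g: "g \<in> I" "lead_at w g \<alpha>" using wU by (auto simp: monomial_free_weights_iff)
    define B where "B = min_exps (supp g - {\<alpha>})"
    have "finite B" by (simp add: B_def finite_min_exps)
    moreover have "wdot w \<alpha> < wdot w \<beta>" if "\<beta> \<in> B" for \<beta>
      using g(2) that min_exps_subset[of "supp g - {\<alpha>}"] by (auto simp: B_def lead_at_def)
    ultimately obtain V where V: "open V" "w \<in> V" "\<And>u \<beta>. u \<in> V \<Longrightarrow> \<beta> \<in> B \<Longrightarrow> wdot u \<alpha> < wdot u \<beta>"
      using strict_min_nhd[of B w \<alpha>] by blast
    have "V \<inter> groebner_class I u \<noteq> {}"
      using w V(2) open_Int_closure_eq_empty[OF V(1), of "groebner_class I u"] by blast
    then obtain u' where u': "u' \<in> V" "u' \<in> U_loc" "loc_equiv I u u'" by (auto simp: groebner_class_def)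
    have "lead_at u' g \<alpha>"
      unfolding lead_at_def
    proof (intro conjI ballI impI)
      show "\<alpha> \<in> supp g" using g(2) by (simp add: lead_at_def)
      fix \<beta> assume "\<beta> \<in> supp g" "\<beta> \<noteq> \<alpha>"
      then obtain \<beta>0 where b: "\<beta>0 \<in> B" "\<beta>0 \<le> \<beta>"
        unfolding B_def using min_exps_below[of \<beta> "supp g - {\<alpha>}"] by blast
      then show "wdot u' \<alpha> < wdot u' \<beta>" using V(3)[OF u'(1) b(1)] wdot_mono[OF u'(2) b(2)] by linarith
    qed
    then have "u' \<notin> monomial_free_weights" using g(1) by (auto simp: monomial_free_weights_iff)
    moreover have "u' \<in> monomial_free_weights"
      using u u'(2,3) by (simp add: monomial_free_weights_def loc_equiv_def)
    ultimately show False by blast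
  qed
qed

text \<open>
Stated for any set of weights that contains the closed class of each of its elements, in order to cover
the one-point set \<open>{0}\<close> of the degenerate case as well.
\<close>

theorem is_subfan_LGF:
  assumes X: "X \<subseteq> U_loc" "\<And>u. u \<in> X \<Longrightarrow> closure (groebner_class I u) \<subseteq> X"
  shows "is_subfan X (LGF I)"
proof -
  let ?\<A> = "cone_ineqs ` {lead_exps v I | v. generic v}"
  let ?S = "{closure (groebner_class I u) | u. u \<in> X}"
  have fin: "finite ?\<A>" using finite_lead_exps by (rule finite_imageI)
  have finA: "finite A" if "A \<in> ?\<A>" for A using that finite_cone_ineqs by blast
  have cover: "\<exists>A\<in>?\<A>. u \<in> half_space_cone A" if "u \<in> U_loc" for u
    using compatible_covering[OF that] half_space_cone_eq_compatible by blast
  have cls: "groebner_class I u = {w \<in> half_space_cone A. \<forall>a\<in>A. u \<bullet> a = 0 \<longleftrightarrow> w \<bullet> a = 0}"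
    if A: "A \<in> ?\<A>" "u \<in> half_space_cone A" for A u
  proof -
    obtain v E where v: "generic v" "E = lead_exps v I" "A = cone_ineqs E" using A(1) by blast
    then have u: "compatible E u" using A(2) by (simp add: half_space_cone_eq_compatible)
    have "w \<in> U_loc" if "compatible E w" for w using that by (simp add: compatible_def)
    then show ?thesis
      unfolding groebner_class_def v(3) half_space_cone_eq_compatible
      using loc_equiv_iff_same_face[OF v(1,2) u] by blast
  qed
  have "polyhedral_fan ?S" "X = \<Union>?S"
    using polyhedral_fan_of_sign_classes[OF fin finA cover cls X] by blast+
  moreover have "?S \<subseteq> LGF I" using X(1) by (auto simp: LGF_def)
  ultimately show ?thesis unfolding is_subfan_def by blast
qed

end

theorem theorem5p8:
  fixes I :: "'n::finite pow set"
    and A :: "'n pow \<Rightarrow> 'n set \<Rightarrow> nat ^ 'n \<Rightarrow> (nat ^ 'n) set"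
  assumes "ideal I pow_ring"
    and "admissible_choice A"
  shows "is_subfan (T_loc A I) (LGF I) \<and>
    (\<not> (\<exists>m\<in>I. is_monomial m) \<longrightarrow>
       T_loc A I = {w \<in> U_loc. \<not> (\<exists>m\<in>in_ideal w I. is_monomial m)}) \<and>
    ((\<exists>m\<in>I. is_monomial m) \<longrightarrow>
       T_loc A I = {0} \<and> {w \<in> U_loc. \<not> (\<exists>m\<in>in_ideal w I. is_monomial m)} = {})"
proof -
  interpret pow_ideal I by (rule pow_ideal.intro) (rule assms(1))
  let ?X = monomial_free_weights
  note T = T_loc_eq[OF assms(2)]
  have 0: "0 \<in> (U_loc :: (real ^ 'n) set)" by (simp add: U_loc_def)
  show ?thesis
  proof (cases "\<exists>m\<in>I. is_monomial m")
    case True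
    then obtain m c \<alpha> where m: "m \<in> I" "c \<noteq> 0" "m = (\<lambda>\<beta>. if \<beta> = \<alpha> then c else 0)"
      by (auto simp: is_monomial_def)
    have "lead_at w m \<alpha>" for w using m(2) by (simp add: lead_at_def supp_def m(3))
    then have "w \<notin> ?X" for w using m(1) unfolding monomial_free_weights_iff by blast
    then have X: "?X = {}" by blast
    have "groebner_class I 0 = {0}" using 0 by (auto simp: groebner_class_def loc_equiv_def vec_eq_iff)
    then have "is_subfan {0} (LGF I)" using 0 by (intro is_subfan_LGF) auto
    moreover have "{w \<in> U_loc. \<not> (\<exists>m\<in>in_ideal w I. is_monomial m)} = {}"
      using X unfolding monomial_free_weights_def .
    ultimately show ?thesis using True unfolding T X by blast
  next
    case False
    then have "0 \<in> ?X" using 0 in_ideal_0[OF assms(1)] by (simp add: monomial_free_weights_def)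
    then have TX: "T_loc A I = ?X" unfolding T by (rule insert_absorb)
    have "?X \<subseteq> U_loc" by (auto simp: monomial_free_weights_def)
    then have "is_subfan ?X (LGF I)"
      by (rule is_subfan_LGF) (rule closure_class_monomial_free)
    then show ?thesis using False TX by (simp add: monomial_free_weights_def)
  qed
qed

end
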